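(* Let $0<\alpha_2<\alpha_1<1$, $c_1>0$, $c_2\ge0$, $c_1+c_2=1$. For $N\in\mathbb N$ let $$h_N(t)=t^{\alpha_1-\frac{N-1}{N}}\sum_{j=0}^\infty\Big(-\frac{c_2}{c_1}\Big)^jt^{(\alpha_1-\alpha_2)j}E^{j+1}_{\alpha_1,\,\alpha_1+(\alpha_1-\alpha_2)j+\frac1N}\Big(-\frac{\lambda+k\mu}{c_1}t^{\alpha_1}\Big).$$ Then, for $t>0$, the mean queue length of the mixed time-changed Erlang queue is $$\mathcal M^{\alpha_1,\alpha_2}(t)=\frac{k(\lambda-\mu)}{c_1}t^{\alpha_1}E^1_{\alpha_1-\alpha_2,\,\alpha_1+1}\Big(-\frac{c_2}{c_1}t^{\alpha_1-\alpha_2}\Big)+k\mu\sum_{m=1}^\infty\sum_{r=0}^\infty\frac{A^0_{m,r}}{c_1^{a^0_{m,r}}}h_{a^0_{m,r}}^{*(a^0_{m,r})}(t),$$ where $a^0_{m,r}=m+r(k+1)$, $A^0_{m,r}=\dfrac{m\lambda^r(k\mu)^{m+rk-1}}{r!\,(m+rk)!}(m+r(k+1)-1)!$, and $h^{*(N)}$ denotes the $N$-fold convolution of $h$.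
   Context: Parameters: $\lambda>0$, $\mu>0$, $k\in\mathbb N=\{1,2,\dots\}$. Erlang queue: single-server queue with Poisson arrivals of rate $\lambda$, each service consisting of $k$ successive phases, each exponential with parameter $k\mu$, all independent. $\mathcal Q(t)=(\mathcal N(t),\mathcal S(t))$, where $\mathcal N(t)$ is the number of customers in the system and $\mathcal S(t)$ is the phase of the customer being served if $\mathcal N(t)>0$ (phases are counted down: service starts at phase $k$ and ends upon completion of phase $1$), with $\mathcal S(t)=0$ if $\mathcal N(t)=0$. Thus $\mathcal Q$ is the continuous-time Markov chain on $\mathcal H_0=\mathcal H\cup\{(0,0)\}$, $\mathcal H=\{(n,s)\in\mathbb N\times\mathbb N: s\le k\}$, with $\mathcal Q(0)=(0,0)$ and transition rates: $(0,0)\to(1,k)$ at rate $\lambda$; $(n,s)\to(n+1,s)$ at rate $\lambda$; $(n,s)\to(n,s-1)$ at rate $k\mu$ if $s\ge2$; $(n,1)\to(n-1,k)$ at rate $k\mu$ if $n\ge2$; $(1,1)\to(0,0)$ at rate $k\mu$. Inverse mixed stable subordinator: $\{D_{\alpha_1,\alpha_2}(t)\}_{t\ge0}$ is the nondecreasing Lévy process (started at $0$) with $\mathbb E(e^{-zD_{\alpha_1,\alpha_2}(t)})=e^{-t(c_1z^{\alpha_1}+c_2z^{\alpha_2})}$, $z>0$; $Y_{\alpha_1,\alpha_2}(t)=\inf\{s\ge0:D_{\alpha_1,\alpha_2}(s)>t\}$, $t>0$, $Y_{\alpha_1,\alpha_2}(0)=0$. Mixed time-changed Erlang queue: $\mathcal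 Q^{\alpha_1,\alpha_2}(t)=\mathcal Q(Y_{\alpha_1,\alpha_2}(t))$, with $\mathcal Q$ and $Y_{\alpha_1,\alpha_2}$ independent. Queue length process (in number of phases): $\mathcal L^{\alpha_1,\alpha_2}(t)=g_k(\mathcal Q^{\alpha_1,\alpha_2}(t))$, where $g_k:\mathcal H_0\to\mathbb N\cup\{0\}$ is the bijection $g_k(n,s)=k(n-1)+s$ for $(n,s)\in\mathcal H$, $g_k(0,0)=0$. Mean queue length: $\mathcal M^{\alpha_1,\alpha_2}(t)=\mathbb E(\mathcal L^{\alpha_1,\alpha_2}(t)\mid\mathcal L^{\alpha_1,\alpha_2}(0)=0)$. Three-parameter Mittag-Leffler function: $E^\gamma_{\alpha,\beta}(t)=\sum_{r=0}^\infty\frac{\Gamma(\gamma+r)t^r}{r!\,\Gamma(\gamma)\Gamma(\alpha r+\beta)}$, $t\in\mathbb R$, $\alpha,\beta,\gamma>0$. Convolution of functions on $(0,\infty)$: $(f*g)(t)=\int_0^tf(t-u)g(u)\,\mathrm du$, $f^{*(1)}=f$, $f^{*(N+1)}=f*f^{*(N)}$. Convention $0^0=1$. *)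

theory Defs
  imports "HOL-Probability.Probability"
begin

section \<open>Continuous-time Markov chains and the Erlang queue\<close>

text \<open>
  Transition functions of a time-homogeneous chain on a countable set \<open>S\<close> with rates \<open>q x y\<close>
  for \<open>x \<noteq> y\<close>. The generator is conservative: the total rate of leaving \<open>x\<close> is the sum
  of the \<open>q x y\<close> over \<open>y \<noteq> x\<close>. The diagonal values \<open>q x x\<close> are never used.
\<close>

definition transition_function_with_rates ::
    "'s set \<Rightarrow> ('s \<Rightarrow> 's \<Rightarrow> real) \<Rightarrow> (real \<Rightarrow> 's \<Rightarrow> 's \<Rightarrow> real) \<Rightarrow> bool" where
  "transition_function_with_rates S q P \<longleftrightarrow>
     (\<forall>t\<ge>0. \<forall>x\<in>S. \<forall>y\<in>S. 0 \<le> P t x y) \<and>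
     (\<forall>t\<ge>0. \<forall>x\<in>S. (P t x has_sum 1) S) \<and>
     (\<forall>x\<in>S. \<forall>y\<in>S. P 0 x y = (if x = y then 1 else 0)) \<and>
     (\<forall>s\<ge>0. \<forall>t\<ge>0. \<forall>x\<in>S. \<forall>z\<in>S. ((\<lambda>y. P s x y * P t y z) has_sum P (s + t) x z) S) \<and>
     (\<forall>x\<in>S. \<forall>y\<in>S. x \<noteq> y \<longrightarrow> ((\<lambda>t. P t x y / t) \<longlongrightarrow> q x y) (at_right 0)) \<and>
     (\<forall>x\<in>S. ((\<lambda>t. (1 - P t x x) / t) \<longlongrightarrow> (\<Sum>\<^sub>\<infinity>y\<in>S - {x}. q x y)) (at_right 0))"

text \<open>
  Only the restriction of the process to times \<open>t \<ge> 0\<close> is meaningful. Right continuity is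
  with respect to the discrete topology on the state space.
\<close>

definition ctmc ::
    "'a measure \<Rightarrow> 's set \<Rightarrow> ('s \<Rightarrow> 's \<Rightarrow> real) \<Rightarrow> 's \<Rightarrow> (real \<Rightarrow> 'a \<Rightarrow> 's) \<Rightarrow> bool" where
  "ctmc M S q x\<^sub>0 X \<longleftrightarrow>
     (\<forall>t\<ge>0. X t \<in> measurable M (count_space UNIV)) \<and>
     (\<forall>t\<ge>0. \<forall>\<omega>\<in>space M. X t \<omega> \<in> S) \<and>
     (\<forall>t\<ge>0. \<forall>\<omega>\<in>space M. \<forall>\<^sub>F s in at_right t. X s \<omega> = X t \<omega>) \<and>
     (AE \<omega> in M. X 0 \<omega> = x\<^sub>0) \<and>
     (\<exists>P. transition_function_with_rates S q P \<and>
        (\<forall>(n::nat) (ts :: nat \<Rightarrow> real) xs.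
           0 \<le> ts 0 \<and> (\<forall>i\<le>n. ts i \<le> ts (Suc i)) \<and> (\<forall>i\<le>Suc n. xs i \<in> S) \<and>
           \<P>(\<omega> in M. \<forall>i\<le>n. X (ts i) \<omega> = xs i) > 0 \<longrightarrow>
           \<P>(\<omega> in M. X (ts (Suc n)) \<omega> = xs (Suc n) \<bar> \<forall>i\<le>n. X (ts i) \<omega> = xs i) =
             P (ts (Suc n) - ts n) (xs n) (xs (Suc n))))"

definition erlang_states :: "nat \<Rightarrow> (nat \<times> nat) set" where
  "erlang_states k = insert (0, 0) {(n, s). 1 \<le> n \<and> 1 \<le> s \<and> s \<le> k}"

definition erlang_rate :: "real \<Rightarrow> real \<Rightarrow> nat \<Rightarrow> nat \<times> nat \<Rightarrow> nat \<times> nat \<Rightarrow> real" where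
  "erlang_rate lam mu k x y =
     (case x of (n, s) \<Rightarrow>
        if n = 0 then (if y = (1, k) then lam else 0)
        else if y = (n + 1, s) then lam
        else if s \<ge> 2 \<and> y = (n, s - 1) then real k * mu
        else if s = 1 \<and> n \<ge> 2 \<and> y = (n - 1, k) then real k * mu
        else if s = 1 \<and> n = 1 \<and> y = (0, 0) then real k * mu
        else 0)"

definition erlang_queue ::
    "'a measure \<Rightarrow> real \<Rightarrow> real \<Rightarrow> nat \<Rightarrow> (real \<Rightarrow> 'a \<Rightarrow> nat \<times> nat) \<Rightarrow> bool" where
  "erlang_queue M lam mu k Q \<longleftrightarrow> ctmc M (erlang_states k) (erlang_rate lam mu k) (0, 0) Q"

definition phase_count :: "nat \<Rightarrow> nat \<times> nat \<Rightarrow> nat" where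
  "phase_count k x = (case x of (n, s) \<Rightarrow> if n = 0 then 0 else k * (n - 1) + s)"


section \<open>The mixed stable subordinator and its inverse\<close>

definition levy_process :: "'a measure \<Rightarrow> (real \<Rightarrow> 'a \<Rightarrow> real) \<Rightarrow> bool" where
  "levy_process M X \<longleftrightarrow>
     (\<forall>t\<ge>0. X t \<in> borel_measurable M) \<and>
     (AE \<omega> in M. X 0 \<omega> = 0) \<and>
     (\<forall>(n::nat) (ts :: nat \<Rightarrow> real). 0 \<le> ts 0 \<and> (\<forall>i<n. ts i \<le> ts (Suc i)) \<longrightarrow>
        prob_space.indep_vars M (\<lambda>_. borel) (\<lambda>i \<omega>. X (ts (Suc i)) \<omega> - X (ts i) \<omega>) {..<n}) \<and>
     (\<forall>s\<ge>0. \<forall>t\<ge>0. distr M borel (\<lambda>\<omega>. X (s + t) \<omega> - X s \<omega>) = distr M borel (X t)) \<and>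
     (\<forall>\<omega>\<in>space M. \<forall>t\<ge>0. continuous (at_right t) (\<lambda>s. X s \<omega>)) \<and>
     (\<forall>\<omega>\<in>space M. \<forall>t>0. \<exists>l. ((\<lambda>s. X s \<omega>) \<longlongrightarrow> l) (at_left t))"

definition mixed_stable_subordinator ::
    "'a measure \<Rightarrow> real \<Rightarrow> real \<Rightarrow> real \<Rightarrow> real \<Rightarrow> (real \<Rightarrow> 'a \<Rightarrow> real) \<Rightarrow> bool" where
  "mixed_stable_subordinator M \<alpha>\<^sub>1 \<alpha>\<^sub>2 c\<^sub>1 c\<^sub>2 D \<longleftrightarrow>
     levy_process M D \<and>
     (\<forall>\<omega>\<in>space M. mono_on {0..} (\<lambda>t. D t \<omega>)) \<and>
     (\<forall>t\<ge>0. \<forall>z>0. (LINT \<omega>|M. exp (- z * D t \<omega>)) =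
        exp (- t * (c\<^sub>1 * z powr \<alpha>\<^sub>1 + c\<^sub>2 * z powr \<alpha>\<^sub>2)))"

text \<open>
  The infimum is taken in the extended reals, so it is \<open>\<infinity>\<close> when the path never exceeds \<open>t\<close>.
  This has probability zero, and \<open>real_of_ereal\<close> then returns \<open>0\<close>; hence the inverse is always
  a nonnegative real.
\<close>

definition inverse_subordinator :: "(real \<Rightarrow> 'a \<Rightarrow> real) \<Rightarrow> real \<Rightarrow> 'a \<Rightarrow> real" where
  "inverse_subordinator D t \<omega> =
     (if t = 0 then 0 else real_of_ereal (INF s\<in>{s. 0 \<le> s \<and> D s \<omega> > t}. ereal s))"

definition generated_events :: "'a measure \<Rightarrow> 's measure \<Rightarrow> (real \<Rightarrow> 'a \<Rightarrow> 's) \<Rightarrow> 'a set set" where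
  "generated_events M N X =
     sets (vimage_algebra (space M) (\<lambda>\<omega>. \<lambda>t\<in>{0..}. X t \<omega>) (PiM {0..} (\<lambda>_. N)))"

text \<open>\<open>indep_var\<close> is not applicable, because it needs both variables to have the same type.\<close>

definition indep_processes ::
    "'a measure \<Rightarrow> (real \<Rightarrow> 'a \<Rightarrow> 's) \<Rightarrow> (real \<Rightarrow> 'a \<Rightarrow> real) \<Rightarrow> bool" where
  "indep_processes M X Y \<longleftrightarrow>
     prob_space.indep_set M (generated_events M (count_space UNIV) X) (generated_events M borel Y)"


section \<open>The time-changed queue and its mean length\<close>

definition time_change :: "(real \<Rightarrow> 'a \<Rightarrow> 's) \<Rightarrow> (real \<Rightarrow> 'a \<Rightarrow> real) \<Rightarrow> real \<Rightarrow> 'a \<Rightarrow> 's" where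
  "time_change X Y t \<omega> = X (Y t \<omega>) \<omega>"

definition queue_length :: "nat \<Rightarrow> (real \<Rightarrow> 'a \<Rightarrow> nat \<times> nat) \<Rightarrow> real \<Rightarrow> 'a \<Rightarrow> nat" where
  "queue_length k X t \<omega> = phase_count k (X t \<omega>)"

definition given_empty :: "'a measure \<Rightarrow> (real \<Rightarrow> 'a \<Rightarrow> nat) \<Rightarrow> 'a measure" where
  "given_empty M L = uniform_measure M {\<omega> \<in> space M. L 0 \<omega> = 0}"

definition mean_queue_length :: "'a measure \<Rightarrow> (real \<Rightarrow> 'a \<Rightarrow> nat) \<Rightarrow> real \<Rightarrow> real" where
  "mean_queue_length M L t = (LINT \<omega>|given_empty M L. real (L t \<omega>))"


section \<open>Special functions and coefficients\<close>

text \<open>\<open>mittag_leffler3 \<gamma> \<alpha> \<beta>\<close> is the function usually written \<open>E\<close> with upper index \<open>\<gamma>\<close> and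
  lower indices \<open>\<alpha>, \<beta>\<close>.\<close>

definition mittag_leffler3 :: "real \<Rightarrow> real \<Rightarrow> real \<Rightarrow> real \<Rightarrow> real" where
  "mittag_leffler3 \<gamma> \<alpha> \<beta> t =
     (\<Sum>r. Gamma (\<gamma> + real r) * t ^ r / (fact r * Gamma \<gamma> * Gamma (\<alpha> * real r + \<beta>)))"

definition half_line_conv :: "(real \<Rightarrow> real) \<Rightarrow> (real \<Rightarrow> real) \<Rightarrow> real \<Rightarrow> real" where
  "half_line_conv f g t = (LINT u:{0<..<t}|lborel. f (t - u) * g u)"

text \<open>The \<open>N\<close>-fold convolution for \<open>N \<ge> 1\<close>; the value at \<open>N = 0\<close> is junk.\<close>

definition conv_power :: "(real \<Rightarrow> real) \<Rightarrow> nat \<Rightarrow> real \<Rightarrow> real" where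
  "conv_power f N = (half_line_conv f ^^ (N - 1)) f"

definition h_fun ::
    "real \<Rightarrow> real \<Rightarrow> nat \<Rightarrow> real \<Rightarrow> real \<Rightarrow> real \<Rightarrow> real \<Rightarrow> nat \<Rightarrow> real \<Rightarrow> real" where
  "h_fun lam mu k \<alpha>\<^sub>1 \<alpha>\<^sub>2 c\<^sub>1 c\<^sub>2 N t =
     t powr (\<alpha>\<^sub>1 - (real N - 1) / real N) *
     (\<Sum>j. (- (c\<^sub>2 / c\<^sub>1)) ^ j * t powr ((\<alpha>\<^sub>1 - \<alpha>\<^sub>2) * real j) *
        mittag_leffler3 (real j + 1) \<alpha>\<^sub>1 (\<alpha>\<^sub>1 + (\<alpha>\<^sub>1 - \<alpha>\<^sub>2) * real j + 1 / real N)
          (- ((lam + real k * mu) / c\<^sub>1) * t powr \<alpha>\<^sub>1))"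

definition a0 :: "nat \<Rightarrow> nat \<Rightarrow> nat \<Rightarrow> nat" where
  "a0 k m r = m + r * (k + 1)"

text \<open>Used for \<open>m \<ge> 1\<close> and \<open>k \<ge> 1\<close> only, where the natural-number subtractions do not truncate.\<close>

definition A0 :: "real \<Rightarrow> real \<Rightarrow> nat \<Rightarrow> nat \<Rightarrow> nat \<Rightarrow> real" where
  "A0 lam mu k m r =
     real m * lam ^ r * (real k * mu) ^ (m + r * k - 1) / (fact r * fact (m + r * k)) *
     fact (m + r * (k + 1) - 1)"

end

theory Submission
  imports Defs
begin

text \<open>
  In phases, the Erlang queue jumps up by \<open>k\<close> at rate \<open>lam\<close> and, unless empty, down by \<open>1\<close> at rate
  \<open>k mu\<close>. Applying the generator to \<open>u ^ phase\<close> gives a linear equation for the generating function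
  driven by the probability \<open>p\<^sub>0\<close> of being empty. Letting \<open>u\<close> tend to \<open>1\<close>, the mean at time \<open>s\<close> is
  \<open>k (lam - mu) s + k mu \<integral> p\<^sub>0\<close> over \<open>[0, s]\<close>; choosing \<open>u\<close> with symbol equal to \<open>\<theta>\<close> (the kernel method), the
  Laplace transform of \<open>p\<^sub>0\<close> at \<open>\<theta>\<close> is a geometric series in \<open>u\<close>. The powers of \<open>u\<close> are ballot
  series, because both are bounded solutions of one first-step recurrence; hence \<open>p\<^sub>0\<close> is the double series of
  Erlang densities with coefficients \<open>A0\<close>.

  By independence, the mean after the time change is the integral of the classical mean against the law of
  the inverse subordinator. For a density \<open>f\<close>, the mean of \<open>\<integral> f\<close> over \<open>[0, Y t]\<close> has in \<open>t\<close> the Laplace transform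
  \<open>F (\<phi> z) / z\<close>, where \<open>F\<close> is the transform of \<open>f\<close> and \<open>\<phi>\<close> the Laplace exponent. For Erlang densities
  this is the transform of the convolution powers of \<open>h_fun\<close>, and for \<open>f = 1\<close> that of the first term. Both sides are
  right continuous in \<open>t\<close>, so uniqueness of Laplace transforms gives equality at every \<open>t > 0\<close>.
\<close>

section \<open>Uniqueness of Laplace transforms\<close>

text \<open>The root \<open>1 / N\<close> in \<open>h_fun\<close> is what makes convolution fit the
  time change: the transform of \<open>h_fun\<close> at order \<open>N\<close> carries the factor
  \<open>s powr (- (1 / N))\<close>, whose \<open>N\<close>-th power is the single factor
  \<open>1 / s\<close> in \<open>F (\<phi> z) / z\<close>. Alternating series occur only inside one
  such term. Each term is inverted separately, with constants that need not be uniform in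
  \<open>N\<close>. The sum over \<open>m\<close> and \<open>r\<close> is taken in
  \<open>ennreal\<close>, where coefficients and densities are nonnegative and interchanges cost
  only measurability; summability of the real double series is then read off from its finite total.
  On the side of the queue, only the one-dimensional laws of the chain enter. Since the exit rates
  are bounded, the generator equation follows from the short-time limits of the transition function,
  but only for bounded test functions; the unbounded phase count is therefore reached as a limit of
  powers.\<close>

lemma char_eq_moment_series:
  assumes "real_distribution M" and "AE x in M. 0 \<le> x \<and> x \<le> 1"
  shows "char M t = (\<Sum>n. ((\<i> * of_real t) ^ n /\<^sub>R fact n) * of_real (LINT x|M. x ^ n))"
proof -
  interpret real_distribution M by fact
  define f where "f n x = ((\<i> * of_real t) ^ n /\<^sub>R fact n) * complex_of_real (x ^ n)" for n x
  have bnd: "AE x in M. norm (x ^ n) \<le> 1" for n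
    using assms(2) by eventually_elim (auto simp: power_le_one)
  have int: "integrable M (\<lambda>x. x ^ n)" for n
    by (rule integrable_const_bound[where B=1]) (use bnd in auto)
  have intf: "integrable M (f n)" for n
    unfolding f_def by (intro integrable_mult_right integrable_of_real int)
  have summand_eq: "f n x = (\<i> * of_real (t * x)) ^ n /\<^sub>R fact n" for n x
    by (simp add: f_def power_mult_distrib)
  have expf: "(\<Sum>n. f n x) = iexp (t * x)" for x
    unfolding summand_eq exp_def by simp
  have summ: "summable (\<lambda>n. norm (f n x))" for x
    unfolding summand_eq by (rule summable_norm_exp)
  have normf: "(LINT x|M. norm (f n x)) \<le> \<bar>t\<bar> ^ n /\<^sub>R fact n" for n
  proof -
    have "(LINT x|M. norm (f n x)) = (LINT x|M. \<bar>t\<bar> ^ n /\<^sub>R fact n * norm (x ^ n))"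
      unfolding f_def by (simp add: norm_mult norm_power power_abs)
    also have "\<dots> \<le> (LINT x|M. \<bar>t\<bar> ^ n /\<^sub>R fact n * 1)"
    proof (rule integral_mono_AE)
      show "AE x in M. \<bar>t\<bar> ^ n /\<^sub>R fact n * norm (x ^ n) \<le> \<bar>t\<bar> ^ n /\<^sub>R fact n * 1"
        using bnd[of n] by eventually_elim (rule mult_left_mono, simp_all)
    qed (intro integrable_mult_right integrable_norm int, simp)
    finally show ?thesis using prob_space by simp
  qed
  have "char M t = (LINT x|M. (\<Sum>n. f n x))"
    unfolding char_def expf ..
  also have "\<dots> = (\<Sum>n. LINT x|M. f n x)"
  proof (rule integral_suminf[OF intf])
    show "AE x in M. summable (\<lambda>n. norm (f n x))" using summ by simp
    show "summable (\<lambda>n. LINT x|M. norm (f n x))"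
     by (rule summable_comparison_test[OF _ summable_exp_generic[of "\<bar>t\<bar>"]])
        (use normf in \<open>auto intro!: exI[of _ 0] simp: integral_nonneg_AE\<close>)
  qed
  also have "\<dots> = (\<Sum>n. ((\<i> * of_real t) ^ n /\<^sub>R fact n) * of_real (LINT x|M. x ^ n))"
    unfolding f_def by (simp del: of_real_power)
  finally show ?thesis .
qed

text \<open>On \<open>[0, 1]\<close> all moments are bounded by 1, so the characteristic function
  can be integrated term by term and is a power series in the moments. Uniqueness of characteristic
  functions does the rest.\<close>

lemma moments_determine_distribution:
  assumes "real_distribution M" "AE x in M. 0 \<le> x \<and> x \<le> 1"
    and "real_distribution N" "AE x in N. 0 \<le> x \<and> x \<le> 1"
    and "\<And>n::nat. (LINT x|M. x ^ n) = (LINT x|N. x ^ n)"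
  shows "M = N"
  by (rule Levy_uniqueness)
    (use assms in \<open>auto simp: char_eq_moment_series fun_eq_iff\<close>)

text \<open>The moment of order 0 is the total mass, so both measures can be normalised by the same
  number; mass 0 has to be treated apart. Moments are given as \<open>nn_integral\<close>, the form
  in which transforms of nonnegative functions deliver them.\<close>

lemma moments_determine_finite_measure:
  fixes M N :: "real measure"
  assumes M: "finite_measure M" "sets M = sets borel" "AE x in M. 0 \<le> x \<and> x \<le> 1"
    and N: "finite_measure N" "sets N = sets borel" "AE x in N. 0 \<le> x \<and> x \<le> 1"
    and eq: "\<And>n::nat. (\<integral>\<^sup>+x. ennreal (x ^ n) \<partial>M) = (\<integral>\<^sup>+x. ennreal (x ^ n) \<partial>N)"
  shows "M = N"
proof -
  have sp: "space M = UNIV" "space N = UNIV"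
    using sets_eq_imp_space_eq[OF M(2)] sets_eq_imp_space_eq[OF N(2)] by simp_all
  have mass: "emeasure M UNIV = emeasure N UNIV"
    using eq[of 0] sp by simp
  have fin: "emeasure M UNIV \<noteq> \<infinity>" "emeasure N UNIV \<noteq> \<infinity>"
    using finite_measure.emeasure_finite[OF M(1)] finite_measure.emeasure_finite[OF N(1)] by simp_all
  have UNIV_sets: "UNIV \<in> sets M" "UNIV \<in> sets N" using M(2) N(2) by auto
  show ?thesis
  proof (cases "emeasure M UNIV = 0")
    case True
    show ?thesis
    proof (rule measure_eqI)
      fix A assume "A \<in> sets M"
      then have "emeasure M A \<le> emeasure M UNIV" "emeasure N A \<le> emeasure N UNIV"
        using UNIV_sets by (auto intro: emeasure_mono)
      then show "emeasure M A = emeasure N A" using True mass by simp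
    qed (use M N in simp)
  next
    case False
    let ?U = "\<lambda>L. uniform_measure L UNIV"
    have *: "real_distribution (?U L)" "AE x in ?U L. 0 \<le> x \<and> x \<le> 1"
      if "emeasure L UNIV \<noteq> 0" "emeasure L UNIV \<noteq> \<infinity>" "sets L = sets borel" "AE x in L. 0 \<le> x \<and> x \<le> 1"
      for L :: "real measure"
    proof -
      interpret prob_space "?U L" using that by (intro prob_space_uniform_measure)
      show "real_distribution (?U L)" by standard (simp add: that)
      show "AE x in ?U L. 0 \<le> x \<and> x \<le> 1"
        using that(3,4) by (intro AE_uniform_measureI) auto
    qed
    have mom: "(LINT x|?U L. x ^ n) = enn2real ((\<integral>\<^sup>+x. ennreal (x ^ n) \<partial>L) / emeasure L UNIV)"
      if "sets L = sets borel" "AE x in L. 0 \<le> x \<and> x \<le> 1" for L :: "real measure" and n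
    proof -
      have [measurable_cong]: "sets L = sets borel" by fact
      have ae: "AE x in ?U L. 0 \<le> x ^ n"
      proof (rule AE_uniform_measureI)
        show "AE x in L. x \<in> UNIV \<longrightarrow> 0 \<le> x ^ n"
          using that(2) by eventually_elim simp
      qed (simp add: that(1))
      show ?thesis
        by (subst integral_eq_nn_integral[OF _ ae]) (simp_all add: nn_integral_uniform_measure)
    qed
    have "?U M = ?U N"
    proof (rule moments_determine_distribution)
      fix n :: nat
      show "(LINT x|?U M. x ^ n) = (LINT x|?U N. x ^ n)"
        unfolding mom[OF M(2,3)] mom[OF N(2,3)] eq mass ..
    qed (rule *; use False fin mass M N in simp)+
    have cancel: "x / c * c = x" if "c \<noteq> 0" "c \<noteq> \<infinity>" for x c :: ennreal
      using that by (simp add: ennreal_divide_times ennreal_divide_self top.not_eq_extremum)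
    show ?thesis
    proof (rule measure_eqI)
      fix A assume A: "A \<in> sets M"
      then have "emeasure (?U M) A = emeasure (?U N) A" using \<open>?U M = ?U N\<close> by simp
      then have "emeasure M A / emeasure M UNIV = emeasure N A / emeasure M UNIV"
        using A UNIV_sets M N mass by simp
      then show "emeasure M A = emeasure N A"
        using False fin by (metis cancel)
    qed (use M N in simp)
  qed
qed

text \<open>With values in \<open>ennreal\<close> the transform makes sense without integrability
  and commutes with sums and iterated integrals. Restricting to \<open>{0<..}\<close> discards
  whatever values a function has at times that are not positive.\<close>

definition nn_laplace :: "(real \<Rightarrow> ennreal) \<Rightarrow> real \<Rightarrow> ennreal" where
  "nn_laplace f s = (\<integral>\<^sup>+t\<in>{0<..}. ennreal (exp (- s * t)) * f t \<partial>lborel)"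

text \<open>Substituting \<open>x = exp (- t)\<close> turns the values at \<open>z + 1, z + 2, \<dots>\<close> into moments of a measure on \<open>[0, 1]\<close>.\<close>

lemma nn_laplace_unique:
  assumes f [measurable]: "f \<in> borel_measurable borel" and g [measurable]: "g \<in> borel_measurable borel"
    and eq: "\<And>s. s > z \<Longrightarrow> nn_laplace f s = nn_laplace g s"
    and fin: "\<And>s. s > z \<Longrightarrow> nn_laplace f s < \<infinity>"
  shows "AE t in lborel. t > 0 \<longrightarrow> f t = g t"
proof -
  \<comment> \<open>The weight makes the measure finite: its total mass is the transform at
    \<open>z + 1\<close>, a point strictly beyond \<open>z\<close>.\<close>
  define w where "w h t = h t * (ennreal (exp (- (z + 1) * t)) * indicator {0<..} t)" for h and t :: real
  have [measurable]: "w h \<in> borel_measurable borel" if "h \<in> borel_measurable borel" for h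
    using that unfolding w_def by measurable
  define \<nu> where "\<nu> h = distr (density lborel (w h)) borel (\<lambda>t. exp (- t))" for h
  have moment: "(\<integral>\<^sup>+x. ennreal (x ^ n) \<partial>\<nu> h) = nn_laplace h (z + 1 + real n)"
    if [measurable]: "h \<in> borel_measurable borel" for h n
  proof -
    have "(\<integral>\<^sup>+x. ennreal (x ^ n) \<partial>\<nu> h) = (\<integral>\<^sup>+t. w h t * ennreal (exp (- t) ^ n) \<partial>lborel)"
      unfolding \<nu>_def by (simp add: nn_integral_distr nn_integral_density)
    also have "\<dots> = nn_laplace h (z + 1 + real n)"
      unfolding nn_laplace_def
    proof (rule nn_integral_cong)
      fix t :: real
      have "exp (- (z + 1 + real n) * t) = exp (- (z + 1) * t) * exp (- t) ^ n"
        by (simp add: exp_of_nat_mult[symmetric] exp_add[symmetric] algebra_simps)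
      then show "w h t * ennreal (exp (- t) ^ n) =
          ennreal (exp (- (z + 1 + real n) * t)) * h t * indicator {0<..} t"
        unfolding w_def by (simp add: ennreal_mult mult_ac)
    qed
    finally show ?thesis .
  qed
  have props: "finite_measure (\<nu> h)" "sets (\<nu> h) = sets borel" "AE x in \<nu> h. 0 \<le> x \<and> x \<le> 1"
    if [measurable]: "h \<in> borel_measurable borel" and "nn_laplace h (z + 1) < \<infinity>" for h
  proof -
    have "emeasure (\<nu> h) (space (\<nu> h)) = nn_laplace h (z + 1)"
      using moment[OF that(1), of 0] by simp
    then show "finite_measure (\<nu> h)" using that by (intro finite_measureI) auto
    show "sets (\<nu> h) = sets borel" by (simp add: \<nu>_def)
    have "AE t in density lborel (w h). 0 \<le> exp (- t) \<and> exp (- t) \<le> 1"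
      by (subst AE_density) (auto simp: w_def indicator_def)
    then show "AE x in \<nu> h. 0 \<le> x \<and> x \<le> 1"
      unfolding \<nu>_def by (subst AE_distr_iff) auto
  qed
  have "\<nu> f = \<nu> g"
    using props[OF f fin] props[OF g] fin[of "z + 1"] eq[of "z + 1"]
    by (intro moments_determine_finite_measure) (auto simp: moment eq)
  \<comment> \<open>The map \<open>- ln\<close> undoes the substitution, so equality of the image
    measures returns to the densities with respect to Lebesgue measure.\<close>
  then have "distr (\<nu> f) borel (\<lambda>x. - ln x) = distr (\<nu> g) borel (\<lambda>x. - ln x)" by simp
  then have "distr (density lborel (w f)) borel (\<lambda>t. t) = distr (density lborel (w g)) borel (\<lambda>t. t)"
    unfolding \<nu>_def by (simp add: distr_distr o_def)
  then have "density lborel (w f) = density lborel (w g)"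
    by (simp add: distr_id2)
  then have "AE t in lborel. w f t = w g t"
    by (intro sigma_finite_measure.density_unique[OF sigma_finite_lborel]) auto
  then show ?thesis
  proof eventually_elim
    case (elim t)
    show ?case
    proof
      assume "t > 0"
      with elim have "f t * ennreal (exp (- (z + 1) * t)) = g t * ennreal (exp (- (z + 1) * t))"
        by (simp add: w_def)
      then have "f t * (ennreal (exp (- (z + 1) * t)) * ennreal (exp ((z + 1) * t))) =
          g t * (ennreal (exp (- (z + 1) * t)) * ennreal (exp ((z + 1) * t)))"
        by (simp only: mult.assoc[symmetric])
      moreover have "exp (- (z + 1) * t) * exp ((z + 1) * t) = 1"
        by (simp only: exp_add[symmetric] mult_minus_left add.left_inverse exp_zero)
      then have "ennreal (exp (- (z + 1) * t)) * ennreal (exp ((z + 1) * t)) = 1"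
        by (simp only: ennreal_mult[symmetric] exp_ge_zero ennreal_1)
      ultimately show "f t = g t" by (simp only: mult_1_right)
    qed
  qed
qed

section \<open>Laplace transforms of signed functions\<close>

abbreviation laplace_term :: "(real \<Rightarrow> real) \<Rightarrow> real \<Rightarrow> real \<Rightarrow> real" where
  "laplace_term f s t \<equiv> indicator {0<..} t *\<^sub>R (exp (- s * t) * f t)"

definition laplace_integrable :: "(real \<Rightarrow> real) \<Rightarrow> real \<Rightarrow> bool" where
  "laplace_integrable f s \<longleftrightarrow> set_integrable lborel {0<..} (\<lambda>t. exp (- s * t) * f t)"

definition laplace :: "(real \<Rightarrow> real) \<Rightarrow> real \<Rightarrow> real" where
  "laplace f s = (LINT t:{0<..}|lborel. exp (- s * t) * f t)"

lemmas laplace_defs =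
  laplace_integrable_def set_integrable_def laplace_def set_lebesgue_integral_def

text \<open>The positive and negative parts of the difference have equal finite
  \<open>nn_laplace\<close> transforms and hence agree almost everywhere; a number whose positive
  and negative parts coincide is 0.\<close>

lemma laplace_unique:
  assumes [measurable]: "(\<lambda>t. indicator {0<..} t * f t) \<in> borel_measurable borel"
     "(\<lambda>t. indicator {0<..} t * g t) \<in> borel_measurable borel"
    and f: "\<And>s. s > z \<Longrightarrow> laplace_integrable f s"
    and g: "\<And>s. s > z \<Longrightarrow> laplace_integrable g s"
    and eq: "\<And>s. s > z \<Longrightarrow> laplace f s = laplace g s"
  shows "AE t in lborel. t > 0 \<longrightarrow> f t = g t"
proof -
  define d where "d t = indicator {0<..} t * f t - indicator {0<..} t * g t" for t :: real
  have [measurable]: "d \<in> borel_measurable borel" unfolding d_def by measurable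
  have d: "integrable lborel (\<lambda>t. exp (- s * t) * d t)" "(LINT t|lborel. exp (- s * t) * d t) = 0" if "s > z" for s
  proof -
    have *: "exp (- s * t) * d t = laplace_term f s t - laplace_term g s t" for t
      by (simp add: d_def algebra_simps)
    show "integrable lborel (\<lambda>t. exp (- s * t) * d t)" unfolding *
      using f[OF that] g[OF that] unfolding laplace_defs by (intro Bochner_Integration.integrable_diff)
    show "(LINT t|lborel. exp (- s * t) * d t) = 0" unfolding *
      using f[OF that] g[OF that] eq[OF that] unfolding laplace_defs
      by (subst Bochner_Integration.integral_diff) auto
  qed
  define p where "p t = ennreal (d t)" for t
  define q where "q t = ennreal (- d t)" for t
  have [measurable]: "p \<in> borel_measurable borel" "q \<in> borel_measurable borel"
    unfolding p_def q_def by measurable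
  have L: "nn_laplace p s = (\<integral>\<^sup>+t. ennreal (exp (- s * t) * d t) \<partial>lborel)"
    "nn_laplace q s = (\<integral>\<^sup>+t. ennreal (- (exp (- s * t) * d t)) \<partial>lborel)" for s
  proof -
    have aux: "ennreal (exp (- s * t)) * ennreal x * indicator {0<..} t = ennreal (exp (- s * t) * x)"
      if "t \<le> 0 \<Longrightarrow> x = 0" for x t :: real
      using that by (cases "t > 0") (simp_all add: ennreal_mult')
    have d0: "t \<le> 0 \<Longrightarrow> d t = 0" "t \<le> 0 \<Longrightarrow> - d t = 0" for t by (simp_all add: d_def)
    have "ennreal (exp (- s * t)) * p t * indicator {0<..} t = ennreal (exp (- s * t) * d t)"
      "ennreal (exp (- s * t)) * q t * indicator {0<..} t = ennreal (- (exp (- s * t) * d t))" for t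
      unfolding p_def q_def by (rule aux[OF d0(1)], assumption, unfold mult_minus_right[symmetric], rule aux[OF d0(2)], assumption)
    then show "nn_laplace p s = (\<integral>\<^sup>+t. ennreal (exp (- s * t) * d t) \<partial>lborel)"
      "nn_laplace q s = (\<integral>\<^sup>+t. ennreal (- (exp (- s * t) * d t)) \<partial>lborel)"
      unfolding nn_laplace_def by simp_all
  qed
  have fin: "nn_laplace p s < \<infinity>" "nn_laplace q s < \<infinity>" if "s > z" for s
    unfolding L using d(1)[OF that] by (auto simp: real_integrable_def top.not_eq_extremum)
  have eqL: "nn_laplace p s = nn_laplace q s" if "s > z" for s
  proof -
    have "enn2real (nn_laplace p s) = enn2real (nn_laplace q s)"
      using d(2)[OF that] real_lebesgue_integral_def[OF d(1)[OF that]] unfolding L by simp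
    then have "ennreal (enn2real (nn_laplace p s)) = ennreal (enn2real (nn_laplace q s))"
      by (rule arg_cong)
    then show ?thesis
      using fin[OF that] by (simp only: ennreal_enn2real infinity_ennreal_def)
  qed
  have "AE t in lborel. t > 0 \<longrightarrow> p t = q t"
    by (rule nn_laplace_unique[where z = z]) (use eqL fin in auto)
  then show ?thesis
  proof eventually_elim
    case (elim t)
    show ?case
    proof
      assume "t > 0"
      with elim have "ennreal (d t) = ennreal (- d t)" by (simp add: p_def q_def)
      then have "d t = 0"
        by (cases "d t" "0 :: real" rule: linorder_cases) (auto simp: ennreal_neg)
      with \<open>t > 0\<close> show "f t = g t" by (simp add: d_def)
    qed
  qed
qed

section \<open>Mittag-Leffler functions\<close>

text \<open>The power allows the integrable singularity at 0 that \<open>h_fun\<close> has, with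
  \<open>b = 1 / N\<close>; \<open>z\<close> fixes where the transform converges. The constant
  \<open>C\<close> is an explicit parameter so that a series of functions can be controlled by the
  series of its constants.\<close>

definition exp_bounded :: "real \<Rightarrow> real \<Rightarrow> real \<Rightarrow> (real \<Rightarrow> real) \<Rightarrow> bool" where
  "exp_bounded b z C f \<longleftrightarrow>
     continuous_on {0<..} f \<and> (\<forall>t>0. \<bar>f t\<bar> \<le> C * (t powr (b - 1) * exp (z * t)))"

lemma exp_bounded_nonneg:
  assumes "exp_bounded b z C f"
  shows "0 \<le> C"
proof -
  have "\<bar>f 1\<bar> \<le> C * exp z" using assms unfolding exp_bounded_def by (auto dest: spec[of _ 1])
  then have "0 \<le> C * exp z" by (rule order_trans[OF abs_ge_zero])
  then show ?thesis by (simp add: zero_le_mult_iff)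
qed

lemma exp_bounded_cmult:
  assumes "exp_bounded b z C f"
  shows "exp_bounded b z (\<bar>c\<bar> * C) (\<lambda>t. c * f t)"
  using assms unfolding exp_bounded_def
  by (auto intro!: continuous_intros mult_left_mono simp: abs_mult mult.assoc)

lemma exp_bounded_cong:
  assumes "\<And>t. t > 0 \<Longrightarrow> f t = g t"
  shows "exp_bounded b z C f \<longleftrightarrow> exp_bounded b z C g"
  using assms continuous_on_cong[OF refl, of "{0<..}" f g] unfolding exp_bounded_def by auto

text \<open>Euler's integral for \<open>Gamma b\<close> with the variable rescaled by
  \<open>s\<close>. Computing it first as an \<open>nn_integral\<close> yields integrability
  together with the value.\<close>

lemma laplace_power:
  assumes "b > 0" "s > 0"
  shows "laplace_integrable (\<lambda>t. t powr (b - 1)) s"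
    and "laplace (\<lambda>t. t powr (b - 1)) s = Gamma b * s powr (- b)"
proof -
  have "ennreal (Gamma b) = (\<integral>\<^sup>+t. ennreal (indicator {0..} t * t powr (b - 1) / exp t) \<partial>lborel)"
    using assms by (rule_tac Gamma_conv_nn_integral_real)
  also have "\<dots> = \<bar>s\<bar> * (\<integral>\<^sup>+t. ennreal (indicator {0..} (0 + s * t) * (0 + s * t) powr (b - 1) / exp (0 + s * t)) \<partial>lborel)"
    using assms by (intro nn_integral_real_affine) auto
  also have "(\<integral>\<^sup>+t. ennreal (indicator {0..} (0 + s * t) * (0 + s * t) powr (b - 1) / exp (0 + s * t)) \<partial>lborel) =
     (\<integral>\<^sup>+t. ennreal (s powr (b - 1)) * ennreal (indicator {0<..} t *\<^sub>R (exp (- s * t) * t powr (b - 1))) \<partial>lborel)"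
    using assms by (intro nn_integral_cong)
      (auto simp: indicator_def powr_mult ennreal_mult'[symmetric] exp_minus field_simps zero_le_mult_iff)
  also have "\<dots> = ennreal (s powr (b - 1)) *
     (\<integral>\<^sup>+t. ennreal (indicator {0<..} t *\<^sub>R (exp (- s * t) * t powr (b - 1))) \<partial>lborel)"
    by (rule nn_integral_cmult) measurable
  finally have "ennreal (s powr (- b)) * ennreal (Gamma b) = ennreal (s powr (- b)) * (ennreal \<bar>s\<bar> * (ennreal (s powr (b - 1)) *
     (\<integral>\<^sup>+t. ennreal (indicator {0<..} t *\<^sub>R (exp (- s * t) * t powr (b - 1))) \<partial>lborel)))"
    by simp
  moreover have "s powr (- b) * (s * s powr (b - 1)) = 1"
    using assms by (simp add: powr_minus powr_diff field_simps)
  then have "ennreal (s powr (- b)) * (ennreal \<bar>s\<bar> * ennreal (s powr (b - 1))) = 1"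
    using assms by (simp flip: ennreal_mult)
  ultimately have "(\<integral>\<^sup>+t. ennreal (indicator {0<..} t *\<^sub>R (exp (- s * t) * t powr (b - 1))) \<partial>lborel)
      = ennreal (Gamma b * s powr (- b))"
    using assms Gamma_real_pos[of b] by (simp add: ennreal_mult mult.assoc[symmetric]) (simp add: mult.commute)
  then have "integrable lborel (\<lambda>t. indicator {0<..} t *\<^sub>R (exp (- s * t) * t powr (b - 1))) \<and>
    (LINT t|lborel. indicator {0<..} t *\<^sub>R (exp (- s * t) * t powr (b - 1))) = Gamma b * s powr (- b)"
    using assms Gamma_real_pos[of b] by (subst nn_integral_eq_integrable[symmetric]) auto
  then show "laplace_integrable (\<lambda>t. t powr (b - 1)) s"
    and "laplace (\<lambda>t. t powr (b - 1)) s = Gamma b * s powr (- b)"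
    by (auto simp: laplace_defs)
qed

lemma exp_bounded_measurable:
  assumes "exp_bounded b z C f"
  shows "(\<lambda>t. indicator {0<..} t * f t) \<in> borel_measurable borel"
  using borel_measurable_continuous_on_indicator[of "{0<..}" f] assms
  by (simp add: exp_bounded_def)

text \<open>The second bound is linear in \<open>C\<close>: summable constants therefore give
  summable \<open>L1\<close> norms, as the exchange of sum and integral requires.\<close>

lemma exp_bounded_laplace:
  assumes f: "exp_bounded b z C f" and "b > 0" "s > z"
  shows "laplace_integrable f s"
    and "(LINT t|lborel. norm (laplace_term f s t)) \<le> C * (Gamma b * (s - z) powr (- b))"
proof -
  let ?g = "\<lambda>t. indicator {0<..} t *\<^sub>R (exp (- (s - z) * t) * t powr (b - 1))"
  have g: "integrable lborel ?g" "(LINT t|lborel. ?g t) = Gamma b * (s - z) powr (- b)"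
    using laplace_power[of b "s - z"] assms
    by (auto simp: laplace_defs)
  have le: "norm (laplace_term f s t) \<le> C * ?g t" for t
  proof (cases "t > 0")
    case True
    have "norm (exp (- s * t) * f t) = exp (- s * t) * \<bar>f t\<bar>" by (simp add: abs_mult)
    also have "\<dots> \<le> exp (- s * t) * (C * (t powr (b - 1) * exp (z * t)))"
      using f True unfolding exp_bounded_def by (intro mult_left_mono) auto
    also have "\<dots> = C * (exp (- (s - z) * t) * t powr (b - 1))"
    proof -
      have "exp (- (s - z) * t) = exp (- s * t) * exp (z * t)"
        by (simp add: exp_add[symmetric] algebra_simps)
      then show ?thesis by simp
    qed
    finally show ?thesis using True by simp
  qed simp
  have meas: "laplace_term f s \<in> borel_measurable lborel"
  proof -
    have "(\<lambda>t. exp (- s * t) * (indicator {0<..} t * f t)) \<in> borel_measurable lborel"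
      using exp_bounded_measurable[OF f] by measurable
    then show ?thesis by (simp add: mult_ac)
  qed
  have int: "integrable lborel (laplace_term f s)"
  proof (rule Bochner_Integration.integrable_bound[OF integrable_mult_right[OF g(1), of C] meas], rule AE_I2)
    fix t
    show "norm (laplace_term f s t) \<le> norm (C * ?g t)"
      using order_trans[OF le[of t] abs_ge_self] by (simp only: real_norm_def)
  qed
  then show "laplace_integrable f s" by (simp add: laplace_defs)
  have "(LINT t|lborel. norm (laplace_term f s t)) \<le> (LINT t|lborel. C * ?g t)"
    using le by (intro integral_mono integrable_norm int integrable_mult_right g(1))
  also have "\<dots> = C * (Gamma b * (s - z) powr (- b))"
    using g(2) by (subst integral_mult_right_zero) simp
  finally show "(LINT t|lborel. norm (laplace_term f s t)) \<le> C * (Gamma b * (s - z) powr (- b))" .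
qed

text \<open>The constants serve as a majorant three times: pointwise for summability, uniformly on
  compact intervals for continuity, and in \<open>L1\<close> norm for the termwise
  transform.\<close>

lemma exp_bounded_suminf:
  assumes f: "\<And>i. exp_bounded b z (C i) (f i)" and C: "summable C" and b: "b > 0"
  shows "exp_bounded b z (suminf C) (\<lambda>t. \<Sum>i. f i t)"
    and "\<And>t. t > 0 \<Longrightarrow> summable (\<lambda>i. f i t)"
    and "\<And>s. s > z \<Longrightarrow> (\<lambda>i. laplace (f i) s) sums laplace (\<lambda>t. \<Sum>i. f i t) s"
proof -
  have bd: "\<bar>f i t\<bar> \<le> C i * (t powr (b - 1) * exp (z * t))" if "t > 0" for i t
    using f[of i] that by (auto simp: exp_bounded_def)
  have sabs: "summable (\<lambda>i. norm (f i t))" if "t > 0" for t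
    by (rule summable_comparison_test[OF _ summable_mult2[OF C]]) (use bd[OF that] in auto)
  show summ: "summable (\<lambda>i. f i t)" if "t > 0" for t
    using sabs[OF that] by (rule summable_norm_cancel)
  have "continuous_on {0<..} (\<lambda>t. \<Sum>i. f i t)"
  proof (intro continuous_at_imp_continuous_on ballI)
    fix x :: real assume "x \<in> {0<..}"
    then have x: "x > 0" by simp
    \<comment> \<open>The interval stays away from 0, where \<open>t powr (b - 1)\<close> may be
      unbounded.\<close>
    let ?S = "{x / 2..2 * x}"
    have "continuous_on ?S (\<lambda>t. t powr (b - 1) * exp (z * t))"
      using x by (intro continuous_intros) auto
    then have "bounded ((\<lambda>t. t powr (b - 1) * exp (z * t)) ` ?S)"
      by (intro compact_imp_bounded compact_continuous_image) auto
    then obtain K where "\<forall>y\<in>(\<lambda>t. t powr (b - 1) * exp (z * t)) ` ?S. norm y \<le> K"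
      unfolding bounded_iff by blast
    then have K: "t powr (b - 1) * exp (z * t) \<le> K" if "t \<in> ?S" for t
      using that by (auto dest!: bspec intro: order_trans[OF abs_ge_self])
    have "uniform_limit ?S (\<lambda>n t. \<Sum>i<n. f i t) (\<lambda>t. \<Sum>i. f i t) sequentially"
    proof (rule Weierstrass_m_test)
      fix n t assume t: "t \<in> ?S"
      have "norm (f n t) \<le> C n * (t powr (b - 1) * exp (z * t))" using bd[of t n] t x by simp
      also have "\<dots> \<le> C n * K"
        using K[OF t] exp_bounded_nonneg[OF f[of n]] by (rule mult_left_mono)
      finally show "norm (f n t) \<le> C n * K" .
    qed (rule summable_mult2[OF C])
    moreover have "continuous_on ?S (\<lambda>t. \<Sum>i<n. f i t)" for n
    proof (rule continuous_on_sum)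
      fix i
      have "continuous_on {0<..} (f i)" using f by (simp add: exp_bounded_def)
      then show "continuous_on ?S (f i)" by (rule continuous_on_subset) (use x in auto)
    qed
    ultimately have "continuous_on ?S (\<lambda>t. \<Sum>i. f i t)"
      by (intro uniform_limit_theorem[where F = sequentially]) auto
    moreover have "x \<in> interior ?S" using x by (simp add: interior_atLeastAtMost_real)
    ultimately show "isCont (\<lambda>t. \<Sum>i. f i t) x" by (rule continuous_on_interior)
  qed
  moreover have "\<bar>\<Sum>i. f i t\<bar> \<le> suminf C * (t powr (b - 1) * exp (z * t))" if t: "t > 0" for t
  proof -
    have "\<bar>\<Sum>i. f i t\<bar> \<le> (\<Sum>i. norm (f i t))"
      using summable_norm[OF sabs[OF t]] by simp
    also have "\<dots> \<le> (\<Sum>i. C i * (t powr (b - 1) * exp (z * t)))"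
      using bd[OF t] by (intro suminf_le sabs[OF t] summable_mult2[OF C]) auto
    also have "\<dots> = suminf C * (t powr (b - 1) * exp (z * t))"
      by (rule suminf_mult2[OF C, symmetric])
    finally show ?thesis .
  qed
  ultimately show "exp_bounded b z (suminf C) (\<lambda>t. \<Sum>i. f i t)"
    by (simp add: exp_bounded_def)
  show "(\<lambda>i. laplace (f i) s) sums laplace (\<lambda>t. \<Sum>i. f i t) s" if s: "s > z" for s
  proof -
    let ?g = "\<lambda>i t. laplace_term (f i) s t"
    have "(\<lambda>i. integral\<^sup>L lborel (?g i)) sums (LINT t|lborel. (\<Sum>i. ?g i t))"
    proof (rule sums_integral)
      show "integrable lborel (?g i)" for i
        using exp_bounded_laplace(1)[OF f b s] by (simp add: laplace_defs)
      show "AE t in lborel. summable (\<lambda>i. norm (?g i t))"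
      proof (rule AE_I2)
        fix t :: real
        show "summable (\<lambda>i. norm (?g i t))"
        proof (cases "t > 0")
          case True
          then show ?thesis using summable_mult[OF sabs[OF True], of "exp (- s * t)"] by (simp add: abs_mult)
        qed simp
      qed
      show "summable (\<lambda>i. LINT t|lborel. norm (?g i t))"
        by (rule summable_comparison_test[OF _ summable_mult2[OF C, of "Gamma b * (s - z) powr (- b)"]])
          (use exp_bounded_laplace(2)[OF f b s] in \<open>auto simp: integral_nonneg_AE\<close>)
    qed
    moreover have "(\<Sum>i. ?g i t) = indicator {0<..} t *\<^sub>R (exp (- s * t) * (\<Sum>i. f i t))" for t
      by (cases "t > 0") (simp_all add: suminf_mult[OF summ])
    ultimately show ?thesis by (simp add: laplace_def set_lebesgue_integral_def)
  qed
qed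

text \<open>Restrict Euler's integral for \<open>Gamma (\<beta> + 1)\<close> to \<open>{x..}\<close>
  and bound the power below by its value at \<open>x\<close>. The shift to
  \<open>\<beta> + 1\<close> makes the power increasing even if \<open>\<beta> < 1\<close>;
  returning by the functional equation costs the division by \<open>\<beta>\<close>.\<close>

lemma Gamma_ge:
  fixes \<beta> x :: real
  assumes "\<beta> > 0" "x > 0"
  shows "x powr \<beta> * exp (- x) / \<beta> \<le> Gamma \<beta>"
proof -
  have "(\<integral>\<^sup>+t. ennreal (exp (- t)) * indicator {x..} t \<partial>lborel) = ennreal (0 - (- exp (- x)))"
    by (rule nn_integral_FTC_atLeast) (auto intro!: derivative_eq_intros, real_asymp)
  then have "ennreal (x powr \<beta> * exp (- x)) = ennreal (x powr \<beta>) * (\<integral>\<^sup>+t. ennreal (exp (- t)) * indicator {x..} t \<partial>lborel)"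
    by (simp add: ennreal_mult)
  also have "\<dots> = (\<integral>\<^sup>+t. ennreal (x powr \<beta>) * (ennreal (exp (- t)) * indicator {x..} t) \<partial>lborel)"
    by (rule nn_integral_cmult[symmetric]) measurable
  also have "\<dots> \<le> (\<integral>\<^sup>+t. ennreal (indicator {0..} t * t powr ((\<beta> + 1) - 1) / exp t) \<partial>lborel)"
    using assms by (intro nn_integral_mono)
      (auto simp: indicator_def exp_minus field_simps ennreal_mult'[symmetric] intro!: divide_right_mono powr_mono2)
  also have "\<dots> = ennreal (Gamma (\<beta> + 1))"
    using assms by (subst Gamma_conv_nn_integral_real) auto
  finally have "x powr \<beta> * exp (- x) \<le> Gamma (\<beta> + 1)"
    using assms by (simp add: Gamma_real_nonneg)
  also have "\<dots> = \<beta> * Gamma \<beta>" using assms by (intro Gamma_plus1) (auto simp: nonpos_Ints_def)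
  finally show ?thesis using assms by (simp add: field_simps)
qed

text \<open>\<open>Gamma_ge\<close> is applied at \<open>x = exp 1 * w * (1 + t)\<close>; the factor \<open>exp 1\<close> absorbs the \<open>\<beta>\<close> of that bound.\<close>

lemma exp_bounded_monomial:
  assumes "0 < b" "b \<le> \<beta>" "w > 0"
  shows "exp_bounded b (exp 1 * w) (exp (exp 1 * w) * w powr (- \<beta>)) (\<lambda>t. t powr (\<beta> - 1) / Gamma \<beta>)"
  unfolding exp_bounded_def
proof (intro conjI allI impI)
  have \<beta>: "\<beta> > 0" using assms by simp
  have G: "Gamma \<beta> > 0" using \<beta> by (rule Gamma_real_pos)
  show "continuous_on {0<..} (\<lambda>t. t powr (\<beta> - 1) / Gamma \<beta>)"
    using G by (intro continuous_intros) auto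
  fix t :: real assume t: "t > 0"
  define x where "x = exp 1 * w * (1 + t)"
  have x: "x > 0" using t assms by (simp add: x_def)
  have xp: "x powr \<beta> = exp \<beta> * w powr \<beta> * (1 + t) powr \<beta>"
    unfolding x_def using assms t by (simp add: powr_mult exp_powr_real)
  \<comment> \<open>Replacing \<open>t\<close> by \<open>1 + t\<close> makes the base at least 1, so
    the exponent can be raised from \<open>\<beta> - b\<close> to \<open>\<beta>\<close> for small
    and large \<open>t\<close> alike.\<close>
  have "t powr (\<beta> - b) \<le> (1 + t) powr (\<beta> - b)" using t assms by (intro powr_mono2) auto
  also have "\<dots> \<le> (1 + t) powr \<beta>" using t assms by (intro powr_mono) auto
  finally have tb: "t powr (\<beta> - b) \<le> (1 + t) powr \<beta>" .
  have \<beta>e: "\<beta> \<le> exp \<beta>" using exp_ge_add_one_self[of \<beta>] by linarith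
  have "1 / Gamma \<beta> \<le> \<beta> * exp x / x powr \<beta>"
    using Gamma_ge[OF \<beta> x] G x \<beta> by (simp add: field_simps exp_minus)
  then have "t powr (\<beta> - b) * (1 / Gamma \<beta>) \<le> (1 + t) powr \<beta> * (\<beta> * exp x / x powr \<beta>)"
    using tb G by (intro mult_mono) auto
  also have "\<dots> = (\<beta> / exp \<beta>) * (exp x * w powr (- \<beta>))"
    using t assms unfolding xp by (simp add: powr_minus field_simps)
  also have "\<dots> \<le> 1 * (exp x * w powr (- \<beta>))"
    using \<beta>e by (intro mult_right_mono) auto
  finally have *: "t powr (\<beta> - b) / Gamma \<beta> \<le> exp x * w powr (- \<beta>)" by simp
  have "\<bar>t powr (\<beta> - 1) / Gamma \<beta>\<bar> = t powr (b - 1) * (t powr (\<beta> - b) / Gamma \<beta>)"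
    using G by (simp flip: powr_add)
  also have "\<dots> \<le> t powr (b - 1) * (exp x * w powr (- \<beta>))"
    using * by (rule mult_left_mono) simp
  also have "exp x = exp (exp 1 * w) * exp (exp 1 * w * t)"
    by (simp add: x_def exp_add[symmetric] algebra_simps)
  finally show "\<bar>t powr (\<beta> - 1) / Gamma \<beta>\<bar> \<le> exp (exp 1 * w) * w powr (- \<beta>) * (t powr (b - 1) * exp (exp 1 * w * t))"
    by (simp add: mult_ac)
qed

lemma laplace_cmult: "laplace (\<lambda>t. c * f t) s = c * laplace f s"
proof -
  have "exp (- s * t) * (c * f t) = c * (exp (- s * t) * f t)" for t by simp
  then show ?thesis unfolding laplace_def by (simp only: set_integral_mult_right)
qed

lemma laplace_monomial:
  assumes "\<beta> > 0" "s > 0"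
  shows "laplace (\<lambda>t. t powr (\<beta> - 1) / Gamma \<beta>) s = s powr (- \<beta>)"
  using laplace_power(2)[OF assms] laplace_cmult[of "1 / Gamma \<beta>" "\<lambda>t. t powr (\<beta> - 1)" s] Gamma_real_pos[OF assms(1)]
  by simp

text \<open>The generalised binomial series at exponent \<open>- Suc j\<close>. It sums both the
  constants and the transforms of the Mittag-Leffler series.\<close>

lemma negative_binomial_sums:
  fixes y :: real
  assumes "\<bar>y\<bar> < 1"
  shows "(\<lambda>r. real ((j + r) choose r) * y ^ r) sums (1 / (1 - y) ^ Suc j)"
proof -
  have "((- real (Suc j)) gchoose r) * (- y) ^ r = real ((j + r) choose r) * y ^ r" for r
  proof -
    have "(- real (Suc j)) gchoose r = (- 1) ^ r * (real (j + r) gchoose r)"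
      using gbinomial_minus[of "real (Suc j)" r] by (simp add: algebra_simps)
    moreover have "(- 1) ^ r * (- y) ^ r = y ^ r"
      by (simp only: power_mult_distrib[symmetric]) simp
    ultimately show ?thesis
      by (simp only: binomial_gbinomial mult.commute[of "(- 1) ^ r"] mult.assoc)
  qed
  moreover have "(1 + - y) powr (- real (Suc j)) = 1 / (1 - y) ^ Suc j"
    using assms by (subst powr_minus) (simp add: powr_realpow divide_inverse del: of_nat_Suc power_Suc)
  ultimately show ?thesis
    using gen_binomial_real[of "- y" "- real (Suc j)"] assms by simp
qed

section \<open>Three-parameter Mittag-Leffler series with integer upper index\<close>

lemma mittag_leffler3_nat:
  "mittag_leffler3 (real j + 1) \<alpha> \<beta> x = (\<Sum>r. real ((j + r) choose r) * x ^ r / Gamma (\<alpha> * real r + \<beta>))"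
  unfolding mittag_leffler3_def
proof (intro arg_cong[where f = suminf] ext)
  fix r
  have "Gamma (real j + 1 + real r) = fact (j + r)" "Gamma (real j + 1) = fact j"
    using Gamma_fact[of "j + r", where 'a = real] Gamma_fact[of j, where 'a = real] by (simp_all add: algebra_simps)
  then show "Gamma (real j + 1 + real r) * x ^ r / (fact r * Gamma (real j + 1) * Gamma (\<alpha> * real r + \<beta>)) =
      real ((j + r) choose r) * x ^ r / Gamma (\<alpha> * real r + \<beta>)"
    by (simp add: binomial_fact)
qed

text \<open>The parameter \<open>w\<close> is free. A monomial has transform
  \<open>s powr (- \<beta>)\<close> and constant proportional to \<open>w powr (- \<beta>)\<close>,
  so the constants form the same negative binomial series as the transforms, evaluated at
  \<open>w\<close> with absolute values; it converges once \<open>w\<close> is large.\<close>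

lemma mittag_leffler3_laplace:
  fixes j :: nat
  assumes "\<alpha> > 0" "0 < b" "b \<le> \<beta>" "w > 0" and small: "\<bar>x\<bar> * w powr (- \<alpha>) < 1"
  defines "f \<equiv> \<lambda>t. t powr (\<beta> - 1) * mittag_leffler3 (real j + 1) \<alpha> \<beta> (- x * t powr \<alpha>)"
  shows "exp_bounded b (exp 1 * w)
      (exp (exp 1 * w) * w powr (- \<beta>) * (1 / (1 - \<bar>x\<bar> * w powr (- \<alpha>)) ^ Suc j)) f"
    and "\<And>s. s > exp 1 * w \<Longrightarrow> laplace f s = s powr (- \<beta>) * (1 / (1 + x * s powr (- \<alpha>)) ^ Suc j)"
proof -
  define g where "g r t = (real ((j + r) choose r) * (- x) ^ r) * (t powr ((\<alpha> * real r + \<beta>) - 1) / Gamma (\<alpha> * real r + \<beta>))" for r t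
  define D where "D = exp (exp 1 * w) * w powr (- \<beta>)"
  define C where "C r = \<bar>real ((j + r) choose r) * (- x) ^ r\<bar> * (exp (exp 1 * w) * w powr (- (\<alpha> * real r + \<beta>)))" for r
  have \<beta>r: "b \<le> \<alpha> * real r + \<beta>" for r using assms by (simp add: add_increasing)
  have wpow: "v powr (- (\<alpha> * real r + \<beta>)) = v powr (- \<beta>) * (v powr (- \<alpha>)) ^ r" if "v > 0" for v r
    using that by (simp add: powr_power powr_add[symmetric] algebra_simps)
  have Cr: "C r = D * (real ((j + r) choose r) * (\<bar>x\<bar> * w powr (- \<alpha>)) ^ r)" for r
    unfolding C_def D_def wpow[OF \<open>w > 0\<close>] by (simp add: abs_mult power_abs power_mult_distrib mult_ac)
  have "(\<lambda>r. real ((j + r) choose r) * (\<bar>x\<bar> * w powr (- \<alpha>)) ^ r) sums (1 / (1 - \<bar>x\<bar> * w powr (- \<alpha>)) ^ Suc j)"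
    using small by (intro negative_binomial_sums) simp
  then have C: "C sums (D * (1 / (1 - \<bar>x\<bar> * w powr (- \<alpha>)) ^ Suc j))"
    unfolding Cr by (rule sums_mult)
  have gb: "exp_bounded b (exp 1 * w) (C r) (g r)" for r
    unfolding C_def g_def using \<beta>r assms by (intro exp_bounded_cmult exp_bounded_monomial)
  note S = exp_bounded_suminf[OF gb sums_summable[OF C] assms(2)]
  have fg: "f t = (\<Sum>r. g r t)" if t: "t > 0" for t
  proof -
    have term_eq: "g r t = t powr (\<beta> - 1) * (real ((j + r) choose r) * (- x * t powr \<alpha>) ^ r / Gamma (\<alpha> * real r + \<beta>))" for r
    proof -
      have "t powr ((\<alpha> * real r + \<beta>) - 1) = t powr (\<beta> - 1) * (t powr \<alpha>) ^ r"
        using t by (simp add: powr_power powr_add[symmetric] algebra_simps)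
      then show ?thesis unfolding g_def by (simp only: power_mult_distrib times_divide_eq_right mult_ac)
    qed
    have "summable (\<lambda>r. t powr (\<beta> - 1) * (real ((j + r) choose r) * (- x * t powr \<alpha>) ^ r / Gamma (\<alpha> * real r + \<beta>)))"
      using S(2)[OF t] unfolding term_eq .
    then have "summable (\<lambda>r. real ((j + r) choose r) * (- x * t powr \<alpha>) ^ r / Gamma (\<alpha> * real r + \<beta>))"
      using t by (subst (asm) summable_cmult_iff) auto
    then show ?thesis unfolding f_def mittag_leffler3_nat term_eq by (rule suminf_mult[symmetric])
  qed
  show "exp_bounded b (exp 1 * w)
      (exp (exp 1 * w) * w powr (- \<beta>) * (1 / (1 - \<bar>x\<bar> * w powr (- \<alpha>)) ^ Suc j)) f"
    using S(1) unfolding sums_unique[OF C, symmetric] D_def by (subst exp_bounded_cong[OF fg])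
  show "laplace f s = s powr (- \<beta>) * (1 / (1 + x * s powr (- \<alpha>)) ^ Suc j)" if s: "s > exp 1 * w" for s
  proof -
    \<comment> \<open>The abscissa \<open>exp 1 * w\<close> lies beyond \<open>w\<close>, so the
      smallness assumed at \<open>w\<close> is inherited by every admissible
      \<open>s\<close>.\<close>
    have "w < exp 1 * w" using assms by simp
    then have sw: "s > w" "s > 0" using s assms by linarith+
    have "\<bar>x\<bar> * s powr (- \<alpha>) \<le> \<bar>x\<bar> * w powr (- \<alpha>)"
      using sw assms by (intro mult_left_mono powr_mono2') auto
    then have "\<bar>- x * s powr (- \<alpha>)\<bar> < 1" using small by (simp add: abs_mult)
    then have "(\<lambda>r. s powr (- \<beta>) * (real ((j + r) choose r) * (- x * s powr (- \<alpha>)) ^ r)) sums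
        (s powr (- \<beta>) * (1 / (1 - (- x * s powr (- \<alpha>))) ^ Suc j))"
      by (intro sums_mult negative_binomial_sums)
    moreover have "laplace (g r) s = s powr (- \<beta>) * (real ((j + r) choose r) * (- x * s powr (- \<alpha>)) ^ r)" for r
    proof -
      have "laplace (g r) s = real ((j + r) choose r) * (- x) ^ r * s powr (- (\<alpha> * real r + \<beta>))"
        unfolding g_def laplace_cmult using \<beta>r[of r] assms sw by (subst laplace_monomial) auto
      then show ?thesis unfolding wpow[OF sw(2)] by (simp only: power_mult_distrib mult_ac)
    qed
    ultimately have "laplace (\<lambda>t. \<Sum>r. g r t) s = s powr (- \<beta>) * (1 / (1 + x * s powr (- \<alpha>)) ^ Suc j)"
      using S(3)[OF s] by (simp add: sums_iff)
    moreover have "laplace f s = laplace (\<lambda>t. \<Sum>r. g r t) s"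
      unfolding laplace_def by (rule set_lebesgue_integral_cong) (auto simp: fg)
    ultimately show ?thesis by simp
  qed
qed

section \<open>Convolution powers\<close>

text \<open>Extended by 0 and multiplied by the exponential, the two factors have an ordinary
  convolution on the whole line; Fubini and translation invariance give the product.\<close>

lemma half_line_conv_laplace:
  assumes f: "exp_bounded a z C f" and g: "exp_bounded b z C' g"
    and a: "a > 0" and b: "b > 0" and s: "s > z"
  shows "laplace (half_line_conv f g) s = laplace f s * laplace g s"
proof -
  define F where "F t = exp (- s * t) * (indicator {0<..} t * f t)" for t
  define G where "G t = exp (- s * t) * (indicator {0<..} t * g t)" for t
  have eqs: "F = laplace_term f s"
    "G = laplace_term g s"
    by (auto simp: F_def G_def)
  have F: "integrable lborel F" "integral\<^sup>L lborel F = laplace f s"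
    and G: "integrable lborel G" "integral\<^sup>L lborel G = laplace g s"
    using exp_bounded_laplace(1)[OF f a s] exp_bounded_laplace(1)[OF g b s]
    unfolding eqs laplace_defs by simp_all
  note [measurable] = borel_measurable_integrable[OF F(1)] borel_measurable_integrable[OF G(1)]
  have shift: "integrable lborel (\<lambda>t. F (t - u))" "(LINT t|lborel. F (t - u)) = integral\<^sup>L lborel F" for u
    using lborel_integrable_real_affine[OF F(1), of 1 "- u"] lborel_integral_real_affine[of 1 F "- u"]
    by (simp_all add: algebra_simps)
  have shiftn: "(LINT t|lborel. norm (F (t - u))) = (LINT t|lborel. norm (F t))" for u
    using lborel_integral_real_affine[of 1 "\<lambda>t. norm (F t)" "- u"] by (simp add: algebra_simps)
  have inner: "(LINT u|lborel. F (t - u) * G u) = indicator {0<..} t *\<^sub>R (exp (- s * t) * half_line_conv f g t)" for t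
  proof -
    have "F (t - u) * G u = (indicator {0<..} t * exp (- s * t)) * (indicator {0<..<t} u *\<^sub>R (f (t - u) * g u))" for u
    proof -
      have "exp (- s * (t - u)) * exp (- s * u) = exp (- s * t)" by (simp add: exp_add[symmetric] algebra_simps)
      then show ?thesis by (auto simp: F_def G_def indicator_def)
    qed
    then show ?thesis
      unfolding half_line_conv_def set_lebesgue_integral_def by simp
  qed
  have "integrable (lborel \<Otimes>\<^sub>M lborel) (case_prod (\<lambda>u t. F (t - u) * G u))"
  proof (rule lborel_pair.Fubini_integrable)
    show "(case_prod (\<lambda>u t. F (t - u) * G u)) \<in> borel_measurable (lborel \<Otimes>\<^sub>M lborel)" by measurable
    show "integrable lborel (\<lambda>u. LINT t|lborel. norm (case (u, t) of (u, t) \<Rightarrow> F (t - u) * G u))"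
      using G(1) by (simp add: abs_mult shiftn[simplified])
    show "AE u in lborel. integrable lborel (\<lambda>t. case (u, t) of (u, t) \<Rightarrow> F (t - u) * G u)"
      using shift(1) by simp
  qed
  then have "(LINT t|lborel. LINT u|lborel. F (t - u) * G u) = (LINT u|lborel. LINT t|lborel. F (t - u) * G u)"
    by (rule lborel_pair.Fubini_integral)
  also have "\<dots> = laplace f s * laplace g s"
    by (simp add: shift F(2) G(2))
  finally show ?thesis unfolding inner by (simp add: laplace_def set_lebesgue_integral_def)
qed

text \<open>Moves \<open>t\<close> from the domain of integration into the integrand, so that one
  dominating function on \<open>{0<..<1}\<close> can serve for varying \<open>t\<close>.\<close>

lemma half_line_conv_rescale:
  assumes "t > 0"
  shows "half_line_conv f g t = (LINT v:{0<..<1}|lborel. t * (f (t * (1 - v)) * g (t * v)))"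
proof -
  have "half_line_conv f g t = \<bar>t\<bar> *\<^sub>R (LINT v|lborel. indicator {0<..<t} (0 + t * v) *\<^sub>R (f (t - (0 + t * v)) * g (0 + t * v)))"
    unfolding half_line_conv_def set_lebesgue_integral_def using assms
    by (intro lborel_integral_real_affine) auto
  also have "(\<lambda>v. indicator {0<..<t} (0 + t * v) *\<^sub>R (f (t - (0 + t * v)) * g (0 + t * v)))
     = (\<lambda>v. indicator {0<..<1} v *\<^sub>R (f (t * (1 - v)) * g (t * v)))"
    using assms by (intro ext) (auto simp: indicator_def algebra_simps zero_less_mult_iff)
  finally show ?thesis
    using assms by (simp add: set_lebesgue_integral_def mult.left_commute)
qed

text \<open>After rescaling, the integrand is dominated by the Beta integrand \<open>B\<close> times
  \<open>w t\<close>. The powers of \<open>t\<close> combine to \<open>a + b - 1\<close>, and the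
  two exponentials multiply to one with the same \<open>z\<close>, so repeated convolution does not
  move the abscissa.\<close>

lemma half_line_conv_exp_bounded:
  assumes f: "exp_bounded a z C f" and g: "exp_bounded b z C' g"
    and a: "a > 0" and b: "b > 0"
  shows "\<exists>K. exp_bounded (a + b) z K (half_line_conv f g)"
proof -
  define B where "B v = indicator {0<..<1} v * ((1 - v) powr (a - 1) * v powr (b - 1))" for v :: real
  define H where "H t v = indicator {0<..<1} v *\<^sub>R (t * (f (t * (1 - v)) * g (t * v)))" for t v :: real
  define w where "w t = C * C' * (t powr (a + b - 1) * exp (z * t))" for t
  have C0: "0 \<le> C" "0 \<le> C'" using f g by (auto intro: exp_bounded_nonneg)
  have w0: "0 \<le> w t" for t unfolding w_def using C0 by simp
  have B0: "0 \<le> B v" for v by (simp add: B_def)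
  have B: "integrable lborel B"
  proof -
    have "B = (\<lambda>v. indicator {0..1} v *\<^sub>R (v powr (b - 1) * (1 - v) powr (a - 1)))"
      by (auto simp: B_def indicator_def fun_eq_iff)
    then show ?thesis using integrable_Beta[OF b a] by (simp only: set_integrable_def)
  qed
  have conv: "half_line_conv f g t = integral\<^sup>L lborel (H t)" if "t > 0" for t
  proof -
    have "H t = (\<lambda>v. indicator {0<..<1} v *\<^sub>R (t * (f (t * (1 - v)) * g (t * v))))"
      by (simp only: H_def fun_eq_iff simp_thms)
    then show ?thesis
      using half_line_conv_rescale[OF that, of f g] by (simp only: set_lebesgue_integral_def)
  qed
  have cf: "continuous_on {0<..} f" and cg: "continuous_on {0<..} g"
    using f g by (auto simp: exp_bounded_def)
  have Hm: "H t \<in> borel_measurable lborel" if "t > 0" for t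
  proof -
    have "continuous_on {0<..<1} (\<lambda>v. t * (f (t * (1 - v)) * g (t * v)))"
      using that by (intro continuous_intros continuous_on_compose2[OF cf] continuous_on_compose2[OF cg]) auto
    then have "(\<lambda>v. indicator {0<..<1} v *\<^sub>R (t * (f (t * (1 - v)) * g (t * v)))) \<in> borel_measurable borel"
      by (intro borel_measurable_continuous_on_indicator) auto
    then show ?thesis by (simp add: H_def[abs_def])
  qed
  have Hle: "norm (H t v) \<le> w t * B v" if t: "t > 0" for t v
  proof (cases "v \<in> {0<..<1}")
    case True
    then have v: "0 < v" "v < 1" by auto
    have fb: "\<bar>f (t * (1 - v))\<bar> \<le> C * ((t * (1 - v)) powr (a - 1) * exp (z * (t * (1 - v))))"
      using f t v unfolding exp_bounded_def by auto
    have gb: "\<bar>g (t * v)\<bar> \<le> C' * ((t * v) powr (b - 1) * exp (z * (t * v)))"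
      using g t v unfolding exp_bounded_def by auto
    have "norm (H t v) = t * (\<bar>f (t * (1 - v))\<bar> * \<bar>g (t * v)\<bar>)"
      using True t by (simp add: H_def abs_mult)
    also have "\<dots> \<le> t * ((C * ((t * (1 - v)) powr (a - 1) * exp (z * (t * (1 - v))))) *
        (C' * ((t * v) powr (b - 1) * exp (z * (t * v)))))"
      using t C0 by (intro mult_left_mono mult_mono fb gb) auto
    also have "\<dots> = C * C' * (t * t powr (a - 1) * t powr (b - 1)) *
        (exp (z * (t * (1 - v))) * exp (z * (t * v))) * B v"
      using t v True by (simp add: B_def powr_mult)
    also have "exp (z * (t * (1 - v))) * exp (z * (t * v)) = exp (z * t)"
      by (simp add: exp_add[symmetric] algebra_simps)
    also have "t * t powr (a - 1) * t powr (b - 1) = t powr (a + b - 1)"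
    proof -
      have "t powr 1 * t powr (a - 1) * t powr (b - 1) = t powr (1 + (a - 1) + (b - 1))"
        by (simp only: powr_add)
      also have "1 + (a - 1) + (b - 1) = a + b - 1" by simp
      finally show ?thesis using t by simp
    qed
    finally show ?thesis by (simp add: w_def mult.assoc)
  qed (use w0 B0 in \<open>simp add: H_def\<close>)
  have bound: "\<bar>half_line_conv f g t\<bar> \<le> w t * integral\<^sup>L lborel B" if t: "t > 0" for t
  proof -
    have "norm (integral\<^sup>L lborel (H t)) \<le> (LINT v|lborel. w t * B v)"
    proof (rule Bochner_Integration.integral_norm_bound_integral)
      show wB: "integrable lborel (\<lambda>v. w t * B v)" by (rule integrable_mult_right[OF B])
      show "integrable lborel (H t)"
        by (rule Bochner_Integration.integrable_bound[OF wB Hm[OF t]])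
          (use Hle[OF t] w0 B0 in \<open>auto simp: abs_mult\<close>)
    qed (rule Hle[OF t])
    then show ?thesis unfolding conv[OF t] by simp
  qed
  have "continuous_on {0<..} (half_line_conv f g)"
    unfolding continuous_on_sequentially
  proof (intro allI ballI impI, elim conjE)
    fix x :: "nat \<Rightarrow> real" and t assume t: "t \<in> {0<..}" and x: "\<forall>n. x n \<in> {0<..}" and lim: "x \<longlonglongrightarrow> t"
    \<comment> \<open>Convergence of \<open>w (x n)\<close> bounds these factors, which makes the
      majorant independent of \<open>n\<close>.\<close>
    have "(\<lambda>n. w (x n)) \<longlonglongrightarrow> w t"
      unfolding w_def using t by (intro tendsto_intros lim) auto
    then have "Bseq (\<lambda>n. w (x n))" by (intro convergent_imp_Bseq convergentI)
    then obtain K where K: "\<And>n. norm (w (x n)) \<le> K" unfolding Bseq_def by blast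
    have "(\<lambda>n. integral\<^sup>L lborel (H (x n))) \<longlonglongrightarrow> integral\<^sup>L lborel (H t)"
    proof (rule integral_dominated_convergence[where w = "\<lambda>v. K * B v"])
      show "integrable lborel (\<lambda>v. K * B v)" by (intro integrable_mult_right B)
      show "AE v in lborel. (\<lambda>n. H (x n) v) \<longlonglongrightarrow> H t v"
      proof (rule AE_I2)
        fix v
        show "(\<lambda>n. H (x n) v) \<longlonglongrightarrow> H t v"
        proof (cases "v \<in> {0<..<1}")
          case True
          then have v: "0 < v" "v < 1" by auto
          have "isCont f (t * (1 - v))" "isCont g (t * v)"
            using cf cg t v by (auto simp: continuous_on_eq_continuous_at)
          then show ?thesis unfolding H_def
            by (intro tendsto_intros lim isCont_tendsto_compose[of _ f] isCont_tendsto_compose[of _ g])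
        qed (simp add: H_def)
      qed
      show "AE v in lborel. norm (H (x n) v) \<le> K * B v" for n
      proof (rule AE_I2)
        fix v
        have "norm (H (x n) v) \<le> w (x n) * B v" using Hle x by simp
        also have "\<dots> \<le> K * B v" using K[of n] B0 by (intro mult_right_mono) auto
        finally show "norm (H (x n) v) \<le> K * B v" .
      qed
    qed (use Hm t x in auto)
    then show "(half_line_conv f g \<circ> x) \<longlonglongrightarrow> half_line_conv f g t"
      using conv t x by (simp add: o_def)
  qed
  with bound have "exp_bounded (a + b) z (C * C' * integral\<^sup>L lborel B) (half_line_conv f g)"
    unfolding exp_bounded_def w_def by (simp add: mult_ac)
  then show ?thesis ..
qed

text \<open>The exponent at 0 is tracked because it improves: with \<open>b = 1 / N\<close>, the
  \<open>N\<close>-fold power has exponent 1 and is bounded near 0. Writing the order as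
  \<open>Suc n\<close> avoids the junk value at 0.\<close>

lemma conv_power_laplace:
  assumes f: "exp_bounded b z C f" and b: "b > 0"
  shows "(\<exists>K. exp_bounded (real (Suc n) * b) z K (conv_power f (Suc n))) \<and>
    (\<forall>s>z. laplace (conv_power f (Suc n)) s = laplace f s ^ Suc n)"
proof (induction n)
  case 0
  then show ?case using f by (auto simp: conv_power_def)
next
  case (Suc n)
  have rec: "conv_power f (Suc (Suc n)) = half_line_conv f (conv_power f (Suc n))"
    by (simp add: conv_power_def)
  from Suc obtain K where K: "exp_bounded (real (Suc n) * b) z K (conv_power f (Suc n))" by blast
  have n: "real (Suc n) * b > 0" using b by simp
  have "b + real (Suc n) * b = real (Suc (Suc n)) * b" by (simp add: algebra_simps)
  then have "\<exists>K. exp_bounded (real (Suc (Suc n)) * b) z K (conv_power f (Suc (Suc n)))"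
    using half_line_conv_exp_bounded[OF f K b n] by (simp only: rec)
  moreover have "laplace (conv_power f (Suc (Suc n))) s = laplace f s ^ Suc (Suc n)" if "s > z" for s
    using half_line_conv_laplace[OF f K b n that] Suc that by (simp add: rec)
  ultimately show ?case by blast
qed

text \<open>Two nested expansions of the same fraction: each Mittag-Leffler transform sums a series
  in \<open>x * s powr (- a1)\<close>, and the sum over \<open>j\<close> is the geometric series in
  \<open>- y * s powr a2 / (s powr a1 + x)\<close>.\<close>

lemma h_fun_laplace:
  fixes lam mu a1 a2 c1 c2 :: real and k N :: nat
  defines "x \<equiv> (lam + real k * mu) / c1" and "y \<equiv> c2 / c1"
  assumes "lam > 0" "mu > 0" "0 < a2" "a2 < a1" "c1 > 0" "c2 \<ge> 0" "N \<ge> 1"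
  obtains z C where "z > 0" "exp_bounded (1 / real N) z C (h_fun lam mu k a1 a2 c1 c2 N)"
    "\<And>s. s > z \<Longrightarrow> laplace (h_fun lam mu k a1 a2 c1 c2 N) s =
       s powr (- (1 / real N)) / (s powr a1 + y * s powr a2 + x)"
proof -
  define b where "b = 1 / real N"
  define d where "d = a1 - a2"
  have b: "b > 0" and d: "d > 0" and \<alpha>: "a1 > 0" using assms by (auto simp: b_def d_def)
  have x: "x > 0" and y: "y \<ge> 0" using assms by (auto simp: x_def y_def add_pos_nonneg)
  \<comment> \<open>The bound \<open>1 / 2\<close> gives \<open>q > 1 / 2\<close>; the bound
    \<open>1 / 4\<close> then makes the ratio \<open>y * w powr (- d) / q\<close> of the geometric
    majorant less than \<open>1 / 2\<close>.\<close>
  have "((\<lambda>w. x * w powr (- a1)) \<longlongrightarrow> 0) at_top" "((\<lambda>w. y * w powr (- d)) \<longlongrightarrow> 0) at_top"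
    using \<alpha> d by real_asymp+
  then have "\<forall>\<^sub>F w in at_top. x * w powr (- a1) < 1 / 2" "\<forall>\<^sub>F w in at_top. y * w powr (- d) < 1 / 4"
    by (auto dest: order_tendstoD(2)[where a = "1 / 2"] order_tendstoD(2)[where a = "1 / 4"])
  then have "\<forall>\<^sub>F w in at_top. w > 0 \<and> x * w powr (- a1) < 1 / 2 \<and> y * w powr (- d) < 1 / 4"
    using eventually_gt_at_top[of 0] by eventually_elim auto
  then obtain w where w: "w > 0" "x * w powr (- a1) < 1 / 2" "y * w powr (- d) < 1 / 4"
    using eventually_happens[of _ "at_top :: real filter"] by (auto simp: trivial_limit_at_top_linorder)
  define z where "z = exp 1 * w"
  define \<beta> where "\<beta> j = a1 + d * real j + b" for j
  define f where "f j t = t powr (\<beta> j - 1) * mittag_leffler3 (real j + 1) a1 (\<beta> j) (- x * t powr a1)" for j t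
  define g where "g j t = (- y) ^ j * f j t" for j t
  define q where "q = 1 - x * w powr (- a1)"
  define E where "E j = exp (exp 1 * w) * w powr (- \<beta> j) * (1 / q ^ Suc j)" for j
  have q: "q > 1 / 2" using w by (simp add: q_def)
  have \<beta>b: "b \<le> \<beta> j" for j using \<alpha> d by (simp add: \<beta>_def)
  have small: "\<bar>x\<bar> * w powr (- a1) < 1" using w x by simp
  have fb: "exp_bounded b z (E j) (f j)" for j
    using mittag_leffler3_laplace(1)[OF \<alpha> b \<beta>b w(1) small, of j j] x
    unfolding E_def f_def z_def q_def by simp
  have fl: "laplace (f j) s = s powr (- \<beta> j) * (1 / (1 + x * s powr (- a1)) ^ Suc j)" if "s > z" for s j
    using mittag_leffler3_laplace(2)[OF \<alpha> b \<beta>b w(1) small, of s j j] that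
    unfolding f_def z_def by simp
  have \<beta>pow: "v powr (- \<beta> j) = v powr (- (a1 + b)) * (v powr (- d)) ^ j" if "v > 0" for v j
    using that by (simp add: \<beta>_def powr_power powr_add[symmetric] algebra_simps)
  have gb: "exp_bounded b z (\<bar>(- y) ^ j\<bar> * E j) (g j)" for j
    unfolding g_def by (intro exp_bounded_cmult fb)
  have "\<bar>(- y) ^ j\<bar> * E j = exp (exp 1 * w) * w powr (- (a1 + b)) / q * (y * w powr (- d) / q) ^ j" for j
    unfolding E_def \<beta>pow[OF w(1)] using y by (simp add: power_mult_distrib power_divide power_abs mult_ac)
  moreover have "\<bar>y * w powr (- d) / q\<bar> < 1"
    using w q y by (simp add: abs_mult field_simps)
  ultimately have sumE: "summable (\<lambda>j. \<bar>(- y) ^ j\<bar> * E j)"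
    by (simp add: summable_mult summable_geometric)
  note S = exp_bounded_suminf[OF gb sumE b]
  let ?h = "h_fun lam mu k a1 a2 c1 c2 N"
  have hg: "?h t = (\<Sum>j. g j t)" if t: "t > 0" for t
  proof -
    define e where "e j = (- (c2 / c1)) ^ j * t powr ((a1 - a2) * real j) *
        mittag_leffler3 (real j + 1) a1 (a1 + (a1 - a2) * real j + 1 / real N)
          (- ((lam + real k * mu) / c1) * t powr a1)" for j
    have "a1 - (real N - 1) / real N = a1 + b - 1"
      using assms by (simp add: b_def diff_divide_distrib)
    then have he: "?h t = t powr (a1 + b - 1) * (\<Sum>j. e j)"
      unfolding h_fun_def e_def by (simp only:)
    have ge: "g j t = t powr (a1 + b - 1) * e j" for j
    proof -
      have "t powr (\<beta> j - 1) = t powr (a1 + b - 1) * t powr (d * real j)"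
        by (simp add: \<beta>_def algebra_simps flip: powr_add)
      then show ?thesis unfolding g_def f_def e_def x_def y_def \<beta>_def b_def d_def by simp
    qed
    have "summable (\<lambda>j. t powr (a1 + b - 1) * e j)" using S(2)[OF t] unfolding ge .
    then have "summable e" using t by (subst (asm) summable_cmult_iff) auto
    then show ?thesis unfolding he ge by (rule suminf_mult[symmetric])
  qed
  have "exp_bounded b z (\<Sum>j. \<bar>(- y) ^ j\<bar> * E j) ?h"
    using S(1) by (subst exp_bounded_cong[OF hg])
  moreover have "laplace ?h s = s powr (- b) / (s powr a1 + y * s powr a2 + x)" if s: "s > z" for s
  proof -
    have "w \<le> exp 1 * w" using w by simp
    then have sw: "s > 0" "w \<le> s" using s w unfolding z_def by linarith+
    define p where "p = 1 + x * s powr (- a1)"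
    \<comment> \<open>The constants involve \<open>q = 1 - x * w powr (- a1)\<close>, where absolute
      values have lost the sign; the transform itself has the larger denominator
      \<open>p\<close>.\<close>
    have p: "p \<ge> 1" using x by (simp add: p_def)
    have "y * s powr (- d) \<le> y * w powr (- d)"
      using sw w y d by (intro mult_left_mono powr_mono2') auto
    then have r: "y * s powr (- d) < 1 / 4" "0 \<le> y * s powr (- d)" using w y by auto
    have "laplace (g j) s = s powr (- (a1 + b)) / p * (- (y * s powr (- d)) / p) ^ j" for j
      unfolding g_def laplace_cmult fl[OF s] \<beta>pow[OF sw(1)] p_def[symmetric]
      by (simp add: power_mult_distrib power_divide power_minus[of y] power_minus[of "y * _"] power_minus[of "y * _ / p"])
    moreover have "(\<lambda>j. s powr (- (a1 + b)) / p * (- (y * s powr (- d)) / p) ^ j) sums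
        (s powr (- (a1 + b)) / p * (1 / (1 - (- (y * s powr (- d)) / p))))"
      using r p by (intro sums_mult geometric_sums) (simp add: abs_mult field_simps)
    ultimately have "laplace (\<lambda>t. \<Sum>j. g j t) s = s powr (- (a1 + b)) / p * (1 / (1 - (- (y * s powr (- d)) / p)))"
      using S(3)[OF s] by (simp add: sums_iff)
    also have "\<dots> = s powr (- b) / (s powr a1 * (p + y * s powr (- d)))"
    proof -
      have "s powr (- (a1 + b)) = s powr (- b) / s powr a1"
        unfolding powr_diff[symmetric] by (intro arg_cong2[where f = "(powr)"]) auto
      moreover have "1 - (- (y * s powr (- d)) / p) = (p + y * s powr (- d)) / p"
        using p by (simp add: field_simps)
      ultimately show ?thesis using p by simp
    qed
    also have "s powr a1 * (p + y * s powr (- d)) = s powr a1 + y * s powr a2 + x"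
    proof -
      have "s powr a1 * s powr (- d) = s powr a2" "s powr a1 * s powr (- a1) = 1"
        using sw by (simp_all add: d_def flip: powr_add)
      then show ?thesis unfolding p_def by (simp add: algebra_simps)
    qed
    finally have "laplace (\<lambda>t. \<Sum>j. g j t) s = s powr (- b) / (s powr a1 + y * s powr a2 + x)" .
    moreover have "laplace ?h s = laplace (\<lambda>t. \<Sum>j. g j t) s"
      unfolding laplace_def by (rule set_lebesgue_integral_cong) (auto simp: hg)
    ultimately show ?thesis by simp
  qed
  moreover have "z > 0" using w by (simp add: z_def)
  ultimately show ?thesis using that unfolding b_def by blast
qed

text \<open>Dividing by \<open>c1 ^ N\<close> turns the normalised denominator of
  \<open>h_fun\<close> back into the Laplace exponent plus \<open>lam + k * mu\<close>. The result
  is the transform of an Erlang term of order \<open>N\<close> taken at that exponent, times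
  \<open>1 / s\<close>.\<close>

lemma conv_power_h_fun_laplace:
  fixes lam mu a1 a2 c1 c2 :: real and k N :: nat
  assumes "lam > 0" "mu > 0" "0 < a2" "a2 < a1" "c1 > 0" "c2 \<ge> 0" "N \<ge> 1"
  obtains z C where "z > 0"
    "exp_bounded 1 z C (\<lambda>t. conv_power (h_fun lam mu k a1 a2 c1 c2 N) N t / c1 ^ N)"
    "\<And>s. s > z \<Longrightarrow> laplace (\<lambda>t. conv_power (h_fun lam mu k a1 a2 c1 c2 N) N t / c1 ^ N) s =
       1 / (s * (c1 * s powr a1 + c2 * s powr a2 + (lam + real k * mu)) ^ N)"
proof -
  let ?h = "h_fun lam mu k a1 a2 c1 c2 N"
  let ?c = "conv_power ?h N"
  obtain z C where z: "z > 0" and h: "exp_bounded (1 / real N) z C ?h"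
    and hl: "\<And>s. s > z \<Longrightarrow> laplace ?h s =
       s powr (- (1 / real N)) / (s powr a1 + c2 / c1 * s powr a2 + (lam + real k * mu) / c1)"
    using h_fun_laplace[OF assms] by blast
  have N: "1 / real N > 0" "Suc (N - 1) = N" "real N * (1 / real N) = 1" using assms by auto
  note P = conv_power_laplace[OF h N(1), of "N - 1", unfolded N(2,3)]
  then obtain K where K: "exp_bounded 1 z K ?c" by blast
  have eq: "(\<lambda>t. ?c t / c1 ^ N) =
    (\<lambda>t. (1 / c1 ^ N) * ?c t)" by simp
  show ?thesis
  proof (rule that[OF z])
    show "exp_bounded 1 z (\<bar>1 / c1 ^ N\<bar> * K) (\<lambda>t. ?c t / c1 ^ N)"
      unfolding eq by (rule exp_bounded_cmult[OF K])
    fix s assume s: "s > z"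
    then have s0: "s > 0" using z by simp
    have root: "(s powr (- (1 / real N))) ^ N = 1 / s"
    proof -
      have "(s powr (- (1 / real N))) ^ N = s powr (real N * (- (1 / real N)))"
        using s0 by (subst powr_power) (simp_all add: mult.commute)
      also have "real N * (- (1 / real N)) = - 1" using N(3) by (simp only: mult_minus_right)
      finally show ?thesis using s0 by (simp add: powr_minus_divide)
    qed
    have "c1 * (s powr a1 + c2 / c1 * s powr a2 + (lam + real k * mu) / c1) =
        c1 * s powr a1 + c2 * s powr a2 + (lam + real k * mu)"
      using assms by (simp add: field_simps)
    then have "c1 ^ N * (s powr a1 + c2 / c1 * s powr a2 + (lam + real k * mu) / c1) ^ N =
        (c1 * s powr a1 + c2 * s powr a2 + (lam + real k * mu)) ^ N"
      by (simp only: power_mult_distrib[symmetric])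
    then show "laplace (\<lambda>t. ?c t / c1 ^ N) s =
       1 / (s * (c1 * s powr a1 + c2 * s powr a2 + (lam + real k * mu)) ^ N)"
      using P s unfolding eq laplace_cmult by (simp add: hl[OF s] power_divide root)
  qed
qed

section \<open>Chains with bounded rates\<close>

abbreviation expect :: "'s pmf \<Rightarrow> ('s \<Rightarrow> real) \<Rightarrow> real" where
  "expect p f \<equiv> measure_pmf.expectation p f"

lemma nn_integral_count_space_has_sum:
  assumes "(f has_sum (c::real)) S" and "\<And>x. x \<in> S \<Longrightarrow> 0 \<le> f x"
  shows "(\<integral>\<^sup>+x. ennreal (f x) \<partial>count_space S) = ennreal c"
proof -
  have "f summable_on S" using assms(1) by (rule has_sum_imp_summable)
  then have "Infinite_Set_Sum.abs_summable_on f S"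
    by (rule abs_summable_equivalent[THEN iffD1, OF summable_on_iff_abs_summable_on_real[THEN iffD1]])
  then show ?thesis
    using assms by (simp add: nn_integral_conv_infsetsum infsetsum_infsum infsumI)
qed

text \<open>Difference quotients are known to converge only from the right and along one sequence,
  with no continuity of \<open>g\<close>. They are therefore integrated exactly, by means of a
  primitive of \<open>G\<close>, and the Lipschitz bound lets dominated convergence pass to the
  limit.\<close>

lemma increment_limit_integral:
  fixes G g :: "real \<Rightarrow> real"
  assumes lip: "\<And>s h. 0 \<le> s \<Longrightarrow> 0 \<le> h \<Longrightarrow> \<bar>G (s + h) - G s\<bar> \<le> B * h"
    and lim: "\<And>s. 0 \<le> s \<Longrightarrow>
      (\<lambda>n. (G (s + inverse (real (Suc n))) - G s) / inverse (real (Suc n))) \<longlonglongrightarrow> g s"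
    and t: "0 \<le> t"
  shows "continuous_on {0..} G" and "(g has_integral (G t - G 0)) {0..t}"
proof -
  define h where "h n = inverse (real (Suc n))" for n
  have h: "0 < h n" "h n \<le> 1" for n by (auto simp: h_def field_simps)
  have h0: "h \<longlonglongrightarrow> 0" unfolding h_def by (rule LIMSEQ_inverse_real_of_nat)
  have B: "0 \<le> B" using order_trans[OF abs_ge_zero lip[of 0 1]] by simp
  have "B-lipschitz_on {0..} G"
  proof (rule lipschitz_onI[OF _ B])
    fix x y :: real assume "x \<in> {0..}" "y \<in> {0..}"
    then show "dist (G x) (G y) \<le> B * dist x y"
      using lip[of x "y - x"] lip[of y "x - y"]
      by (cases "x \<le> y") (auto simp: dist_real_def abs_minus_commute)
  qed
  then show cont: "continuous_on {0..} G" by (rule lipschitz_on_continuous_on)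
  define \<Phi> where "\<Phi> x = integral {0..x} G" for x
  have \<Phi>: "(\<Phi> has_field_derivative G x) (at x within {0..t + 1})" if "x \<in> {0..t + 1}" for x
    unfolding \<Phi>_def has_real_derivative_iff_has_vector_derivative using that
    by (intro integral_has_vector_derivative continuous_on_subset[OF cont]) auto
  have quot: "(\<lambda>n. (\<Phi> (x + h n) - \<Phi> x) / h n) \<longlonglongrightarrow> G x" if x: "0 \<le> x" "x \<le> t" for x
  proof -
    have "filterlim (\<lambda>n. x + h n) (at x within {0..t + 1}) sequentially"
    proof -
      have "x + h n \<in> {0..t + 1}" "x + h n \<noteq> x" for n using x h[of n] by auto
      then show ?thesis
        unfolding filterlim_at using tendsto_add[OF tendsto_const h0, of x] by simp
    qed
    from filterlim_compose[OF \<Phi>[unfolded has_field_derivative_iff] this] x show ?thesis by simp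
  qed
  show "(g has_integral (G t - G 0)) {0..t}"
  proof (rule has_integral_dominated_convergence)
    fix n
    \<comment> \<open>The integral telescopes to the average of \<open>G\<close> over
      \<open>[t, t + h n]\<close> minus its average over \<open>[0, h n]\<close>.\<close>
    show "((\<lambda>s. (G (s + h n) - G s) / h n) has_integral
        (\<Phi> (t + h n) - \<Phi> t) / h n - (\<Phi> (0 + h n) - \<Phi> 0) / h n) {0..t}"
    proof (rule fundamental_theorem_of_calculus[OF t])
      fix x assume x: "x \<in> {0..t}"
      have "((\<Phi> \<circ> (\<lambda>s. s + h n)) has_field_derivative G (x + h n) * 1) (at x within {0..t})"
        using x h[of n]
        by (intro DERIV_image_chain has_field_derivative_subset[OF \<Phi>]) (auto intro!: derivative_eq_intros add_mono)
      moreover have "(\<Phi> has_field_derivative G x) (at x within {0..t})"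
        using x by (intro has_field_derivative_subset[OF \<Phi>]) auto
      ultimately have "((\<lambda>s. (\<Phi> (s + h n) - \<Phi> s) / h n) has_field_derivative (G (x + h n) - G x) / h n) (at x within {0..t})"
        unfolding o_def by (intro DERIV_cdivide DERIV_diff) simp_all
      then show "((\<lambda>s. (\<Phi> (s + h n) - \<Phi> s) / h n) has_vector_derivative (G (x + h n) - G x) / h n) (at x within {0..t})"
        by (simp add: has_real_derivative_iff_has_vector_derivative)
    qed
    show "\<forall>s\<in>{0..t}. norm ((G (s + h n) - G s) / h n) \<le> B"
      using lip[of _ "h n"] h[of n] by (auto simp: abs_divide divide_le_eq less_imp_le)
  next
    show "(\<lambda>s. B) integrable_on {0..t}" by (rule integrable_const_ivl)
    show "\<forall>s\<in>{0..t}. (\<lambda>n. (G (s + h n) - G s) / h n) \<longlonglongrightarrow> g s"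
      using lim unfolding h_def by auto
    show "(\<lambda>n. (\<Phi> (t + h n) - \<Phi> t) / h n - (\<Phi> (0 + h n) - \<Phi> 0) / h n) \<longlonglongrightarrow> G t - G 0"
      using t by (intro tendsto_diff quot) auto
  qed
qed

lemmas pmf_integrable = measure_pmf.integrable_const_bound[where B = 1]

text \<open>The finite sets \<open>nb x\<close> contain all targets of jumps and turn the infinite
  sum for the exit rate into a finite one. The uniform bound \<open>C\<close> becomes the Lipschitz
  constant in time of every expectation below.\<close>

locale bounded_rate_chain =
  fixes S :: "'s set" and q :: "'s \<Rightarrow> 's \<Rightarrow> real" and P :: "real \<Rightarrow> 's \<Rightarrow> 's \<Rightarrow> real"
    and nb :: "'s \<Rightarrow> 's set" and C :: real
  assumes tf: "transition_function_with_rates S q P"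
    and nb: "\<And>x. x \<in> S \<Longrightarrow> finite (nb x) \<and> nb x \<subseteq> S - {x}"
    and q_zero: "\<And>x y. x \<in> S \<Longrightarrow> y \<in> S \<Longrightarrow> y \<noteq> x \<Longrightarrow> y \<notin> nb x \<Longrightarrow> q x y = 0"
    and rate_le: "\<And>x. x \<in> S \<Longrightarrow> (\<Sum>y\<in>nb x. q x y) \<le> C"
begin

lemma P_nonneg: "0 \<le> t \<Longrightarrow> x \<in> S \<Longrightarrow> y \<in> S \<Longrightarrow> 0 \<le> P t x y"
  using tf unfolding transition_function_with_rates_def by simp

lemma P_has_sum: "0 \<le> t \<Longrightarrow> x \<in> S \<Longrightarrow> (P t x has_sum 1) S"
  using tf unfolding transition_function_with_rates_def by simp

lemma P_0: "x \<in> S \<Longrightarrow> y \<in> S \<Longrightarrow> P 0 x y = (if x = y then 1 else 0)"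
  using tf unfolding transition_function_with_rates_def by simp

lemma P_add: "0 \<le> s \<Longrightarrow> 0 \<le> t \<Longrightarrow> x \<in> S \<Longrightarrow> z \<in> S \<Longrightarrow> ((\<lambda>y. P s x y * P t y z) has_sum P (s + t) x z) S"
  using tf unfolding transition_function_with_rates_def by simp

lemma filterlim_inverse_Suc: "filterlim (\<lambda>n. inverse (real (Suc n))) (at_right 0) sequentially"
  unfolding filterlim_at using LIMSEQ_inverse_real_of_nat by auto

lemma q_lim: "x \<in> S \<Longrightarrow> y \<in> S \<Longrightarrow> x \<noteq> y \<Longrightarrow>
    (\<lambda>n. P (inverse (real (Suc n))) x y / inverse (real (Suc n))) \<longlonglongrightarrow> q x y"
  using tf by (intro filterlim_compose[OF _ filterlim_inverse_Suc, of "\<lambda>t. P t x y / t"])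
    (simp add: transition_function_with_rates_def)

lemma exit_lim:
  assumes "x \<in> S"
  shows "((\<lambda>t. (1 - P t x x) / t) \<longlongrightarrow> (\<Sum>y\<in>nb x. q x y)) (at_right 0)"
proof -
  have "(\<Sum>\<^sub>\<infinity>y\<in>S - {x}. q x y) = (\<Sum>\<^sub>\<infinity>y\<in>nb x. q x y)"
    using nb[OF assms] q_zero[OF assms] by (intro infsum_cong_neutral) auto
  also have "\<dots> = (\<Sum>y\<in>nb x. q x y)" using nb[OF assms] by (intro infsum_finite) auto
  finally show ?thesis using tf assms unfolding transition_function_with_rates_def by auto
qed

text \<open>Keep only the summand \<open>y = x\<close> in each Chapman-Kolmogorov sum: being at
  \<open>x\<close> at all grid times is one way of being there at the end.\<close>

lemma P_diag_power:
  assumes "x \<in> S" "0 \<le> h"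
  shows "P h x x ^ n \<le> P (real n * h) x x"
proof (induction n)
  case (Suc n)
  have "P h x x ^ Suc n \<le> P h x x * P (real n * h) x x"
    using Suc P_nonneg[OF assms(2) assms(1) assms(1)] by (simp add: mult_left_mono)
  also have "\<dots> = (\<Sum>y\<in>{x}. P h x y * P (real n * h) y x)" by simp
  also have "\<dots> \<le> P (h + real n * h) x x"
    using assms by (intro finite_sum_le_has_sum[OF P_add] mult_nonneg_nonneg P_nonneg) auto
  also have "h + real n * h = real (Suc n) * h" by (simp add: algebra_simps)
  finally show ?case .
qed (use assms P_0 in simp)

lemma P_le_1:
  assumes "0 \<le> t" "x \<in> S" "y \<in> S"
  shows "P t x y \<le> 1"
  using finite_sum_le_has_sum[OF P_has_sum[OF assms(1,2)], of "{y}"] assms P_nonneg by auto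

text \<open>Bernoulli's inequality for \<open>P (t / n) x x ^ n\<close>; letting \<open>n\<close> grow turns the exit rate at \<open>0\<close> into a bound for all times.\<close>

lemma exit_le:
  assumes "x \<in> S" "0 \<le> t"
  shows "1 - P t x x \<le> C * t"
proof (cases "t = 0")
  case True
  then show ?thesis using assms by (simp add: P_0)
next
  case False
  define h where "h n = t * inverse (real (Suc n))" for n
  have h: "0 < h n" for n using False assms by (simp add: h_def)
  have "filterlim h (at_right 0) sequentially"
    unfolding filterlim_at using h tendsto_mult_right_zero[OF LIMSEQ_inverse_real_of_nat, of t]
    by (auto simp: h_def[abs_def] less_imp_neq[symmetric])
  from filterlim_compose[OF exit_lim[OF assms(1)] this]
  have lim: "(\<lambda>n. (1 - P (h n) x x) / h n * t) \<longlonglongrightarrow> (\<Sum>y\<in>nb x. q x y) * t"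
    by (intro tendsto_mult_right)
  have "1 - P t x x \<le> (1 - P (h n) x x) / h n * t" for n
  proof -
    have "1 + real (Suc n) * (P (h n) x x - 1) \<le> (1 + (P (h n) x x - 1)) ^ Suc n"
      using P_nonneg[of "h n" x x] h[of n] assms by (intro Bernoulli_inequality) auto
    also have "\<dots> \<le> P (real (Suc n) * h n) x x"
      using P_diag_power[OF assms(1), of "h n" "Suc n"] h[of n] by simp
    also have "real (Suc n) * h n = t" by (simp add: h_def field_simps)
    finally have "1 - P t x x \<le> real (Suc n) * (1 - P (h n) x x)" by (simp add: algebra_simps)
    also have "real (Suc n) * (1 - P (h n) x x) = (1 - P (h n) x x) / h n * t"
      using False by (simp add: h_def field_simps)
    finally show ?thesis .
  qed
  then have "1 - P t x x \<le> (\<Sum>y\<in>nb x. q x y) * t"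
    by (intro LIMSEQ_le_const[OF lim]) auto
  also have "\<dots> \<le> C * t" using rate_le[OF assms(1)] assms(2) by (rule mult_right_mono)
  finally show ?thesis .
qed

text \<open>As a \<open>pmf\<close> on the whole type, extended by 0 outside \<open>S\<close>, a row
  of the transition function can be integrated against and composed by \<open>bind_pmf\<close>.
  Meaningful for nonnegative times and starting points in \<open>S\<close>.\<close>

definition kernel :: "real \<Rightarrow> 's \<Rightarrow> 's pmf" where
  "kernel t x = embed_pmf (\<lambda>y. if y \<in> S then P t x y else 0)"

lemma pmf_kernel:
  assumes "0 \<le> t" "x \<in> S"
  shows "pmf (kernel t x) y = (if y \<in> S then P t x y else 0)"
  unfolding kernel_def
proof (rule pmf_embed_pmf)
  have "(\<integral>\<^sup>+y. ennreal (if y \<in> S then P t x y else 0) \<partial>count_space UNIV) =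
      (\<integral>\<^sup>+y. ennreal (P t x y) * indicator S y \<partial>count_space UNIV)"
    by (intro nn_integral_cong) (auto simp: indicator_def)
  also have "\<dots> = (\<integral>\<^sup>+y. ennreal (P t x y) \<partial>count_space S)"
    by (simp add: nn_integral_count_space_indicator)
  also have "\<dots> = 1"
    using nn_integral_count_space_has_sum[OF P_has_sum[OF assms]] P_nonneg assms by simp
  finally show "(\<integral>\<^sup>+y. ennreal (if y \<in> S then P t x y else 0) \<partial>count_space UNIV) = 1" .
qed (use P_nonneg assms in auto)

lemma set_kernel: "0 \<le> t \<Longrightarrow> x \<in> S \<Longrightarrow> set_pmf (kernel t x) \<subseteq> S"
  by (auto simp: set_pmf_eq pmf_kernel split: if_splits)

lemma kernel_0: "x \<in> S \<Longrightarrow> kernel 0 x = return_pmf x"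
  by (intro pmf_eqI) (auto simp: pmf_kernel P_0 pmf_return)

lemma kernel_add:
  assumes "0 \<le> s" "0 \<le> t" "x \<in> S"
  shows "kernel (s + t) x = bind_pmf (kernel s x) (kernel t)"
proof (rule pmf_eqI)
  fix z
  have "ennreal (pmf (bind_pmf (kernel s x) (kernel t)) z) =
      (\<integral>\<^sup>+y. ennreal (pmf (kernel s x) y) * ennreal (pmf (kernel t y) z) \<partial>count_space UNIV)"
    by (simp add: ennreal_pmf_bind nn_integral_measure_pmf)
  also have "\<dots> = (\<integral>\<^sup>+y. ennreal (P s x y * (if z \<in> S then P t y z else 0)) * indicator S y \<partial>count_space UNIV)"
    using assms P_nonneg
    by (intro nn_integral_cong) (auto simp: pmf_kernel indicator_def ennreal_mult')
  also have "\<dots> = (\<integral>\<^sup>+y. ennreal (P s x y * (if z \<in> S then P t y z else 0)) \<partial>count_space S)"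
    by (simp add: nn_integral_count_space_indicator)
  also have "\<dots> = ennreal (pmf (kernel (s + t) x) z)"
  proof (cases "z \<in> S")
    case True
    then show ?thesis
      using nn_integral_count_space_has_sum[OF P_add[OF assms True]] assms P_nonneg by (simp add: pmf_kernel)
  qed (use assms in \<open>simp add: pmf_kernel\<close>)
  finally show "pmf (kernel (s + t) x) z = pmf (bind_pmf (kernel s x) (kernel t)) z" by simp
qed

section \<open>The generator on test functions with values in \<open>[0, 1]\<close>\<close>

context
  fixes \<rho> :: "'s \<Rightarrow> real"
  assumes \<rho>: "\<And>x. 0 \<le> \<rho> x" "\<And>x. \<rho> x \<le> 1"
begin

lemma integrable_\<rho>: "integrable (measure_pmf p) \<rho>"
  using \<rho> by (intro pmf_integrable) auto

lemma expectation_\<rho>_bounds: "0 \<le> expect p \<rho>" "expect p \<rho> \<le> 1"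
  using \<rho> by (auto intro!: integral_nonneg measure_pmf.integral_le_const integrable_\<rho>)

lemma expectation_kernel_add:
  assumes "0 \<le> s" "0 \<le> t" "x \<in> S"
  shows "expect (kernel (s + t) x) \<rho> =
    expect (kernel s x) (\<lambda>y. expect (kernel t y) \<rho>)"
proof -
  have "ennreal (expect (kernel (s + t) x) \<rho>) = (\<integral>\<^sup>+y. ennreal (\<rho> y) \<partial>kernel (s + t) x)"
    using \<rho> by (subst nn_integral_eq_integral[OF integrable_\<rho>]) auto
  also have "\<dots> = (\<integral>\<^sup>+y. \<integral>\<^sup>+z. ennreal (\<rho> z) \<partial>kernel t y \<partial>kernel s x)"
    by (simp add: kernel_add[OF assms])
  also have "\<dots> = (\<integral>\<^sup>+y. ennreal (expect (kernel t y) \<rho>) \<partial>kernel s x)"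
    using \<rho> by (simp add: nn_integral_eq_integral[OF integrable_\<rho>])
  also have "\<dots> = ennreal (expect (kernel s x) (\<lambda>y. expect (kernel t y) \<rho>))"
    using expectation_\<rho>_bounds
    by (intro nn_integral_eq_integral pmf_integrable) auto
  finally show ?thesis
    by (subst (asm) ennreal_inj) (auto intro!: Bochner_Integration.integral_nonneg expectation_\<rho>_bounds)
qed

text \<open>States outside \<open>insert x F\<close> contribute at most their total probability,
  since values of \<open>\<rho>\<close> differ by at most 1. The choice \<open>F = {}\<close> yields
  the uniform Lipschitz bound, \<open>F = nb x\<close> the generator.\<close>

lemma expectation_kernel_diff:
  assumes "0 \<le> h" "x \<in> S"
  shows "\<bar>expect (kernel h x) \<rho> - \<rho> x\<bar> \<le> C * h"
    and "finite F \<Longrightarrow> F \<subseteq> S - {x} \<Longrightarrow>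
      \<bar>expect (kernel h x) \<rho> - \<rho> x - (\<Sum>y\<in>F. P h x y * (\<rho> y - \<rho> x))\<bar>
      \<le> 1 - P h x x - (\<Sum>y\<in>F. P h x y)"
proof -
  let ?K = "kernel h x"
  have main: "\<bar>expect ?K \<rho> - \<rho> x - (\<Sum>y\<in>F. P h x y * (\<rho> y - \<rho> x))\<bar>
      \<le> 1 - P h x x - (\<Sum>y\<in>F. P h x y)" if F: "finite F" "F \<subseteq> S - {x}" for F
  proof -
    let ?R = "- insert x F"
    have bd: "\<bar>\<rho> y - \<rho> x\<bar> \<le> 1" for y
      using \<rho>(1)[of x] \<rho>(1)[of y] \<rho>(2)[of x] \<rho>(2)[of y] by linarith
    have int: "integrable ?K (\<lambda>y. (\<rho> y - \<rho> x) * indicator A y)" for A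
      using bd by (intro pmf_integrable AE_I2) (auto simp: indicator_def)
    have "expect ?K \<rho> - \<rho> x = expect ?K (\<lambda>y. \<rho> y - \<rho> x)"
      by (simp add: integrable_\<rho>)
    also have "\<dots> = expect ?K (\<lambda>y. (\<rho> y - \<rho> x) * indicator F y + (\<rho> y - \<rho> x) * indicator ?R y)"
      by (intro Bochner_Integration.integral_cong) (auto simp: indicator_def)
    also have "\<dots> = expect ?K (\<lambda>y. (\<rho> y - \<rho> x) * indicator F y) +
        expect ?K (\<lambda>y. (\<rho> y - \<rho> x) * indicator ?R y)"
      by (intro Bochner_Integration.integral_add int)
    also have "expect ?K (\<lambda>y. (\<rho> y - \<rho> x) * indicator F y) = (\<Sum>y\<in>F. (\<rho> y - \<rho> x) * indicator F y * pmf ?K y)"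
      using F by (intro integral_measure_pmf_real) (auto split: split_indicator_asm)
    also have "\<dots> = (\<Sum>y\<in>F. P h x y * (\<rho> y - \<rho> x))"
      using F assms by (intro sum.cong) (auto simp: pmf_kernel)
    finally have "\<bar>expect ?K \<rho> - \<rho> x - (\<Sum>y\<in>F. P h x y * (\<rho> y - \<rho> x))\<bar> =
        norm (expect ?K (\<lambda>y. (\<rho> y - \<rho> x) * indicator ?R y))" by simp
    also have "\<dots> \<le> expect ?K (\<lambda>y. norm ((\<rho> y - \<rho> x) * indicator ?R y))"
      by (rule integral_norm_bound)
    also have "\<dots> \<le> expect ?K (indicator ?R)"
    proof (rule integral_mono[OF integrable_norm[OF int]])
      show "norm ((\<rho> y - \<rho> x) * indicator ?R y) \<le> indicator ?R y" for y
        using bd[of y] by (auto simp: indicator_def)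
    qed (auto intro!: pmf_integrable)
    also have "\<dots> = 1 - measure_pmf.prob ?K (insert x F)"
      using measure_pmf.prob_compl[of "insert x F" ?K] by (simp add: Compl_eq_Diff_UNIV)
    also have "measure_pmf.prob ?K (insert x F) = P h x x + (\<Sum>y\<in>F. P h x y)"
    proof -
      have "measure_pmf.prob ?K (insert x F) = (\<Sum>y\<in>insert x F. pmf ?K y)"
        using F by (intro measure_measure_pmf_finite) simp
      also have "\<dots> = (\<Sum>y\<in>insert x F. P h x y)"
        using F assms by (intro sum.cong) (auto simp: pmf_kernel)
      finally show ?thesis using F by (subst (asm) sum.insert) auto
    qed
    finally show ?thesis by simp
  qed
  show "finite F \<Longrightarrow> F \<subseteq> S - {x} \<Longrightarrow>
      \<bar>expect ?K \<rho> - \<rho> x - (\<Sum>y\<in>F. P h x y * (\<rho> y - \<rho> x))\<bar>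
      \<le> 1 - P h x x - (\<Sum>y\<in>F. P h x y)" by (rule main)
  show "\<bar>expect ?K \<rho> - \<rho> x\<bar> \<le> C * h"
    using main[of "{}"] exit_le[OF assms(2,1)] by simp
qed

text \<open>The error is controlled by the exit quotient minus the quotients into
  \<open>nb x\<close>, and this tends to 0 because the generator is conservative.\<close>

lemma generator_lim:
  assumes x: "x \<in> S"
  shows "(\<lambda>n. (expect (kernel (inverse (real (Suc n))) x) \<rho> - \<rho> x) / inverse (real (Suc n)))
    \<longlonglongrightarrow> (\<Sum>y\<in>nb x. q x y * (\<rho> y - \<rho> x))"
proof -
  define h where "h n = inverse (real (Suc n))" for n
  have h: "0 < h n" for n by (simp add: h_def)
  let ?E = "\<lambda>n. expect (kernel (h n) x) \<rho> - \<rho> x"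
  let ?T = "\<lambda>n. \<Sum>y\<in>nb x. P (h n) x y / h n * (\<rho> y - \<rho> x)"
  have nbx: "finite (nb x)" "nb x \<subseteq> S - {x}" using nb[OF x] by auto
  have ql: "(\<lambda>n. P (h n) x y / h n) \<longlonglongrightarrow> q x y" if "y \<in> nb x" for y
    using q_lim[of x y] x that nbx unfolding h_def by auto
  have T: "?T \<longlonglongrightarrow> (\<Sum>y\<in>nb x. q x y * (\<rho> y - \<rho> x))"
    by (intro tendsto_sum tendsto_mult ql tendsto_const)
  have "(\<lambda>n. (1 - P (h n) x x) / h n - (\<Sum>y\<in>nb x. P (h n) x y / h n)) \<longlonglongrightarrow>
      (\<Sum>y\<in>nb x. q x y) - (\<Sum>y\<in>nb x. q x y)"
    using filterlim_compose[OF exit_lim[OF x] filterlim_inverse_Suc]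
    by (intro tendsto_diff tendsto_sum ql) (simp_all add: h_def)
  then have "(\<lambda>n. (1 - P (h n) x x) / h n - (\<Sum>y\<in>nb x. P (h n) x y / h n)) \<longlonglongrightarrow> 0" by simp
  then have "(\<lambda>n. ?E n / h n - ?T n) \<longlonglongrightarrow> 0"
  proof (rule Lim_null_comparison[OF always_eventually, rotated], intro allI)
    fix n
    have "?E n / h n - ?T n = (?E n - (\<Sum>y\<in>nb x. P (h n) x y * (\<rho> y - \<rho> x))) / h n"
      by (simp add: diff_divide_distrib sum_divide_distrib)
    then have "norm (?E n / h n - ?T n) = \<bar>?E n - (\<Sum>y\<in>nb x. P (h n) x y * (\<rho> y - \<rho> x))\<bar> / h n"
      using h[of n] by simp
    also have "\<dots> \<le> (1 - P (h n) x x - (\<Sum>y\<in>nb x. P (h n) x y)) / h n"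
      using expectation_kernel_diff(2)[of "h n" x "nb x"] x nbx h[of n] by (intro divide_right_mono) auto
    finally show "norm (?E n / h n - ?T n) \<le> (1 - P (h n) x x) / h n - (\<Sum>y\<in>nb x. P (h n) x y / h n)"
      by (simp add: diff_divide_distrib sum_divide_distrib)
  qed
  from tendsto_add[OF this T] show ?thesis by (simp add: h_def)
qed

text \<open>The semigroup property writes an increment at time \<open>s\<close> as the expectation
  of increments started at time 0. Their quotients are bounded by \<open>C\<close> uniformly in the
  state, so the generator limit may be taken under the expectation.\<close>

lemma dynkin:
  assumes "x0 \<in> S" "0 \<le> t"
  shows "continuous_on {0..} (\<lambda>t. expect (kernel t x0) \<rho>)"
    and "((\<lambda>s. expect (kernel s x0) (\<lambda>x. \<Sum>y\<in>nb x. q x y * (\<rho> y - \<rho> x))) has_integral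
      (expect (kernel t x0) \<rho> - \<rho> x0)) {0..t}"
proof -
  define G where "G t = expect (kernel t x0) \<rho>" for t
  have C: "0 \<le> C" using exit_le[OF assms(1), of 1] P_le_1[of 1 x0 x0] assms by simp
  have Gd: "G (s + h) - G s = expect (kernel s x0) (\<lambda>y. expect (kernel h y) \<rho> - \<rho> y)"
    if "0 \<le> s" "0 \<le> h" for s h
    unfolding G_def expectation_kernel_add[OF that assms(1)]
    using expectation_\<rho>_bounds
    by (subst Bochner_Integration.integral_diff) (auto intro!: pmf_integrable integrable_\<rho>)
  have AE_S: "AE y in kernel s x0. y \<in> S" if "0 \<le> s" for s
    using set_kernel[OF that assms(1)] by (auto simp: AE_measure_pmf_iff)
  have lip: "\<bar>G (s + h) - G s\<bar> \<le> C * h" if sh: "0 \<le> s" "0 \<le> h" for s h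
  proof -
    have ae: "AE y in kernel s x0. norm (expect (kernel h y) \<rho> - \<rho> y) \<le> C * h"
      using AE_S[OF sh(1)] by eventually_elim (use expectation_kernel_diff(1)[OF sh(2)] in auto)
    have "norm (G (s + h) - G s) \<le> expect (kernel s x0) (\<lambda>y. norm (expect (kernel h y) \<rho> - \<rho> y))"
      unfolding Gd[OF sh] by (rule integral_norm_bound)
    also have "\<dots> \<le> C * h"
      using ae by (intro measure_pmf.integral_le_const measure_pmf.integrable_const_bound[where B = "C * h"]) simp_all
    finally show ?thesis by simp
  qed
  have lim: "(\<lambda>n. (G (s + inverse (real (Suc n))) - G s) / inverse (real (Suc n))) \<longlonglongrightarrow>
      expect (kernel s x0) (\<lambda>x. \<Sum>y\<in>nb x. q x y * (\<rho> y - \<rho> x))" if s: "0 \<le> s" for s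
  proof -
    define h where "h n = inverse (real (Suc n))" for n
    have h: "0 < h n" for n by (simp add: h_def)
    have "(\<lambda>n. expect (kernel s x0) (\<lambda>y. (expect (kernel (h n) y) \<rho> - \<rho> y) / h n)) \<longlonglongrightarrow>
      expect (kernel s x0) (\<lambda>x. \<Sum>y\<in>nb x. q x y * (\<rho> y - \<rho> x))"
    proof (rule integral_dominated_convergence[where w = "\<lambda>_. C"])
      show "AE y in kernel s x0. (\<lambda>n. (expect (kernel (h n) y) \<rho> - \<rho> y) / h n) \<longlonglongrightarrow>
          (\<Sum>z\<in>nb y. q y z * (\<rho> z - \<rho> y))"
        using AE_S[OF s] by eventually_elim (use generator_lim in \<open>simp add: h_def\<close>)
      show "AE y in kernel s x0. norm ((expect (kernel (h n) y) \<rho> - \<rho> y) / h n) \<le> C" for n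
        using AE_S[OF s]
      proof eventually_elim
        case (elim y)
        show ?case using expectation_kernel_diff(1)[of "h n" y] elim h[of n] by (simp add: divide_le_eq)
      qed
    qed auto
    moreover have "expect (kernel s x0) (\<lambda>y. (expect (kernel (h n) y) \<rho> - \<rho> y) / h n)
        = (G (s + h n) - G s) / h n" for n
      using Gd[OF s less_imp_le[OF h]] by simp
    ultimately show ?thesis unfolding h_def by simp
  qed
  have G0: "G 0 = \<rho> x0" using assms by (simp add: G_def kernel_0)
  show "continuous_on {0..} (\<lambda>t. expect (kernel t x0) \<rho>)"
    using increment_limit_integral(1)[OF lip lim assms(2)] by (simp add: G_def)
  show "((\<lambda>s. expect (kernel s x0) (\<lambda>x. \<Sum>y\<in>nb x. q x y * (\<rho> y - \<rho> x))) has_integral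
      (expect (kernel t x0) \<rho> - \<rho> x0)) {0..t}"
    using increment_limit_integral(2)[OF lip lim assms(2)] by (simp add: G0) (simp add: G_def)
qed

end

lemma continuous_P:
  assumes "x \<in> S" "y \<in> S"
  shows "continuous_on {0..} (\<lambda>t. P t x y)"
proof -
  have "continuous_on {0..} (\<lambda>t. expect (kernel t x) (indicator {y} :: 's \<Rightarrow> real))"
    by (rule dynkin(1)[where t = 0]) (auto simp: assms indicator_def)
  then show ?thesis
    by (rule continuous_on_cong[THEN iffD1, rotated 2]) (auto simp: measure_pmf_single pmf_kernel assms)
qed

end

section \<open>The Erlang queue\<close>

definition next_down :: "nat \<Rightarrow> nat \<times> nat \<Rightarrow> nat \<times> nat" where
  "next_down k x = (if snd x \<ge> 2 then (fst x, snd x - 1) else if fst x \<ge> 2 then (fst x - 1, k) else (0, 0))"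

definition erlang_nbrs :: "nat \<Rightarrow> nat \<times> nat \<Rightarrow> (nat \<times> nat) set" where
  "erlang_nbrs k x = (if x = (0, 0) then {(1, k)} else {(fst x + 1, snd x), next_down k x})"

lemma erlang_states_nonzeroD:
  assumes "x \<in> erlang_states k" "x \<noteq> (0, 0)" "k \<ge> 1"
  shows "(fst x + 1, snd x) \<in> erlang_states k - {x}" "next_down k x \<in> erlang_states k - {x}"
    and "next_down k x \<noteq> (fst x + 1, snd x)"
    and "erlang_rate lam mu k x (fst x + 1, snd x) = lam"
    and "erlang_rate lam mu k x (next_down k x) = real k * mu"
    and "phase_count k (fst x + 1, snd x) = phase_count k x + k"
    and "Suc (phase_count k (next_down k x)) = phase_count k x"
proof -
  obtain n s where x: "x = (n, s)" by (cases x)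
  have ns: "1 \<le> n" "1 \<le> s" "s \<le> k" using assms by (auto simp: x erlang_states_def)
  then obtain j where j: "n = Suc j" by (cases n) auto
  show "(fst x + 1, snd x) \<in> erlang_states k - {x}" "next_down k x \<in> erlang_states k - {x}"
    "next_down k x \<noteq> (fst x + 1, snd x)"
    "erlang_rate lam mu k x (fst x + 1, snd x) = lam"
    "erlang_rate lam mu k x (next_down k x) = real k * mu"
    using ns by (auto simp: x erlang_states_def next_down_def erlang_rate_def)
  show "phase_count k (fst x + 1, snd x) = phase_count k x + k"
    by (simp add: x j phase_count_def)
  show "Suc (phase_count k (next_down k x)) = phase_count k x"
  proof (cases "s \<ge> 2")
    case True
    then show ?thesis using ns by (simp add: x phase_count_def next_down_def)
  next
    case False
    then have s: "s = 1" using ns by simp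
    show ?thesis
    proof (cases j)
      case (Suc i)
      then show ?thesis by (simp add: x j s phase_count_def next_down_def)
    qed (simp add: x j s phase_count_def next_down_def)
  qed
qed

lemma erlang_rate_other:
  assumes "y \<notin> erlang_nbrs k x" "x \<in> erlang_states k"
  shows "erlang_rate lam mu k x y = 0"
proof (rule ccontr)
  assume nz: "erlang_rate lam mu k x y \<noteq> 0"
  obtain n s where x: "x = (n, s)" by (cases x)
  show False
  proof (cases "n = 0")
    case True
    then have "x = (0, 0)" using assms by (auto simp: x erlang_states_def)
    with nz assms show False by (auto simp: erlang_rate_def erlang_nbrs_def split: if_splits)
  next
    case False
    then have "x \<noteq> (0, 0)" by (simp add: x)
    with nz assms False show False
      by (auto simp: x erlang_rate_def erlang_nbrs_def next_down_def split: if_splits)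
  qed
qed

locale erlang_chain =
  fixes lam mu :: real and k :: nat and P :: "real \<Rightarrow> nat \<times> nat \<Rightarrow> nat \<times> nat \<Rightarrow> real"
  assumes lam: "lam > 0" and mu: "mu > 0" and k: "k \<ge> 1"
    and tf_erlang: "transition_function_with_rates (erlang_states k) (erlang_rate lam mu k) P"

sublocale erlang_chain \<subseteq> bounded_rate_chain "erlang_states k" "erlang_rate lam mu k" P
  "erlang_nbrs k" "lam + real k * mu"
proof
  show "transition_function_with_rates (erlang_states k) (erlang_rate lam mu k) P" by (rule tf_erlang)
  fix x assume x: "x \<in> erlang_states k"
  show "finite (erlang_nbrs k x) \<and> erlang_nbrs k x \<subseteq> erlang_states k - {x}"
  proof (cases "x = (0, 0)")
    case True
    then show ?thesis using k by (auto simp: erlang_nbrs_def erlang_states_def)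
  next
    case False
    then show ?thesis using erlang_states_nonzeroD(1,2)[OF x False k] by (auto simp: erlang_nbrs_def)
  qed
  show "(\<Sum>y\<in>erlang_nbrs k x. erlang_rate lam mu k x y) \<le> lam + real k * mu"
  proof (cases "x = (0, 0)")
    case True
    then show ?thesis using lam mu by (simp add: erlang_nbrs_def erlang_rate_def)
  next
    case False
    then show ?thesis using erlang_states_nonzeroD(3)[OF x False k, symmetric] erlang_states_nonzeroD(4,5)[OF x False k, of lam mu]
      by (simp add: erlang_nbrs_def)
  qed
next
  fix x y assume "x \<in> erlang_states k" "y \<notin> erlang_nbrs k x"
  then show "erlang_rate lam mu k x y = 0" by (rule erlang_rate_other[rotated])
qed

context erlang_chain
begin

lemma zero_state: "(0, 0) \<in> erlang_states k" by (simp add: erlang_states_def)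

text \<open>The cut-off extends the function continuously to negative times, about which
  \<open>P\<close> says nothing; continuity and measurability then hold on the whole line.\<close>

definition empty_prob :: "real \<Rightarrow> real" where
  "empty_prob t = P (max 0 t) (0, 0) (0, 0)"

definition phase_gf :: "real \<Rightarrow> real \<Rightarrow> real" where
  "phase_gf u t = expect (kernel t (0, 0)) (\<lambda>x. u ^ phase_count k x)"

text \<open>The factor by which the generator multiplies \<open>u ^ phase\<close> at nonempty
  states. At the empty state there is no downward jump, and the missing amount is
  \<open>sink u\<close>.\<close>

definition symbol :: "real \<Rightarrow> real" where
  "symbol u = lam * (u ^ k - 1) + real k * mu * (1 / u - 1)"

lemma empty_prob_bounds: "0 \<le> empty_prob t" "empty_prob t \<le> 1"
  using P_nonneg P_le_1 zero_state by (auto simp: empty_prob_def)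

lemma continuous_empty_prob: "continuous_on A empty_prob"
proof -
  have "continuous_on UNIV empty_prob" unfolding empty_prob_def
    by (rule continuous_on_compose2[OF continuous_P[OF zero_state zero_state]]) (auto intro!: continuous_intros)
  then show ?thesis by (rule continuous_on_subset) simp
qed

lemma phase_gf_bounds:
  assumes "0 \<le> u" "u \<le> 1"
  shows "0 \<le> phase_gf u t" "phase_gf u t \<le> 1"
  unfolding phase_gf_def using assms by (auto intro!: expectation_\<rho>_bounds power_le_one)

abbreviation sink :: "real \<Rightarrow> real" where
  "sink u \<equiv> real k * mu * (1 / u - 1)"

abbreviation gen :: "real \<Rightarrow> nat \<times> nat \<Rightarrow> real" where
  "gen u x \<equiv>
    \<Sum>y\<in>erlang_nbrs k x. erlang_rate lam mu k x y * (u ^ phase_count k y - u ^ phase_count k x)"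

lemma generator_power:
  assumes x: "x \<in> erlang_states k" and u: "0 < u"
  shows "gen u x =
    symbol u * u ^ phase_count k x - sink u * indicator {(0, 0)} x"
proof (cases "x = (0, 0)")
  case True
  then show ?thesis by (simp add: erlang_nbrs_def erlang_rate_def phase_count_def symbol_def)
next
  case False
  note N = erlang_states_nonzeroD[OF x False k]
  define j where "j = phase_count k (next_down k x)"
  have j: "phase_count k x = Suc j" using N(7) by (simp add: j_def)
  have "gen u x =
      lam * (u ^ (Suc j + k) - u ^ Suc j) + real k * mu * (u ^ j - u ^ Suc j)"
    using False N(3)[symmetric] N(4,5)[of lam mu] N(6) by (simp add: erlang_nbrs_def j j_def[symmetric])
  also have "\<dots> = symbol u * u ^ Suc j"
    using u by (simp add: symbol_def field_simps power_add)
  finally show ?thesis using False by (simp add: j)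
qed

lemma phase_gf_integral:
  assumes u: "0 < u" "u \<le> 1" and t: "0 \<le> t"
  shows "continuous_on {0..} (phase_gf u)"
    and "((\<lambda>s. symbol u * phase_gf u s - sink u * empty_prob s) has_integral (phase_gf u t - 1)) {0..t}"
proof -
  have \<rho>: "0 \<le> u ^ phase_count k x" "u ^ phase_count k x \<le> 1" for x
    using u by (auto intro: power_le_one)
  note dyn = dynkin[of "\<lambda>x. u ^ phase_count k x", OF \<rho> zero_state t]
  show "continuous_on {0..} (phase_gf u)" using dyn(1) by (simp add: phase_gf_def[abs_def])
  show "((\<lambda>s. symbol u * phase_gf u s - sink u * empty_prob s) has_integral (phase_gf u t - 1)) {0..t}"
  proof (rule has_integral_eq)
    show "((\<lambda>s. expect (kernel s (0, 0)) (gen u)) has_integral (phase_gf u t - 1)) {0..t}"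
      using dyn(2) by (simp add: phase_gf_def phase_count_def)
    fix s assume "s \<in> {0..t}"
    then have s: "0 \<le> s" by simp
    let ?K = "kernel s (0, 0)"
    have "expect ?K (gen u) =
        expect ?K (\<lambda>x. symbol u * u ^ phase_count k x - sink u * indicator {(0, 0)} x)"
      using set_kernel[OF s zero_state]
      by (intro integral_cong_AE) (auto simp: AE_measure_pmf_iff intro!: generator_power u)
    also have "\<dots> = symbol u * phase_gf u s - sink u * pmf ?K (0, 0)"
      using \<rho> by (subst Bochner_Integration.integral_diff)
        (auto simp: phase_gf_def measure_pmf_single intro!: integrable_mult_right pmf_integrable)
    finally show "expect ?K (gen u) =
        symbol u * phase_gf u s - sink u * empty_prob s"
      using s by (simp add: pmf_kernel zero_state empty_prob_def)
  qed
qed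

text \<open>The integral equation upgrades itself: its integrand is continuous because
  \<open>phase_gf\<close> and \<open>empty_prob\<close> are, so it may be differentiated.\<close>

lemma phase_gf_derivative:
  assumes u: "0 < u" "u \<le> 1" and s: "s \<in> {0..t}"
  shows "(phase_gf u has_field_derivative symbol u * phase_gf u s - sink u * empty_prob s) (at s within {0..t})"
proof -
  let ?g = "\<lambda>s. symbol u * phase_gf u s - sink u * empty_prob s"
  have "continuous_on {0..t} ?g"
    using phase_gf_integral(1)[OF u order_refl]
    by (intro continuous_intros continuous_empty_prob) (auto intro: continuous_on_subset)
  then have "((\<lambda>x. integral {0..x} ?g) has_field_derivative ?g s) (at s within {0..t})"
    unfolding has_real_derivative_iff_has_vector_derivative by (rule integral_has_vector_derivative[OF _ s])
  from DERIV_add[OF this DERIV_const[of 1]]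
  have "((\<lambda>x. integral {0..x} ?g + 1) has_field_derivative ?g s) (at s within {0..t})" by simp
  then show ?thesis
  proof (rule has_field_derivative_transform_within[OF _ zero_less_one s])
    fix x assume "x \<in> {0..t}"
    then show "integral {0..x} ?g + 1 = phase_gf u x"
      using integral_unique[OF phase_gf_integral(2)[OF u, of x]] by simp
  qed
qed

text \<open>The kernel method: multiplying by \<open>exp (- symbol u * t)\<close> removes the unknown generating function.\<close>

lemma nn_laplace_empty_prob:
  assumes u: "0 < u" "u < 1" and pos: "symbol u > 0"
  shows "nn_laplace (\<lambda>t. ennreal (empty_prob t)) (symbol u) = ennreal (1 / sink u)"
proof -
  define \<theta> where "\<theta> = symbol u"
  define c where "c = sink u"
  have c: "c > 0" using k mu u by (auto simp: c_def field_simps)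
  define f where "f t = exp (- \<theta> * t) * empty_prob t" for t
  define F where "F t = exp (- \<theta> * t) * phase_gf u t" for t
  have fm [measurable]: "f \<in> borel_measurable borel"
    unfolding f_def by (intro borel_measurable_continuous_onI continuous_intros continuous_empty_prob)
  have I: "(\<integral>\<^sup>+t. ennreal (f t) * indicator {0..real n} t \<partial>lborel) = ennreal ((1 - F (real n)) / c)" for n
  proof -
    have "(F has_field_derivative - c * f s) (at s within {0..real n})" if s: "s \<in> {0..real n}" for s
      unfolding F_def f_def c_def \<theta>_def
      by (rule derivative_eq_intros phase_gf_derivative[OF u(1) less_imp_le[OF u(2)] s] refl)+
        (simp add: algebra_simps)
    then have "((\<lambda>s. - c * f s) has_integral (F (real n) - F 0)) {0..real n}"
      by (intro fundamental_theorem_of_calculus) (auto simp: has_real_derivative_iff_has_vector_derivative)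
    moreover have "F 0 = 1"
      by (simp add: F_def phase_gf_def kernel_0 zero_state phase_count_def)
    ultimately have "((\<lambda>s. (- 1 / c) * (- c * f s)) has_integral (- 1 / c) * (F (real n) - 1)) {0..real n}"
      by (intro has_integral_mult_right) simp
    moreover have "(\<lambda>s. (- 1 / c) * (- c * f s)) = f" using c by (simp add: fun_eq_iff)
    moreover have "(- 1 / c) * (F (real n) - 1) = (1 - F (real n)) / c" by (simp add: algebra_simps diff_divide_distrib)
    ultimately have "(f has_integral (1 - F (real n)) / c) {0..real n}" by (simp only:)
    then show ?thesis
      by (rule nn_integral_has_integral_lebesgue'[rotated]) (simp add: f_def empty_prob_bounds)
  qed
  have "(\<lambda>n. \<integral>\<^sup>+t. ennreal (f t) * indicator {0..real n} t \<partial>lborel) \<longlonglongrightarrow>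
      (\<integral>\<^sup>+t. ennreal (f t) * indicator {0..} t \<partial>lborel)"
  proof (rule nn_integral_LIMSEQ)
    show "incseq (\<lambda>n t. ennreal (f t) * indicator {0..real n} t)"
      by (auto simp: incseq_def le_fun_def indicator_def)
    fix t :: real
    obtain N where "t \<le> real N" using real_arch_simple by blast
    then show "(\<lambda>n. ennreal (f t) * indicator {0..real n} t) \<longlonglongrightarrow> ennreal (f t) * indicator {0..} t"
      by (intro tendsto_eventually eventually_sequentiallyI[of N]) (auto simp: indicator_def)
  qed simp
  \<comment> \<open>The boundary term \<open>F (real n)\<close> vanishes since
    \<open>phase_gf\<close> is at most 1 and the exponential decays; this is where
    \<open>symbol u > 0\<close> enters.\<close>
  moreover have "(\<lambda>n. ennreal ((1 - F (real n)) / c)) \<longlonglongrightarrow> ennreal ((1 - 0) / c)"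
  proof (intro tendsto_ennrealI tendsto_intros)
    have "(\<lambda>n. exp (- \<theta> * real n)) \<longlonglongrightarrow> 0"
      using pos unfolding \<theta>_def[symmetric] by real_asymp
    then show "(\<lambda>n. F (real n)) \<longlonglongrightarrow> 0"
      using phase_gf_bounds[of u] u unfolding F_def
      by (elim Lim_null_comparison[OF always_eventually, rotated]) (auto simp: abs_mult mult_left_le)
  qed (use c in auto)
  ultimately have "(\<integral>\<^sup>+t. ennreal (f t) * indicator {0..} t \<partial>lborel) = ennreal (1 / c)"
    unfolding I by (simp add: LIMSEQ_unique)
  moreover have "nn_laplace (\<lambda>t. ennreal (empty_prob t)) \<theta> = (\<integral>\<^sup>+t. ennreal (f t) * indicator {0..} t \<partial>lborel)"
    unfolding nn_laplace_def
  proof (rule nn_integral_cong_AE)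
    show "AE t in lborel. ennreal (exp (- \<theta> * t)) * ennreal (empty_prob t) * indicator {0<..} t = ennreal (f t) * indicator {0..} t"
      using AE_lborel_singleton[of 0]
      by eventually_elim (auto simp: f_def indicator_def ennreal_mult' empty_prob_bounds)
  qed
  ultimately show ?thesis by (simp add: \<theta>_def c_def)
qed

text \<open>Dividing \<open>1 - u ^ j\<close> by \<open>1 - u\<close> gives a geometric sum that
  increases to \<open>j\<close> as \<open>u\<close> tends to 1, so monotone convergence reaches the
  mean before it is known to be finite. Nonnegativity is stated separately because
  \<open>ennreal\<close> would truncate a negative value and \<open>lam - mu\<close> may be
  negative.\<close>

lemma mean_phase_count:
  assumes t: "0 \<le> t"
  shows "(\<integral>\<^sup>+x. ennreal (real (phase_count k x)) \<partial>kernel t (0, 0)) =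
    ennreal (real k * (lam - mu) * t + real k * mu * integral {0..t} empty_prob)"
    and "0 \<le> real k * (lam - mu) * t + real k * mu * integral {0..t} empty_prob"
proof -
  \<comment> \<open>The double successor starts the sequence at \<open>1 / 2\<close>, keeping it
    strictly between 0 and 1.\<close>
  define u where "u n = 1 - inverse (real (Suc (Suc n)))" for n
  have u: "0 < u n" "u n < 1" for n by (auto simp: u_def field_simps)
  have u_lim: "u \<longlonglongrightarrow> 1"
    unfolding u_def using tendsto_diff[OF tendsto_const LIMSEQ_Suc[OF LIMSEQ_inverse_real_of_nat], of 1] by simp
  have u_inc: "incseq u" by (rule incseq_SucI) (simp add: u_def field_simps)
  let ?K = "\<lambda>s. kernel s (0, 0)"
  let ?I = "\<lambda>n. integral {0..t} (phase_gf (u n))"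
  let ?p = "integral {0..t} empty_prob"
  have int_p: "empty_prob integrable_on {0..t}" by (intro integrable_continuous_real continuous_empty_prob)
  have int_g: "phase_gf (u n) integrable_on {0..t}" for n
    by (intro integrable_continuous_real continuous_on_subset[OF phase_gf_integral(1)[OF u(1) less_imp_le[OF u(2)] order_refl]]) auto
  have gf_lim: "(\<lambda>n. phase_gf (u n) s) \<longlonglongrightarrow> 1" for s
  proof -
    have "(\<lambda>n. expect (?K s) (\<lambda>x. u n ^ phase_count k x)) \<longlonglongrightarrow> expect (?K s) (\<lambda>x. 1 ^ phase_count k x)"
      using u by (intro integral_dominated_convergence[where w = "\<lambda>_. 1"] AE_I2 tendsto_power u_lim)
        (simp_all add: power_le_one less_imp_le)
    then show ?thesis by (simp add: phase_gf_def)
  qed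
  have I_lim: "?I \<longlonglongrightarrow> t"
  proof -
    have "?I \<longlonglongrightarrow> integral {0..t} (\<lambda>_. 1)"
      using phase_gf_bounds[OF less_imp_le[OF u(1)] less_imp_le[OF u(2)]]
      by (intro dominated_convergence(2)[where h = "\<lambda>_. 1"] int_g gf_lim) auto
    then show ?thesis using t by simp
  qed
  have geo: "(\<Sum>i<j. u n ^ i) = (1 - u n ^ j) / (1 - u n)" for j n
    using geometric_sum[of "u n" j] u(2)[of n] by (simp add: field_simps)
  have quot: "expect (?K t) (\<lambda>x. \<Sum>i<phase_count k x. u n ^ i) =
      (lam * (\<Sum>i<k. u n ^ i) - real k * mu / u n) * ?I n + real k * mu / u n * ?p" for n
  proof -
    have "integral {0..t} (\<lambda>s. symbol (u n) * phase_gf (u n) s - sink (u n) * empty_prob s) = phase_gf (u n) t - 1"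
      using phase_gf_integral(2)[OF u(1) less_imp_le[OF u(2)] t] by (rule integral_unique)
    also have "integral {0..t} (\<lambda>s. symbol (u n) * phase_gf (u n) s - sink (u n) * empty_prob s) =
        symbol (u n) * ?I n - sink (u n) * ?p"
      by (subst Henstock_Kurzweil_Integration.integral_diff) (auto intro!: integrable_on_mult_right int_g int_p)
    finally have e1: "1 - phase_gf (u n) t = sink (u n) * ?p - symbol (u n) * ?I n" by simp
    \<comment> \<open>Both \<open>symbol\<close> and \<open>sink\<close> vanish at 1; division by
      \<open>1 - u n\<close> cancels this zero and leaves expressions continuous at 1.\<close>
    have s: "- symbol (u n) / (1 - u n) = lam * (\<Sum>i<k. u n ^ i) - real k * mu / u n"
      unfolding geo symbol_def using u[of n] by (simp add: field_simps)
    have c: "sink (u n) / (1 - u n) = real k * mu / u n"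
      using u[of n] by (simp add: field_simps)
    have "expect (?K t) (\<lambda>x. \<Sum>i<phase_count k x. u n ^ i) = (1 - phase_gf (u n) t) / (1 - u n)"
      unfolding geo phase_gf_def using u[of n]
      by (subst integral_divide_zero, subst Bochner_Integration.integral_diff)
        (auto intro!: pmf_integrable AE_I2 power_le_one)
    also have "\<dots> = (- symbol (u n) / (1 - u n)) * ?I n + sink (u n) / (1 - u n) * ?p"
      unfolding e1 by (simp add: diff_divide_distrib)
    finally show ?thesis unfolding s c .
  qed
  have lim: "(\<lambda>n. (lam * (\<Sum>i<k. u n ^ i) - real k * mu / u n) * ?I n + real k * mu / u n * ?p) \<longlonglongrightarrow>
      (lam * (\<Sum>i<k. 1 ^ i) - real k * mu / 1) * t + real k * mu / 1 * ?p"
    by (intro tendsto_intros u_lim I_lim) auto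
  have "(\<lambda>n. \<integral>\<^sup>+x. ennreal (\<Sum>i<phase_count k x. u n ^ i) \<partial>?K t) \<longlonglongrightarrow> (\<integral>\<^sup>+x. ennreal (real (phase_count k x)) \<partial>?K t)"
  proof (rule nn_integral_LIMSEQ)
    show "incseq (\<lambda>n x. ennreal (\<Sum>i<phase_count k x. u n ^ i))"
      using u_inc less_imp_le[OF u(1)] by (auto simp: incseq_def le_fun_def intro!: ennreal_leI sum_mono power_mono)
    fix x
    have "(\<lambda>n. \<Sum>i<phase_count k x. u n ^ i) \<longlonglongrightarrow> (\<Sum>i<phase_count k x. 1 ^ i)"
      by (intro tendsto_sum tendsto_power u_lim)
    then show "(\<lambda>n. ennreal (\<Sum>i<phase_count k x. u n ^ i)) \<longlonglongrightarrow> ennreal (real (phase_count k x))"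
      by (intro tendsto_ennrealI) simp
  qed simp
  moreover have "(\<integral>\<^sup>+x. ennreal (\<Sum>i<phase_count k x. u n ^ i) \<partial>?K t) =
      ennreal ((lam * (\<Sum>i<k. u n ^ i) - real k * mu / u n) * ?I n + real k * mu / u n * ?p)" for n
  proof -
    have "norm (\<Sum>i<j. u n ^ i) \<le> 1 / (1 - u n)" for j
    proof -
      have "0 \<le> (\<Sum>i<j. u n ^ i)" using u(1)[of n] by (intro sum_nonneg) simp
      moreover have "(\<Sum>i<j. u n ^ i) \<le> 1 / (1 - u n)"
        unfolding geo using u[of n] by (intro divide_right_mono) auto
      ultimately show ?thesis by simp
    qed
    then have "integrable (?K t) (\<lambda>x. \<Sum>i<phase_count k x. u n ^ i)"
      by (intro measure_pmf.integrable_const_bound[where B = "1 / (1 - u n)"]) auto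
    then show ?thesis unfolding quot[symmetric]
      using u[of n] by (intro nn_integral_eq_integral) (auto intro!: AE_I2 sum_nonneg)
  qed
  moreover note tendsto_ennrealI[OF lim]
  ultimately have "(\<integral>\<^sup>+x. ennreal (real (phase_count k x)) \<partial>?K t) =
      ennreal ((lam * (\<Sum>i<k. 1 ^ i) - real k * mu / 1) * t + real k * mu / 1 * ?p)"
    by (intro LIMSEQ_unique) auto
  then show "(\<integral>\<^sup>+x. ennreal (real (phase_count k x)) \<partial>?K t) =
      ennreal (real k * (lam - mu) * t + real k * mu * integral {0..t} empty_prob)" by (simp add: algebra_simps)
  have "0 \<le> (lam * (\<Sum>i<k. u n ^ i) - real k * mu / u n) * ?I n + real k * mu / u n * ?p" for n
    unfolding quot[symmetric] using u(1)[of n] by (intro Bochner_Integration.integral_nonneg sum_nonneg) simp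
  then have "0 \<le> (lam * (\<Sum>i<k. 1 ^ i) - real k * mu / 1) * t + real k * mu / 1 * ?p"
    by (intro LIMSEQ_le_const[OF lim]) auto
  then show "0 \<le> real k * (lam - mu) * t + real k * mu * integral {0..t} empty_prob" by (simp add: algebra_simps)
qed

end

section \<open>Ballot series\<close>

text \<open>\<open>ballot_weight k x y m r\<close> is the probability that the walk with steps \<open>+k\<close> (weight \<open>x\<close>) and
  \<open>-1\<close> (weight \<open>y\<close>) first reaches \<open>-m\<close> after exactly \<open>r\<close> upward steps; the recurrence conditions on
  the first step.\<close>

definition ballot_weight :: "nat \<Rightarrow> real \<Rightarrow> real \<Rightarrow> nat \<Rightarrow> nat \<Rightarrow> real" where
  "ballot_weight k x y m r = (if m = 0 then (if r = 0 then 1 else 0) else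
     real m * fact (m + r * (k + 1) - 1) / (fact r * fact (m + r * k)) * x ^ r * y ^ (m + r * k))"

lemma ballot_weight_rec_0: "ballot_weight k x y (Suc m) 0 = y * ballot_weight k x y m 0"
  by (cases m) (simp_all add: ballot_weight_def del: of_nat_Suc)

text \<open>After the common factorials are cancelled, this is the identity
  \<open>Suc m * Suc d = m * Suc e + (Suc m + k) * Suc r\<close>, where
  \<open>d = e + r\<close>.\<close>

lemma ballot_weight_rec:
  "ballot_weight k x y (Suc m) (Suc r) =
     y * ballot_weight k x y m (Suc r) + x * ballot_weight k x y (Suc m + k) r"
proof -
  define d where "d = m + k + r + r * k"
  define F where "F = (fact d :: real)"
  define e where "e = m + Suc r * k"
  have "Suc m + Suc r * (k + 1) - 1 = Suc d" "Suc m + k + r * (k + 1) - 1 = d"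
    "m > 0 \<Longrightarrow> m + Suc r * (k + 1) - 1 = d"
    by (simp_all add: d_def)
  then have f1: "fact (Suc m + Suc r * (k + 1) - 1) = real (Suc d) * F"
    and f2: "fact (Suc m + k + r * (k + 1) - 1) = F"
    and f3: "m > 0 \<Longrightarrow> fact (m + Suc r * (k + 1) - 1) = F"
    unfolding F_def by (simp_all only: fact_Suc)
  have e: "Suc m + Suc r * k = Suc e" "Suc m + k + r * k = Suc e" "m + Suc r * k = e"
    by (simp_all add: e_def algebra_simps)
  have fe: "fact (Suc e) = real (Suc e) * (fact e :: real)" by simp
  have fr: "fact (Suc r) = real (Suc r) * (fact r :: real)" by simp
  define A where "A = real m * F / (fact (Suc r) * fact e)"
  define B where "B = real (Suc m + k) * F / (fact r * fact (Suc e))"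
  have AB: "real (Suc m) * (real (Suc d) * F) / (fact (Suc r) * fact (Suc e)) = A + B"
  proof -
    have "real (Suc m) * real (Suc d) = real m * real (Suc e) + real (Suc m + k) * real (Suc r)"
      by (simp add: d_def e_def algebra_simps)
    then have "real (Suc m) * (real (Suc d) * F) / (real (Suc r) * fact r * (real (Suc e) * fact e)) =
      (real m * real (Suc e) + real (Suc m + k) * real (Suc r)) * F / (real (Suc r) * fact r * (real (Suc e) * fact e))"
      by (simp only: mult.assoc[symmetric])
    also have "\<dots> = real m * F / (real (Suc r) * fact r * fact e) + real (Suc m + k) * F / (fact r * (real (Suc e) * fact e))"
      by (simp add: add_divide_distrib ring_distribs del: of_nat_Suc of_nat_add)
    finally show ?thesis unfolding A_def B_def fe fr .
  qed
  have "ballot_weight k x y (Suc m) (Suc r) = (A + B) * x ^ Suc r * y ^ Suc e"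
    unfolding ballot_weight_def f1 e AB by (simp del: power_Suc)
  \<comment> \<open>For \<open>m = 0\<close> both sides vanish: the weight by its case distinction,
    \<open>A\<close> by its factor \<open>m\<close>.\<close>
  moreover have "ballot_weight k x y m (Suc r) = A * x ^ Suc r * y ^ e"
    unfolding ballot_weight_def A_def e using f3 by (cases "m = 0") (simp_all only: if_True if_False, simp_all)
  moreover have "ballot_weight k x y (Suc m + k) r = B * x ^ r * y ^ Suc e"
    unfolding ballot_weight_def f2 e B_def by (simp del: power_Suc of_nat_Suc of_nat_add)
  ultimately show ?thesis by (simp add: algebra_simps)
qed

context
  fixes k :: nat and x y :: real
  assumes x: "0 < x" and y: "0 < y" and xy: "x + y < 1"
begin

abbreviation bw :: "nat \<Rightarrow> nat \<Rightarrow> real" where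
  "bw \<equiv> ballot_weight k x y"

lemma ballot_weight_nonneg: "0 \<le> bw m r"
  using x y by (simp add: ballot_weight_def)

text \<open>The truncation at \<open>n\<close> total steps makes the first-step recurrence an induction on \<open>n\<close>.\<close>

lemma ballot_weight_truncated_sum_le:
  "(\<Sum>r\<le>n. if m + r * (k + 1) \<le> n then bw m r else 0) \<le> 1"
proof (induction n arbitrary: m)
  case 0
  show ?case by (cases "m = 0") (simp_all add: ballot_weight_def)
next
  case (Suc n)
  let ?T = "\<lambda>n m r. if m + r * (k + 1) \<le> n then bw m r else 0"
  show ?case
  proof (cases m)
    case 0
    have "(\<Sum>r\<le>Suc n. ?T (Suc n) m r) = (\<Sum>r\<le>Suc n. if r = 0 then 1 else 0)"
      by (intro sum.cong) (auto simp: 0 ballot_weight_def)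
    then show ?thesis by simp
  next
    case (Suc j)
    have "(\<Sum>r\<le>Suc n. ?T (Suc n) m r) = ?T (Suc n) m 0 + (\<Sum>r\<le>n. ?T (Suc n) m (Suc r))"
      by (rule sum.atMost_Suc_shift)
    also have "\<dots> = y * ?T n j 0 + (\<Sum>r\<le>n. y * ?T n j (Suc r) + x * ?T n (m + k) r)"
      unfolding Suc
      by (intro arg_cong2[where f = "(+)"] sum.cong refl)
        (auto simp: ballot_weight_rec_0 ballot_weight_rec algebra_simps)
    also have "\<dots> = y * (?T n j 0 + (\<Sum>r\<le>n. ?T n j (Suc r))) + x * (\<Sum>r\<le>n. ?T n (m + k) r)"
      by (simp only: sum.distrib sum_distrib_left ring_distribs add.assoc)
    also have "?T n j 0 + (\<Sum>r\<le>n. ?T n j (Suc r)) = (\<Sum>r\<le>Suc n. ?T n j r)"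
      by (rule sum.atMost_Suc_shift[symmetric])
    also have "\<dots> = (\<Sum>r\<le>n. ?T n j r)" by simp
    also have "y * (\<Sum>r\<le>n. ?T n j r) + x * (\<Sum>r\<le>n. ?T n (m + k) r) \<le> y * 1 + x * 1"
      using x y by (intro add_mono mult_left_mono Suc.IH) auto
    finally show ?thesis using xy by linarith
  qed
qed

lemma ballot_weight_sum_le: "(\<Sum>r<R. bw m r) \<le> 1"
proof -
  \<comment> \<open>Large enough that none of the first \<open>R\<close> terms is cut off.\<close>
  define n where "n = m + R * (k + 1)"
  have "(\<Sum>r<R. bw m r) = (\<Sum>r<R. if m + r * (k + 1) \<le> n then bw m r else 0)"
  proof (rule sum.cong)
    fix r assume "r \<in> {..<R}"
    then have "r * (k + 1) \<le> R * (k + 1)" by (intro mult_le_mono1) simp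
    then show "bw m r = (if m + r * (k + 1) \<le> n then bw m r else 0)"
      by (simp add: n_def)
  qed simp
  also have "\<dots> \<le> (\<Sum>r\<le>n. if m + r * (k + 1) \<le> n then bw m r else 0)"
    by (intro sum_mono2) (auto simp: n_def ballot_weight_nonneg)
  finally show ?thesis using ballot_weight_truncated_sum_le[of m n] by linarith
qed

lemma ballot_weight_summable: "summable (bw m)"
  by (rule summableI_nonneg_bounded[OF ballot_weight_nonneg ballot_weight_sum_le])

text \<open>The sums \<open>v m\<close> and the powers \<open>u ^ m\<close> agree at
  \<open>m = 0\<close> and lie in \<open>[0, 1]\<close>. Each use of the recurrence shrinks the
  bound on their difference by \<open>x + y\<close>, which is less than 1.\<close>

lemma ballot_weight_sums:
  assumes u: "0 < u" "u < 1" "u = y + x * u ^ Suc k"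
  shows "bw m sums u ^ m"
proof -
  define v where "v m = (\<Sum>r. bw m r)" for m
  have v: "0 \<le> v m" "v m \<le> 1" for m unfolding v_def
    by (intro suminf_nonneg ballot_weight_summable ballot_weight_nonneg)
      (intro suminf_le_const ballot_weight_summable ballot_weight_sum_le)
  have v0: "v 0 = 1"
  proof -
    have "bw 0 = (\<lambda>r. if r = 0 then 1 else 0)" by (auto simp: ballot_weight_def)
    then show ?thesis using sums_single[of 0 "\<lambda>_. 1 :: real"] by (simp add: v_def sums_iff)
  qed
  have rec: "v (Suc m) = y * v m + x * v (Suc m + k)" for m
  proof -
    note s = ballot_weight_summable
    have "v (Suc m) = bw (Suc m) 0 + (\<Sum>r. bw (Suc m) (Suc r))"
      unfolding v_def using suminf_split_head[OF s[of "Suc m"]] by simp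
    also have "(\<Sum>r. bw (Suc m) (Suc r)) =
        y * (\<Sum>r. bw m (Suc r)) + x * v (Suc m + k)"
      unfolding ballot_weight_rec v_def
      using s[of m, THEN summable_Suc_iff[THEN iffD2]] s[of "Suc m + k"]
      by (simp add: suminf_add[symmetric] suminf_mult summable_mult)
    also have "bw (Suc m) 0 + (y * (\<Sum>r. bw m (Suc r)) + x * v (Suc m + k)) =
        y * v m + x * v (Suc m + k)"
      unfolding v_def suminf_split_head[OF s[of m]] by (simp add: ballot_weight_rec_0 algebra_simps)
    finally show ?thesis .
  qed
  have urec: "u ^ Suc m = y * u ^ m + x * u ^ (Suc m + k)" for m
  proof -
    have "u ^ Suc m = u ^ m * u" by simp
    also have "\<dots> = u ^ m * (y + x * u ^ Suc k)" using u(3) by simp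
    also have "\<dots> = y * u ^ m + x * u ^ (Suc m + k)" by (simp add: algebra_simps power_add)
    finally show ?thesis .
  qed
  have "\<bar>v m - u ^ m\<bar> \<le> (x + y) ^ n" for n m
  proof (induction n arbitrary: m)
    case 0
    have "0 \<le> u ^ m" "u ^ m \<le> 1" using u by (auto intro: power_le_one)
    then show ?case using v[of m] by (simp add: abs_le_iff)
  next
    case (Suc n)
    show ?case
    proof (cases m)
      case 0
      then show ?thesis using v0 x y by simp
    next
      case (Suc j)
      have "v m - u ^ m = y * (v j - u ^ j) + x * (v (m + k) - u ^ (m + k))"
        unfolding Suc rec[of j] urec[of j] by (simp add: algebra_simps)
      also have "\<bar>\<dots>\<bar> \<le> y * \<bar>v j - u ^ j\<bar> + x * \<bar>v (m + k) - u ^ (m + k)\<bar>"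
        using x y abs_triangle_ineq[of "y * (v j - u ^ j)" "x * (v (m + k) - u ^ (m + k))"] by (simp add: abs_mult)
      also have "\<dots> \<le> y * (x + y) ^ n + x * (x + y) ^ n"
        using x y by (intro add_mono mult_left_mono Suc.IH) auto
      finally show ?thesis by (simp add: algebra_simps)
    qed
  qed
  moreover have "(\<lambda>n. (x + y) ^ n) \<longlonglongrightarrow> 0" using x y xy by (intro LIMSEQ_power_zero) simp
  ultimately have "\<bar>v m - u ^ m\<bar> \<le> 0" by (intro LIMSEQ_le_const) auto
  then show ?thesis
    using summable_sums[OF ballot_weight_summable, of m] by (simp add: v_def)
qed

text \<open>Intermediate values: the difference of the two sides is \<open>- y\<close> at 0 and
  \<open>1 - y - x\<close> at 1. For the queue this is the equation
  \<open>symbol u = \<theta>\<close>, multiplied by \<open>u\<close> and divided by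
  \<open>\<theta> + lam + k * mu\<close>.\<close>

lemma ballot_root:
  obtains u where "0 < u" "u < 1" "u = y + x * u ^ Suc k"
proof -
  have "\<exists>u. 0 \<le> u \<and> u \<le> 1 \<and> u - (y + x * u ^ Suc k) = 0"
    using x y xy by (intro IVT) (auto intro!: continuous_intros)
  then obtain u where u: "0 \<le> u" "u \<le> 1" "u = y + x * u ^ Suc k" by auto
  have "0 < y + x * u ^ Suc k" using x y u(1) by (intro add_pos_nonneg) auto
  moreover have "u \<noteq> 1" using u(3) xy by auto
  ultimately show ?thesis using that u by fastforce
qed

end

section \<open>Inverse subordinators\<close>

text \<open>Adding 1 after the floor keeps the approximation strictly above \<open>s\<close> even
  when \<open>s\<close> is a grid point, as convergence along \<open>at_right s\<close>
  demands.\<close>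

definition grid_above :: "nat \<Rightarrow> real \<Rightarrow> real" where
  "grid_above n s = (real_of_int \<lfloor>real (Suc n) * s\<rfloor> + 1) / real (Suc n)"

lemma grid_above: "s < grid_above n s" "grid_above n s \<le> s + inverse (real (Suc n))"
proof -
  have "real (Suc n) * s < real_of_int \<lfloor>real (Suc n) * s\<rfloor> + 1" by linarith
  then show "s < grid_above n s" by (simp add: grid_above_def field_simps)
  have "real_of_int \<lfloor>real (Suc n) * s\<rfloor> + 1 \<le> real (Suc n) * s + 1" by linarith
  then have "grid_above n s \<le> (real (Suc n) * s + 1) / real (Suc n)"
    unfolding grid_above_def by (rule divide_right_mono) simp
  also have "\<dots> = s + inverse (real (Suc n))" by (simp add: field_simps)
  finally show "grid_above n s \<le> s + inverse (real (Suc n))" .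
qed

lemma filterlim_grid_above: "filterlim (\<lambda>n. grid_above n s) (at_right s) sequentially"
proof -
  have "(\<lambda>n. grid_above n s) \<longlonglongrightarrow> s"
  proof (rule tendsto_sandwich[of "\<lambda>_. s" _ _ "\<lambda>n. s + inverse (real (Suc n))"])
    show "(\<lambda>n. s + inverse (real (Suc n))) \<longlonglongrightarrow> s"
      using tendsto_add[OF tendsto_const LIMSEQ_inverse_real_of_nat, of s] by simp
  qed (use grid_above(1)[of s] grid_above(2)[of _ s] in \<open>auto intro!: always_eventually less_imp_le\<close>)
  then show ?thesis
    unfolding filterlim_at using grid_above(1)[of s] by (auto intro!: always_eventually simp: less_imp_neq[symmetric])
qed

text \<open>Evaluated at \<open>grid_above\<close>, the process is a single random variable on each
  of countably many time cells, hence jointly measurable; right continuity passes this to the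
  limit.\<close>

lemma right_continuous_jointly_measurable:
  fixes X :: "real \<Rightarrow> 'a \<Rightarrow> real"
  assumes meas: "\<And>t. 0 \<le> t \<Longrightarrow> X t \<in> borel_measurable M"
    and cont: "\<And>w t. w \<in> space M \<Longrightarrow> 0 \<le> t \<Longrightarrow> continuous (at_right t) (\<lambda>s. X s w)"
  shows "(\<lambda>(s, w). X (max 0 s) w) \<in> borel_measurable (borel \<Otimes>\<^sub>M M)"
proof (rule borel_measurable_LIMSEQ_real[where u = "\<lambda>n (s, w). X (grid_above n (max 0 s)) w"])
  let ?r = "\<lambda>n s. grid_above n (max 0 s)"
  fix p :: "real \<times> 'a" assume "p \<in> space (borel \<Otimes>\<^sub>M M)"
  then have w: "snd p \<in> space M" by (auto simp: space_pair_measure)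
  show "(\<lambda>n. case p of (s, w) \<Rightarrow> X (?r n s) w) \<longlonglongrightarrow> (case p of (s, w) \<Rightarrow> X (max 0 s) w)"
    using filterlim_compose[OF cont[OF w, of "max 0 (fst p)", unfolded continuous_within] filterlim_grid_above]
    by (simp add: case_prod_beta)
next
  fix n
  define g where "g p = \<lfloor>real (Suc n) * max 0 (fst p)\<rfloor>" for p :: "real \<times> 'a"
  have "(\<lambda>p. X (max 0 ((real_of_int (g p) + 1) / real (Suc n))) (snd p)) \<in> borel_measurable (borel \<Otimes>\<^sub>M M)"
  proof (rule measurable_compose_countable[where g = g and
      f = "\<lambda>i p. X (max 0 ((real_of_int i + 1) / real (Suc n))) (snd p)"])
    show "g \<in> borel \<Otimes>\<^sub>M M \<rightarrow>\<^sub>M count_space UNIV" unfolding g_def by measurable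
    show "(\<lambda>p. X (max 0 ((real_of_int i + 1) / real (Suc n))) (snd p)) \<in> borel_measurable (borel \<Otimes>\<^sub>M M)" for i
      by (rule measurable_compose[OF measurable_snd meas]) simp
  qed
  also have "(\<lambda>p. X (max 0 ((real_of_int (g p) + 1) / real (Suc n))) (snd p)) =
      (\<lambda>(s, w). X (grid_above n (max 0 s)) w)"
  proof (intro ext, clarify)
    fix s w
    have "0 \<le> grid_above n (max 0 s)" using grid_above(1)[of "max 0 s" n] by linarith
    then show "X (max 0 ((real_of_int (g (s, w)) + 1) / real (Suc n))) (snd (s, w)) = X (grid_above n (max 0 s)) w"
      by (simp add: g_def grid_above_def max_def)
  qed
  finally show "(\<lambda>(s, w). X (grid_above n (max 0 s)) w) \<in> borel_measurable (borel \<Otimes>\<^sub>M M)" .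
qed

text \<open>A null set contains no interval, so there are points of equality arbitrarily close to
  \<open>t\<close> on the right. Right continuity of \<open>F\<close> is available along one
  sequence only; monotonicity sandwiches the values at those points.\<close>

lemma eq_of_AE_eq_right_continuous:
  fixes F R :: "real \<Rightarrow> real"
  assumes ae: "AE t in lborel. t > 0 \<longrightarrow> F t = R t"
    and mono: "\<And>s t. 0 < s \<Longrightarrow> s \<le> t \<Longrightarrow> F s \<le> F t"
    and lim: "(\<lambda>n. F (t + inverse (real (Suc n)))) \<longlonglongrightarrow> F t"
    and cont: "continuous_on {0<..} R" and t: "t > 0"
  shows "F t = R t"
proof -
  have "\<exists>s\<in>{t<..<t + inverse (real (Suc n))}. F s = R s" for n
  proof (rule ccontr)
    assume neg: "\<not> ?thesis"
    have "AE s in lborel. s \<notin> {t<..<t + inverse (real (Suc n))}"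
      using ae by eventually_elim (use neg t in auto)
    then have "emeasure lborel {t<..<t + inverse (real (Suc n))} = 0"
      by (subst (asm) AE_iff_measurable[where N = "{t<..<t + inverse (real (Suc n))}"]) auto
    moreover have "emeasure lborel {t<..<t + inverse (real (Suc n))} = ennreal (t + inverse (real (Suc n)) - t)"
      by (rule emeasure_lborel_Ioo) simp
    moreover have "0 < t + inverse (real (Suc n)) - t" by simp
    ultimately show False by (simp only: ennreal_eq_0_iff)
  qed
  then obtain s where s: "\<And>n. t < s n" "\<And>n. s n < t + inverse (real (Suc n))" "\<And>n. F (s n) = R (s n)"
    by (metis greaterThanLessThan_iff)
  have s_lim: "s \<longlonglongrightarrow> t"
  proof (rule tendsto_sandwich[of "\<lambda>_. t" _ _ "\<lambda>n. t + inverse (real (Suc n))"])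
    show "(\<lambda>n. t + inverse (real (Suc n))) \<longlonglongrightarrow> t"
      using tendsto_add[OF tendsto_const LIMSEQ_inverse_real_of_nat, of t] by simp
  qed (use s in \<open>auto intro!: always_eventually less_imp_le\<close>)
  have "isCont R t" using cont t by (simp add: continuous_on_eq_continuous_at)
  from isCont_tendsto_compose[OF this s_lim]
  have "(\<lambda>n. R (s n)) \<longlonglongrightarrow> R t" .
  moreover have "(\<lambda>n. F (s n)) \<longlonglongrightarrow> F t"
  proof (rule tendsto_sandwich[OF _ _ tendsto_const lim])
    show "\<forall>\<^sub>F n in sequentially. F t \<le> F (s n)"
      by (intro always_eventually allI mono[OF t] less_imp_le s(1))
    show "\<forall>\<^sub>F n in sequentially. F (s n) \<le> F (t + inverse (real (Suc n)))"
      by (intro always_eventually allI mono[OF less_trans[OF t s(1)]] less_imp_le s(2))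
  qed
  ultimately show ?thesis unfolding s(3) by (intro LIMSEQ_unique)
qed

section \<open>First passage of a subordinator\<close>

locale subordinator = prob_space M
  for M :: "'a measure" +
  fixes D :: "real \<Rightarrow> 'a \<Rightarrow> real" and \<phi> :: "real \<Rightarrow> real"
  assumes D_meas: "\<And>t. 0 \<le> t \<Longrightarrow> D t \<in> borel_measurable M"
    and D_0: "AE w in M. D 0 w = 0"
    and D_right_cont: "\<And>w t. w \<in> space M \<Longrightarrow> 0 \<le> t \<Longrightarrow> continuous (at_right t) (\<lambda>s. D s w)"
    and D_mono: "\<And>w s t. w \<in> space M \<Longrightarrow> 0 \<le> s \<Longrightarrow> s \<le> t \<Longrightarrow> D s w \<le> D t w"
    and D_laplace: "\<And>t z. 0 \<le> t \<Longrightarrow> 0 < z \<Longrightarrow> (LINT w|M. exp (- z * D t w)) = exp (- t * \<phi> z)"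
    and \<phi>_pos: "\<And>z. 0 < z \<Longrightarrow> 0 < \<phi> z"
begin

lemma D_joint [measurable]: "(\<lambda>(s, w). D (max 0 s) w) \<in> borel_measurable (borel \<Otimes>\<^sub>M M)"
  by (rule right_continuous_jointly_measurable[OF D_meas D_right_cont])

lemma D_nonneg: "AE w in M. \<forall>s\<ge>0. 0 \<le> D s w"
  using D_0 AE_space by eventually_elim (metis D_mono order_refl)

lemma D_exp: 
  assumes "0 \<le> s" "0 < z"
  shows "(\<integral>\<^sup>+w. ennreal (exp (- z * D s w)) \<partial>M) = ennreal (exp (- s * \<phi> z))"
proof -
  note [measurable] = D_meas[OF assms(1)]
  have "AE w in M. norm (exp (- z * D s w)) \<le> 1"
    using D_nonneg by eventually_elim (use assms in auto)
  then have "integrable M (\<lambda>w. exp (- z * D s w))"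
    by (intro integrable_const_bound[where B = 1]) auto
  then show ?thesis
    using D_laplace[OF assms] by (simp add: nn_integral_eq_integral)
qed

text \<open>Chernoff's bound: where \<open>D s w \<le> t\<close>, the number
  \<open>exp (t - D s w)\<close> is at least 1.\<close>

lemma D_tail:
  assumes "0 \<le> s"
  shows "emeasure M {w \<in> space M. D s w \<le> t} \<le> ennreal (exp t * exp (- s * \<phi> 1))"
proof -
  note [measurable] = D_meas[OF assms]
  have "emeasure M {w \<in> space M. D s w \<le> t} = (\<integral>\<^sup>+w. indicator {w \<in> space M. D s w \<le> t} w \<partial>M)"
    by (rule nn_integral_indicator[symmetric]) measurable
  also have "\<dots> \<le> (\<integral>\<^sup>+w. ennreal (exp t) * ennreal (exp (- 1 * D s w)) \<partial>M)"
    by (intro nn_integral_mono) (auto simp: indicator_def simp flip: ennreal_mult exp_add)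
  also have "\<dots> = ennreal (exp t) * ennreal (exp (- s * \<phi> 1))"
    by (subst nn_integral_cmult) (use D_exp[OF assms, of 1] in auto)
  finally show ?thesis by (simp add: ennreal_mult)
qed

text \<open>By \<open>D_tail\<close>, staying below a fixed level at all integer times has
  probability 0. This excludes the paths on which \<open>inverse_subordinator\<close> returns its
  default 0.\<close>

lemma D_unbounded: "AE w in M. \<forall>t. \<exists>s\<ge>0. t < D s w"
proof -
  have "AE w in M. \<exists>n. real N < D (real n) w" for N :: nat
  proof -
    note [measurable] = D_meas
    let ?B = "\<lambda>n. {w \<in> space M. D (real n) w \<le> real N}"
    let ?A = "{w \<in> space M. \<forall>n. D (real n) w \<le> real N}"
    have "(\<lambda>n. ennreal (exp (real N) * exp (- real n * \<phi> 1))) \<longlonglongrightarrow> ennreal (exp (real N) * 0)"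
    proof (intro tendsto_ennrealI tendsto_mult_left)
      show "(\<lambda>n. exp (- real n * \<phi> 1)) \<longlonglongrightarrow> 0" using \<phi>_pos[of 1] by real_asymp
    qed
    moreover have "emeasure M ?A \<le> ennreal (exp (real N) * exp (- real n * \<phi> 1))" for n
    proof -
      have "emeasure M ?A \<le> emeasure M (?B n)" by (intro emeasure_mono) auto
      then show ?thesis using D_tail[of "real n" "real N"] by (rule order_trans) simp
    qed
    ultimately have "emeasure M ?A \<le> ennreal (exp (real N) * 0)"
      by (intro LIMSEQ_le_const) auto
    then have "emeasure M ?A = 0" by simp
    then show ?thesis
      by (intro AE_I'[of ?A]) (auto simp: null_sets_def not_less)
  qed
  then have "AE w in M. \<forall>N. \<exists>n. real N < D (real n) w" by (simp add: AE_all_countable)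
  then show ?thesis
  proof eventually_elim
    case (elim w)
    show ?case
    proof
      fix t
      obtain N where "t \<le> real N" using real_arch_simple by blast
      moreover obtain n where "real N < D (real n) w" using elim by blast
      ultimately show "\<exists>s\<ge>0. t < D s w" by (intro exI[of _ "real n"]) auto
    qed
  qed
qed

lemma inverse_nonneg: "0 \<le> inverse_subordinator D t w"
  unfolding inverse_subordinator_def by (auto intro!: real_of_ereal_pos INF_greatest)

text \<open>With \<open>le_inverseI\<close> this identifies
  \<open>s < inverse_subordinator D t w\<close> with \<open>D s w \<le> t\<close>, except possibly
  when \<open>s\<close> equals the inverse. This direction covers every path: if \<open>t\<close> is
  never exceeded, the inverse is 0 and no \<open>s\<close> qualifies.\<close>

lemma less_inverseD:
  assumes "0 \<le> s" "s < inverse_subordinator D t w" "0 < t"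
  shows "D s w \<le> t"
proof (rule ccontr)
  assume "\<not> D s w \<le> t"
  then have le: "(INF s\<in>{s. 0 \<le> s \<and> D s w > t}. ereal s) \<le> ereal s"
    using assms by (intro INF_lower) auto
  have "(0::ereal) \<le> (INF s\<in>{s. 0 \<le> s \<and> D s w > t}. ereal s)" by (auto intro!: INF_greatest)
  with le have "inverse_subordinator D t w \<le> s"
    using assms(3) unfolding inverse_subordinator_def
    by (cases "INF s\<in>{s. 0 \<le> s \<and> D s w > t}. ereal s") auto
  with assms show False by simp
qed

lemma le_inverseI:
  assumes w: "w \<in> space M" and s: "0 \<le> s" "D s w \<le> t" and ex: "\<exists>r\<ge>0. t < D r w" and t: "0 < t"
  shows "s \<le> inverse_subordinator D t w"
proof -
  obtain r where r: "0 \<le> r" "t < D r w" using ex by blast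
  have le: "(INF s\<in>{s. 0 \<le> s \<and> D s w > t}. ereal s) \<le> ereal r"
    using r by (intro INF_lower) auto
  have ge: "ereal s \<le> (INF s\<in>{s. 0 \<le> s \<and> D s w > t}. ereal s)"
  proof (rule INF_greatest)
    fix v assume "v \<in> {s. 0 \<le> s \<and> D s w > t}"
    then have "\<not> v \<le> s" using D_mono[OF w, of v s] s by auto
    then show "ereal s \<le> ereal v" by simp
  qed
  from le ge show ?thesis using t unfolding inverse_subordinator_def
    by (cases "INF s\<in>{s. 0 \<le> s \<and> D s w > t}. ereal s") auto
qed

abbreviation passage :: "real \<Rightarrow> real \<Rightarrow> ennreal" where
  "passage t s \<equiv> \<integral>\<^sup>+w. indicator {..t} (D (max 0 s) w) \<partial>M"

text \<open>The mean of the integral of \<open>f\<close> up to the inverse at \<open>t\<close>,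
  written through the distribution functions of \<open>D\<close>, because these are the quantities
  whose Laplace transform in \<open>t\<close> is accessible.\<close>

definition occupation :: "(real \<Rightarrow> ennreal) \<Rightarrow> real \<Rightarrow> ennreal" where
  "occupation f t = (\<integral>\<^sup>+s\<in>{0<..}. f s * passage t s \<partial>lborel)"

lemma D_joint_lborel [measurable]: "(\<lambda>(s, w). D (max 0 s) w) \<in> borel_measurable (lborel \<Otimes>\<^sub>M M)"
  using D_joint by (simp cong: measurable_cong_sets)

text \<open>Tonelli, followed for almost every path by replacing \<open>D s w \<le> t\<close> with
  \<open>s\<close> below the inverse; the two conditions differ at most at one point, a Lebesgue
  null set.\<close>

lemma occupation_eq:
  assumes [measurable]: "f \<in> borel_measurable borel" and t: "0 < t"
  shows "occupation f t = (\<integral>\<^sup>+w. (\<integral>\<^sup>+s\<in>{0<..<inverse_subordinator D t w}. f s \<partial>lborel) \<partial>M)"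
proof -
  interpret p: pair_sigma_finite lborel M ..
  have "occupation f t = (\<integral>\<^sup>+s. \<integral>\<^sup>+w. f s * indicator {0<..} s * indicator {..t} (D (max 0 s) w) \<partial>M \<partial>lborel)"
    unfolding occupation_def
  proof (rule nn_integral_cong)
    fix s :: real
    have "D (max 0 s) \<in> borel_measurable M" by (rule D_meas) simp
    then show "f s * passage t s * indicator {0<..} s =
        (\<integral>\<^sup>+w. f s * indicator {0<..} s * indicator {..t} (D (max 0 s) w) \<partial>M)"
      by (subst nn_integral_cmult) (simp_all add: mult_ac)
  qed
  also have "\<dots> = (\<integral>\<^sup>+w. \<integral>\<^sup>+s. f s * indicator {0<..} s * indicator {..t} (D (max 0 s) w) \<partial>lborel \<partial>M)"
    by (rule p.Fubini'[symmetric]) measurable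
  also have "\<dots> = (\<integral>\<^sup>+w. (\<integral>\<^sup>+s\<in>{0<..<inverse_subordinator D t w}. f s \<partial>lborel) \<partial>M)"
  proof (rule nn_integral_cong_AE)
    show "AE w in M. (\<integral>\<^sup>+s. f s * indicator {0<..} s * indicator {..t} (D (max 0 s) w) \<partial>lborel) =
        (\<integral>\<^sup>+s\<in>{0<..<inverse_subordinator D t w}. f s \<partial>lborel)"
      using D_unbounded AE_space
    proof eventually_elim
      case (elim w)
      let ?y = "inverse_subordinator D t w"
      show ?case
      proof (rule nn_integral_cong_AE)
        show "AE s in lborel. f s * indicator {0<..} s * indicator {..t} (D (max 0 s) w) = f s * indicator {0<..<?y} s"
          using AE_lborel_singleton[of ?y]
        proof eventually_elim
          case (elim s)
          have "s < ?y \<longleftrightarrow> D s w \<le> t" if "0 < s"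
            using less_inverseD[of s t w] le_inverseI[of w s t] that elim t \<open>w \<in> space M\<close> \<open>\<forall>t. \<exists>s\<ge>0. t < D s w\<close>
            by fastforce
          then show ?case by (auto simp: indicator_def)
        qed
      qed
    qed
  qed
  finally show ?thesis .
qed

lemma occupation_mono: "s \<le> t \<Longrightarrow> occupation f s \<le> occupation f t"
  unfolding occupation_def by (intro nn_integral_mono mult_mono) (auto simp: indicator_def)

lemma occupation_measurable [measurable]:
  assumes [measurable]: "f \<in> borel_measurable borel"
  shows "occupation f \<in> borel_measurable borel"
proof -
  have "(\<lambda>t. \<integral>\<^sup>+s. f s * (\<integral>\<^sup>+w. (if D (max 0 s) w \<le> t then 1 else 0) \<partial>M) * indicator {0<..} s \<partial>lborel) \<in> borel_measurable borel"
    by measurable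
  moreover have "indicator {..t} x = (if x \<le> t then 1 else 0 :: ennreal)" for t x :: real
    by (simp add: indicator_def)
  ultimately show ?thesis unfolding occupation_def[abs_def] by simp
qed

text \<open>Integrating \<open>exp (- z * t)\<close> over \<open>t \<ge> D s w\<close> gives
  \<open>exp (- z * D s w) / z\<close>, with mean \<open>exp (- s * \<phi> z) / z\<close>;
  integration against \<open>f\<close> then evaluates its transform at
  \<open>\<phi> z\<close>.\<close>

lemma nn_laplace_occupation:
  assumes f [measurable]: "f \<in> borel_measurable borel" and z: "0 < z"
  shows "nn_laplace (occupation f) z = ennreal (1 / z) * nn_laplace f (\<phi> z)"
proof -
  interpret p: pair_sigma_finite lborel M ..
  let ?i = "\<lambda>s w t. (if D (max 0 s) w \<le> t then 1 else 0 :: ennreal)"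
  let ?p = "\<lambda>s t. \<integral>\<^sup>+w. ?i s w t \<partial>M"
  have ind: "indicator {..t} x = (if x \<le> t then 1 else 0 :: ennreal)" for t x :: real
    by (simp add: indicator_def)
  let ?e = "\<lambda>t. ennreal (exp (- z * t)) * indicator {0<..} t"
  let ?g = "\<lambda>s. f s * indicator {0<..} s"
  have inner: "(\<integral>\<^sup>+t. ?e t * ?p s t \<partial>lborel) = ennreal (1 / z) * ennreal (exp (- \<phi> z * s))" if s: "0 < s" for s
  proof -
    note [measurable] = D_meas[of "max 0 s"]
    have "(\<integral>\<^sup>+t. ?e t * ?p s t \<partial>lborel) = (\<integral>\<^sup>+t. \<integral>\<^sup>+w. ?e t * ?i s w t \<partial>M \<partial>lborel)"
      by (intro nn_integral_cong nn_integral_cmult[symmetric]) measurable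
    also have "\<dots> = (\<integral>\<^sup>+w. \<integral>\<^sup>+t. ?e t * ?i s w t \<partial>lborel \<partial>M)"
      by (rule p.Fubini'[symmetric]) measurable
    also have "\<dots> = (\<integral>\<^sup>+w. ennreal (1 / z) * ennreal (exp (- z * D s w)) \<partial>M)"
    proof (rule nn_integral_cong_AE)
      show "AE w in M. (\<integral>\<^sup>+t. ?e t * ?i s w t \<partial>lborel) = ennreal (1 / z) * ennreal (exp (- z * D s w))"
        using D_nonneg
      proof eventually_elim
        case (elim w)
        define d where "d = D s w"
        have d: "0 \<le> d" using elim s by (simp add: d_def)
        have "(\<integral>\<^sup>+t. ?e t * ?i s w t \<partial>lborel) = (\<integral>\<^sup>+t. ennreal (exp (- z * t)) * indicator {d..} t \<partial>lborel)"
        proof (rule nn_integral_cong_AE)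
          show "AE t in lborel. ?e t * ?i s w t = ennreal (exp (- z * t)) * indicator {d..} t"
            using AE_lborel_singleton[of 0] by eventually_elim (use s d in \<open>auto simp: d_def[symmetric] indicator_def\<close>)
        qed
        also have "\<dots> = ennreal (0 - (- exp (- z * d) / z))"
        proof (rule nn_integral_FTC_atLeast)
          show "((\<lambda>t. - exp (- z * t) / z) \<longlongrightarrow> 0) at_top" using z by real_asymp
        qed (use z in \<open>auto intro!: derivative_eq_intros\<close>)
        also have "\<dots> = ennreal (1 / z) * ennreal (exp (- z * D s w))"
          using z by (simp add: d_def flip: ennreal_mult)
        finally show ?case .
      qed
    qed
    also have "\<dots> = ennreal (1 / z) * ennreal (exp (- s * \<phi> z))"
      using D_meas[of s] s z by (subst nn_integral_cmult) (simp_all add: D_exp[unfolded mult_minus_left])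
    finally show ?thesis by (simp add: mult.commute)
  qed
  have "nn_laplace (occupation f) z = (\<integral>\<^sup>+t. \<integral>\<^sup>+s. ?g s * (?e t * ?p s t) \<partial>lborel \<partial>lborel)"
    unfolding nn_laplace_def occupation_def ind
  proof (rule nn_integral_cong)
    fix t :: real
    have "ennreal (exp (- z * t)) * (\<integral>\<^sup>+s\<in>{0<..}. f s * ?p s t \<partial>lborel) * indicator {0<..} t =
        ?e t * (\<integral>\<^sup>+s\<in>{0<..}. f s * ?p s t \<partial>lborel)" by (simp only: mult_ac)
    also have "\<dots> = (\<integral>\<^sup>+s. ?e t * (f s * ?p s t * indicator {0<..} s) \<partial>lborel)"
      by (rule nn_integral_cmult[symmetric]) measurable
    finally show "ennreal (exp (- z * t)) * (\<integral>\<^sup>+s\<in>{0<..}. f s * ?p s t \<partial>lborel) * indicator {0<..} t =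
        (\<integral>\<^sup>+s. ?g s * (?e t * ?p s t) \<partial>lborel)" by (simp only: mult_ac)
  qed
  also have "\<dots> = (\<integral>\<^sup>+s. \<integral>\<^sup>+t. ?g s * (?e t * ?p s t) \<partial>lborel \<partial>lborel)"
    by (rule lborel_pair.Fubini') measurable
  also have "\<dots> = (\<integral>\<^sup>+s. ennreal (1 / z) * (ennreal (exp (- \<phi> z * s)) * f s * indicator {0<..} s) \<partial>lborel)"
  proof (rule nn_integral_cong)
    fix s :: real
    have "(\<integral>\<^sup>+t. ?g s * (?e t * ?p s t) \<partial>lborel) = ?g s * (\<integral>\<^sup>+t. ?e t * ?p s t \<partial>lborel)"
      by (rule nn_integral_cmult) measurable
    also have "\<dots> = ennreal (1 / z) * (ennreal (exp (- \<phi> z * s)) * f s * indicator {0<..} s)"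
    proof (cases "0 < s")
      case True
      show ?thesis unfolding inner[OF True] by (simp only: mult_ac)
    qed simp
    finally show "(\<integral>\<^sup>+t. ?g s * (?e t * ?p s t) \<partial>lborel) =
        ennreal (1 / z) * (ennreal (exp (- \<phi> z * s)) * f s * indicator {0<..} s)" .
  qed
  also have "\<dots> = ennreal (1 / z) * nn_laplace f (\<phi> z)"
    unfolding nn_laplace_def by (rule nn_integral_cmult) measurable
  finally show ?thesis .
qed

text \<open>By monotonicity an infinite value would persist at all later times and force the
  transform to be infinite.\<close>

lemma occupation_finite:
  assumes [measurable]: "f \<in> borel_measurable borel" and z: "0 < z" and fin: "nn_laplace f (\<phi> z) < \<infinity>"
  shows "occupation f t < \<infinity>"
proof (rule ccontr)
  define a where "a = max 0 t"
  assume "\<not> occupation f t < \<infinity>"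
  then have inf: "occupation f v = \<infinity>" if "a \<le> v" for v
    using occupation_mono[of t v f] that by (auto simp: a_def top_unique not_less)
  have "emeasure lborel {a<..<a + 1} * \<infinity> = (\<integral>\<^sup>+v. \<infinity> * indicator {a<..<a + 1} v \<partial>lborel)"
    by (subst nn_integral_cmult_indicator) (auto simp: mult.commute)
  also have "\<dots> \<le> nn_laplace (occupation f) z" unfolding nn_laplace_def
    by (intro nn_integral_mono) (auto simp: indicator_def inf a_def ennreal_mult_top)
  also have "\<dots> < \<infinity>" using fin unfolding nn_laplace_occupation[OF assms(1) z] by (simp add: ennreal_mult_less_top)
  finally show False by simp
qed

lemma occupation_right_continuous:
  assumes [measurable]: "f \<in> borel_measurable borel" and f_fin: "\<And>s. f s < \<infinity>"
    and fin: "\<And>t. occupation f t < \<infinity>"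
  shows "(\<lambda>n. occupation f (t + inverse (real (Suc n)))) \<longlonglongrightarrow> occupation f t"
proof -
  let ?t = "\<lambda>n. t + inverse (real (Suc n))"
  have t_le: "?t n \<le> t + 1" for n by (simp add: field_simps)
  have ind: "(\<lambda>n. indicator {..?t n} x :: ennreal) \<longlonglongrightarrow> indicator {..t} x" for x :: real
  proof (cases "x \<le> t")
    case True
    then have "x \<le> ?t n" for n by (simp add: add_increasing2)
    with True show ?thesis by simp
  next
    case False
    have "?t \<longlonglongrightarrow> t" using tendsto_add[OF tendsto_const LIMSEQ_inverse_real_of_nat, of t] by simp
    then have "\<forall>\<^sub>F n in sequentially. ?t n < x" using False by (intro order_tendstoD) auto
    then show ?thesis by (intro tendsto_eventually) (auto elim!: eventually_mono simp: False)
  qed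
  have [measurable]: "D (max 0 s) \<in> borel_measurable M" for s by (rule D_meas) simp
  have M_lim: "(\<lambda>n. passage (?t n) s) \<longlonglongrightarrow> passage t s" for s
  proof (rule nn_integral_dominated_convergence[where w = "\<lambda>_. 1"])
    show "AE w in M. (\<lambda>n. indicator {..?t n} (D (max 0 s) w) :: ennreal) \<longlonglongrightarrow> indicator {..t} (D (max 0 s) w)"
      by (intro AE_I2 ind)
  qed (auto simp: emeasure_space_1 indicator_def)
  have fin1: "occupation f (t + 1) < \<infinity>" by (rule fin)
  have ind': "indicator {..t} x = (if x \<le> t then 1 else 0 :: ennreal)" for t x :: real
    by (simp add: indicator_def)
  have [measurable]: "(\<lambda>s. f s * passage v s * indicator {0<..} s) \<in> borel_measurable lborel" for v
    unfolding ind' by measurable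
  show ?thesis unfolding occupation_def
  proof (rule nn_integral_dominated_convergence[where w = "\<lambda>s. f s * passage (t + 1) s * indicator {0<..} s"])
    show "AE s in lborel. f s * passage (?t n) s * indicator {0<..} s \<le>
        f s * passage (t + 1) s * indicator {0<..} s" for n
      using order_trans[OF _ t_le[of n]]
      by (intro AE_I2 mult_mono nn_integral_mono) (auto simp: indicator_def)
    show "(\<integral>\<^sup>+s. f s * passage (t + 1) s * indicator {0<..} s \<partial>lborel) < \<infinity>"
      using fin1 by (simp add: occupation_def)
    show "AE s in lborel. (\<lambda>n. f s * passage (?t n) s * indicator {0<..} s) \<longlonglongrightarrow>
        f s * passage t s * indicator {0<..} s"
    proof (rule AE_I2)
      fix s
      \<comment> \<open>Multiplication by a constant is continuous in \<open>ennreal\<close> only if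
        the constant is finite or the limit is nonzero, hence the hypothesis on
        \<open>f\<close>.\<close>
      have "f s * indicator {0<..} s < top" using f_fin[of s] by (simp add: indicator_def)
      from ennreal_tendsto_cmult[OF this M_lim[of s]]
      show "(\<lambda>n. f s * passage (?t n) s * indicator {0<..} s) \<longlonglongrightarrow>
        f s * passage t s * indicator {0<..} s"
        by (simp only: mult_ac)
    qed
  qed auto
qed

end

section \<open>Laplace inversion and time change\<close>

lemma nn_laplace_eq_laplace:
  assumes "laplace_integrable g s" "\<And>t. t > 0 \<Longrightarrow> 0 \<le> g t"
  shows "nn_laplace (\<lambda>t. ennreal (g t)) s = ennreal (laplace g s)" "0 \<le> laplace g s"
proof -
  have nn: "0 \<le> laplace_term g s t" for t
    using assms(2) by (auto simp: indicator_def)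
  have "nn_laplace (\<lambda>t. ennreal (g t)) s = (\<integral>\<^sup>+t. ennreal (laplace_term g s t) \<partial>lborel)"
    unfolding nn_laplace_def using assms(2)
    by (intro nn_integral_cong) (auto simp: indicator_def ennreal_mult')
  also have "\<dots> = ennreal (laplace g s)"
    unfolding laplace_def set_lebesgue_integral_def using assms(1) nn
    by (intro nn_integral_eq_integral) (auto simp: laplace_defs)
  finally show "nn_laplace (\<lambda>t. ennreal (g t)) s = ennreal (laplace g s)" .
  show "0 \<le> laplace g s"
    unfolding laplace_def set_lebesgue_integral_def using nn by (intro Bochner_Integration.integral_nonneg) auto
qed

text \<open>Knowing the transforms beyond \<open>z\<close> also delivers finiteness of
  \<open>occupation\<close> and nonnegativity of \<open>R t\<close>; the latter cannot be seen from
  the alternating series that define \<open>R\<close> in the applications.\<close>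

lemma (in subordinator) occupation_inversion:
  assumes f [measurable]: "f \<in> borel_measurable borel" and f_fin: "\<And>s. f s < \<infinity>"
    and R: "exp_bounded b z C R" "b > 0" "z > 0"
    and eq: "\<And>s. s > z \<Longrightarrow> ennreal (1 / s) * nn_laplace f (\<phi> s) = ennreal (laplace R s)"
    and nn: "\<And>s. s > z \<Longrightarrow> 0 \<le> laplace R s"
    and t: "t > 0"
  shows "occupation f t = ennreal (R t)" "0 \<le> R t"
proof -
  have lap: "nn_laplace (occupation f) s = ennreal (laplace R s)" if "s > z" for s
    using nn_laplace_occupation[OF f, of s] eq[OF that] that R(3) by simp
  have "nn_laplace f (\<phi> (z + 1)) < \<infinity>"
  proof -
    have "ennreal (1 / (z + 1)) * nn_laplace f (\<phi> (z + 1)) < \<infinity>" using eq[of "z + 1"] by simp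
    then show ?thesis using R(3) by (auto simp: ennreal_mult_less_top)
  qed
  then have fin: "occupation f v < \<infinity>" for v using R(3) by (intro occupation_finite[OF f, of "z + 1"]) auto
  define F where "F v = enn2real (occupation f v)" for v
  have F: "ennreal (F v) = occupation f v" "0 \<le> F v" for v
    using fin[of v] by (simp_all add: F_def)
  have [measurable]: "F \<in> borel_measurable borel" unfolding F_def by measurable
  have FL: "laplace_integrable F s \<and> laplace F s = laplace R s" if s: "s > z" for s
  proof -
    have "(\<integral>\<^sup>+v. ennreal (laplace_term F s v) \<partial>lborel) = nn_laplace (occupation f) s"
      unfolding nn_laplace_def by (intro nn_integral_cong) (auto simp: indicator_def ennreal_mult' F)
    also have "\<dots> = ennreal (laplace R s)" by (rule lap[OF s])
    finally have "integrable lborel (laplace_term F s) \<and>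
        (LINT v|lborel. laplace_term F s v) = laplace R s"
      by (subst (asm) nn_integral_eq_integrable) (auto simp: F nn[OF s])
    then show ?thesis by (simp add: laplace_defs)
  qed
  have "AE v in lborel. v > 0 \<longrightarrow> F v = R v"
    using exp_bounded_measurable[OF R(1)] FL exp_bounded_laplace(1)[OF R(1,2)]
    by (intro laplace_unique[where z = z]) auto
  moreover have "F v \<le> F w" if "0 < v" "v \<le> w" for v w
    unfolding F_def using fin occupation_mono[OF that(2)] by (intro enn2real_mono) auto
  moreover have "(\<lambda>n. F (t + inverse (real (Suc n)))) \<longlonglongrightarrow> F t"
  proof -
    have "(\<lambda>n. occupation f (t + inverse (real (Suc n)))) \<longlonglongrightarrow> ennreal (F t)"
      unfolding F(1) by (rule occupation_right_continuous[OF f f_fin fin])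
    from tendsto_enn2real[OF this F(2)] show ?thesis by (simp add: F_def)
  qed
  moreover have "continuous_on {0<..} R" using R(1) by (simp add: exp_bounded_def)
  ultimately have "F t = R t" using t by (intro eq_of_AE_eq_right_continuous)
  then show "occupation f t = ennreal (R t)" "0 \<le> R t" using F[of t] by simp_all
qed

section \<open>Independence and evaluation at a random time\<close>

lemma generated_eventsI:
  assumes "0 \<le> t" "B \<in> sets N" "space N = UNIV"
  shows "{w \<in> space M. X t w \<in> B} \<in> generated_events M N X"
proof -
  let ?A = "{g \<in> space (PiM {0..} (\<lambda>_::real. N)). g t \<in> B}"
  have "t \<in> {0..}" using assms by simp
  then have "?A \<in> sets (PiM {0..} (\<lambda>_. N))" using assms(2) by measurable
  from in_vimage_algebra[OF this, of "\<lambda>w. \<lambda>t\<in>{0..}. X t w" "space M"]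
  have "(\<lambda>w. \<lambda>t\<in>{0..}. X t w) -` ?A \<inter> space M \<in> generated_events M N X"
    unfolding generated_events_def .
  also have "(\<lambda>w. \<lambda>t\<in>{0..}. X t w) -` ?A \<inter> space M = {w \<in> space M. X t w \<in> B}"
    using assms by (auto simp: space_PiM)
  finally show ?thesis .
qed

text \<open>The Markov property with time 0 as the only conditioning time; the initial state has
  probability 1, so conditioning on it changes nothing.\<close>

lemma (in prob_space) ctmc_marginal:
  assumes X: "ctmc M S q x0 X" and x0: "x0 \<in> S"
  obtains P where "transition_function_with_rates S q P"
    "\<And>t x. 0 \<le> t \<Longrightarrow> x \<in> S \<Longrightarrow> prob {w \<in> space M. X t w = x} = P t x0 x"
proof -
  from X obtain P where P: "transition_function_with_rates S q P"
    and mk: "\<forall>(n::nat) (ts :: nat \<Rightarrow> real) xs.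
           0 \<le> ts 0 \<and> (\<forall>i\<le>n. ts i \<le> ts (Suc i)) \<and> (\<forall>i\<le>Suc n. xs i \<in> S) \<and>
           \<P>(w in M. \<forall>i\<le>n. X (ts i) w = xs i) > 0 \<longrightarrow>
           \<P>(w in M. X (ts (Suc n)) w = xs (Suc n) \<bar> \<forall>i\<le>n. X (ts i) w = xs i) =
             P (ts (Suc n) - ts n) (xs n) (xs (Suc n))"
    unfolding ctmc_def by (elim conjE exE) (rule that)
  have X_meas: "X t \<in> M \<rightarrow>\<^sub>M count_space UNIV" if "0 \<le> t" for t using X that by (simp add: ctmc_def)
  have ev: "{w \<in> space M. X t w = x} \<in> events" if "0 \<le> t" for t x
    using measurable_sets[OF X_meas[OF that], of "{x}"] by (simp add: vimage_def Int_def conj_commute)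
  have start: "AE w in M. X 0 w = x0" using X by (simp add: ctmc_def)
  then have one: "prob {w \<in> space M. X 0 w = x0} = 1"
    using prob_Collect_eq_1[of "\<lambda>w. X 0 w = x0"] ev[of 0 x0] by simp
  have "prob {w \<in> space M. X t w = x} = P t x0 x" if t: "0 \<le> t" and x: "x \<in> S" for t x
  proof -
    have "\<P>(w in M. X t w = x \<bar> X 0 w = x0) = P t x0 x"
      using mk[THEN spec[where x = 0], THEN spec[where x = "\<lambda>i. if i = 0 then 0 else t"],
          THEN spec[where x = "\<lambda>i. if i = 0 then x0 else x"]]
        t x x0 one by simp
    moreover have "prob {w \<in> space M. X t w = x \<and> X 0 w = x0} = prob {w \<in> space M. X t w = x}"
    proof (rule finite_measure_eq_AE)
      show "{w \<in> space M. X t w = x \<and> X 0 w = x0} \<in> events"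
        using sets.Int[OF ev[OF t, of x] ev[of 0 x0]] by (simp add: Int_def conj_ac)
      show "AE w in M. (w \<in> {w \<in> space M. X t w = x \<and> X 0 w = x0}) = (w \<in> {w \<in> space M. X t w = x})"
        using start by eventually_elim auto
    qed (rule ev[OF t])
    ultimately show ?thesis using one by (simp add: cond_prob_def)
  qed
  with P show ?thesis using that by blast
qed

text \<open>Independence of two families includes that their members are events, which yields
  measurability of \<open>Y t\<close> without studying the infimum that defines it.\<close>

lemma (in prob_space) indep_processes_measurable:
  assumes "indep_processes M X Y" "0 \<le> t"
  shows "Y t \<in> borel_measurable M"
proof (rule measurableI)
  have gen: "generated_events M borel Y \<subseteq> events"
    using assms(1) by (simp add: indep_processes_def indep_set_def indep_sets_def UNIV_bool)
  fix B :: "real set" assume "B \<in> sets borel"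
  then have "{w \<in> space M. Y t w \<in> B} \<in> generated_events M borel Y"
    using assms(2) by (intro generated_eventsI) auto
  then show "Y t -` B \<inter> space M \<in> events"
    using gen by (auto simp: vimage_def Int_def conj_commute)
qed simp

text \<open>The random time is approximated from above by grid points, where independence applies event by event;
  right continuity of the paths and continuity of \<open>p\<close> pass to the limit.\<close>

lemma (in prob_space) independent_time_change:
  fixes X :: "real \<Rightarrow> 'a \<Rightarrow> 's"
  assumes X_meas: "\<And>t. 0 \<le> t \<Longrightarrow> X t \<in> M \<rightarrow>\<^sub>M count_space UNIV"
    and X_right: "\<And>t w. 0 \<le> t \<Longrightarrow> w \<in> space M \<Longrightarrow> \<forall>\<^sub>F s in at_right t. X s w = X t w"
    and indep: "indep_processes M X Y" and t: "0 \<le> t" and Y_nonneg: "\<And>w. 0 \<le> Y t w"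
    and p: "\<And>s. 0 \<le> s \<Longrightarrow> prob {w \<in> space M. X s w = x} = p s" and p_cont: "continuous_on {0..} p"
  shows "{w \<in> space M. X (Y t w) w = x} \<in> events"
    and "emeasure M {w \<in> space M. X (Y t w) w = x} = (\<integral>\<^sup>+w. ennreal (p (Y t w)) \<partial>M)"
proof -
  define T where "T = Y t"
  have T0: "0 \<le> T w" for w using Y_nonneg by (simp add: T_def)
  have ind: "indep_set (generated_events M (count_space UNIV) X) (generated_events M borel Y)"
    using indep by (simp add: indep_processes_def)
  have T_gen: "{w \<in> space M. T w \<in> B} \<in> generated_events M borel Y" if "B \<in> sets borel" for B
    unfolding T_def using t that by (intro generated_eventsI) auto
  have [measurable]: "T \<in> borel_measurable M"
    unfolding T_def by (rule indep_processes_measurable[OF indep t])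
  have X_ev [measurable]: "{w \<in> space M. X s w = x} \<in> events" if "0 \<le> s" for s
    using measurable_sets[OF X_meas[OF that], of "{x}"] by (simp add: vimage_def Int_def conj_commute)
  have p01: "0 \<le> p s" "p s \<le> 1" if "0 \<le> s" for s using p[OF that, symmetric] by auto
  define g where "g n i = (real i + 1) / real (Suc n)" for n i :: nat
  define N where "N n w = nat \<lfloor>real (Suc n) * T w\<rfloor>" for n w
  have g0: "0 \<le> g n i" for n i by (simp add: g_def)
  have gN: "g n (N n w) = grid_above n (T w)" for n w
    using T0[of w] by (simp add: g_def N_def grid_above_def)
  have [measurable]: "N n \<in> M \<rightarrow>\<^sub>M count_space UNIV" for n unfolding N_def by measurable
  let ?E = "\<lambda>n. {w \<in> space M. X (grid_above n (T w)) w = x}"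
  let ?A = "\<lambda>n i. {w \<in> space M. N n w = i}"
  let ?B = "\<lambda>n i. {w \<in> space M. X (g n i) w = x}"
  \<comment> \<open>Within one cell of the grid the time is a constant, so each piece is the
    intersection of one event of \<open>X\<close> with one of \<open>Y\<close>.\<close>
  have E_UN: "?E n = (\<Union>i. ?B n i \<inter> ?A n i)" for n by (auto simp: gN[symmetric])
  have B_ev: "?B n i \<in> events" for n i by (rule X_ev[OF g0])
  have AB_ev: "?B n i \<inter> ?A n i \<in> events" for n i
    using B_ev by (intro sets.Int) auto
  have E_ev: "?E n \<in> events" for n unfolding E_UN using AB_ev by (intro sets.countable_UN) auto
  have E_prob: "emeasure M (?E n) = (\<integral>\<^sup>+w. ennreal (p (grid_above n (T w))) \<partial>M)" for n
  proof -
    have "emeasure M (?B n i \<inter> ?A n i) = ennreal (p (g n i)) * emeasure M (?A n i)" for i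
    proof -
      have B_gen: "?B n i \<in> generated_events M (count_space UNIV) X"
        using generated_eventsI[of "g n i" "{x}" "count_space UNIV" M X] g0 by simp
      have "?A n i = {w \<in> space M. T w \<in> {s. nat \<lfloor>real (Suc n) * s\<rfloor> = i}}" by (auto simp: N_def)
      moreover have "{s :: real. nat \<lfloor>real (Suc n) * s\<rfloor> = i} \<in> sets borel"
      proof -
        have "(\<lambda>s :: real. nat \<lfloor>real (Suc n) * s\<rfloor>) \<in> borel \<rightarrow>\<^sub>M count_space UNIV" by measurable
        from measurable_sets[OF this, of "{i}"] show ?thesis by (simp add: vimage_def)
      qed
      ultimately have "?A n i \<in> generated_events M borel Y" using T_gen by (simp only:)
      then have "prob (?B n i \<inter> ?A n i) = prob (?B n i) * prob (?A n i)"
        by (rule indep_setD[OF ind B_gen])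
      then show ?thesis using p[OF g0, of n i] by (simp add: emeasure_eq_measure ennreal_mult p01 g0)
    qed
    then have "emeasure M (?E n) = (\<Sum>i. ennreal (p (g n i)) * emeasure M (?A n i))"
      unfolding E_UN using AB_ev
      by (subst suminf_emeasure[symmetric]) (auto simp: disjoint_family_on_def)
    also have "\<dots> = (\<Sum>i. \<integral>\<^sup>+w. ennreal (p (g n i)) * indicator (?A n i) w \<partial>M)"
      by (intro suminf_cong nn_integral_cmult_indicator[symmetric]) measurable
    also have "\<dots> = (\<integral>\<^sup>+w. (\<Sum>i. ennreal (p (g n i)) * indicator (?A n i) w) \<partial>M)"
      by (intro nn_integral_suminf[symmetric]) measurable
    also have "\<dots> = (\<integral>\<^sup>+w. ennreal (p (grid_above n (T w))) \<partial>M)"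
    proof (rule nn_integral_cong)
      fix w assume w: "w \<in> space M"
      have "(\<Sum>i. ennreal (p (g n i)) * indicator (?A n i) w) = (\<Sum>i\<in>{N n w}. ennreal (p (g n i)) * indicator (?A n i) w)"
        by (intro suminf_finite) auto
      then show "(\<Sum>i. ennreal (p (g n i)) * indicator (?A n i) w) = ennreal (p (grid_above n (T w)))"
        using w by (simp add: gN)
    qed
    finally show ?thesis .
  qed
  let ?Z = "{w \<in> space M. X (T w) w = x}"
  have ind_lim: "(\<lambda>n. indicator (?E n) w :: real) \<longlonglongrightarrow> indicator ?Z w" if w: "w \<in> space M" for w
    using filterlim_iff[THEN iffD1, OF filterlim_grid_above, rule_format, OF X_right[OF T0[of w] w]] w
    by (intro tendsto_eventually) (auto elim!: eventually_mono simp: indicator_def)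
  have "(indicator ?Z :: 'a \<Rightarrow> real) \<in> borel_measurable M"
    by (rule borel_measurable_LIMSEQ_real[OF ind_lim]) (use E_ev in auto)
  then have Z: "?Z \<in> events" by (simp add: borel_measurable_indicator_iff Int_absorb2 Collect_conj_eq)
  then show "{w \<in> space M. X (Y t w) w = x} \<in> events" by (simp add: T_def)
  have "(\<lambda>n. \<integral>\<^sup>+w. ennreal (indicator (?E n) w) \<partial>M) \<longlonglongrightarrow> (\<integral>\<^sup>+w. ennreal (indicator ?Z w) \<partial>M)"
  proof (rule nn_integral_dominated_convergence[where w = "\<lambda>_. 1"])
    show "AE w in M. (\<lambda>n. ennreal (indicator (?E n) w)) \<longlonglongrightarrow> ennreal (indicator ?Z w)"
      by (intro AE_I2 tendsto_ennrealI ind_lim)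
  qed (use E_ev Z in \<open>auto simp: emeasure_space_1 indicator_def\<close>)
  then have lim1: "(\<lambda>n. emeasure M (?E n)) \<longlonglongrightarrow> emeasure M ?Z"
    using E_ev Z by (simp add: ennreal_indicator)
  have p_meas: "(\<lambda>w. p (f w)) \<in> borel_measurable M" if [measurable]: "f \<in> borel_measurable M" and "\<And>w. 0 \<le> f w" for f
  proof -
    have "continuous_on UNIV (\<lambda>s. p (max 0 s))"
      by (intro continuous_on_compose2[OF p_cont] continuous_intros) auto
    then have "(\<lambda>s. p (max 0 s)) \<in> borel_measurable borel" by (rule borel_measurable_continuous_onI)
    from measurable_compose[OF that(1) this] show ?thesis using that(2) by (simp add: max_def)
  qed
  have grid_nonneg: "0 \<le> grid_above n (T w)" for n w
    using grid_above(1)[of "T w" n] T0[of w] by linarith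
  have [measurable]: "(\<lambda>w. grid_above n (T w)) \<in> borel_measurable M" for n
    unfolding grid_above_def by measurable
  have "(\<lambda>n. \<integral>\<^sup>+w. ennreal (p (grid_above n (T w))) \<partial>M) \<longlonglongrightarrow> (\<integral>\<^sup>+w. ennreal (p (T w)) \<partial>M)"
  proof (rule nn_integral_dominated_convergence[where w = "\<lambda>_. 1"])
    show "AE w in M. (\<lambda>n. ennreal (p (grid_above n (T w)))) \<longlonglongrightarrow> ennreal (p (T w))"
    proof (intro AE_I2 tendsto_ennrealI)
      fix w
      have "(\<lambda>n. grid_above n (T w)) \<longlonglongrightarrow> T w"
        using filterlim_grid_above[of "T w"] by (simp add: filterlim_at)
      then show "(\<lambda>n. p (grid_above n (T w))) \<longlonglongrightarrow> p (T w)"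
        using p_cont[unfolded continuous_on_sequentially] T0[of w] grid_nonneg by (auto simp: o_def)
    qed
    show "(\<lambda>w. ennreal (p (grid_above n (T w)))) \<in> borel_measurable M" for n
      by (intro measurable_compose[OF p_meas]) (auto simp: grid_nonneg)
    show "(\<lambda>w. ennreal (p (T w))) \<in> borel_measurable M"
      by (intro measurable_compose[OF p_meas]) (auto simp: T0)
  qed (auto simp: emeasure_space_1 p01 grid_nonneg)
  with lim1 show "emeasure M {w \<in> space M. X (Y t w) w = x} = (\<integral>\<^sup>+w. ennreal (p (Y t w)) \<partial>M)"
    unfolding E_prob by (simp add: LIMSEQ_unique T_def)
qed

lemma nn_integral_countable_partition:
  fixes Z :: "'a \<Rightarrow> 's::countable" and f :: "'s \<Rightarrow> ennreal"
  assumes ev: "\<And>x. {w \<in> space M. Z w = x} \<in> sets M"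
  shows "(\<integral>\<^sup>+w. f (Z w) \<partial>M) = (\<integral>\<^sup>+x. f x * emeasure M {w \<in> space M. Z w = x} \<partial>count_space UNIV)"
proof -
  have "(\<integral>\<^sup>+w. f (Z w) \<partial>M) = (\<integral>\<^sup>+w. \<integral>\<^sup>+x. f x * indicator {w \<in> space M. Z w = x} w \<partial>count_space UNIV \<partial>M)"
  proof (rule nn_integral_cong)
    fix w assume "w \<in> space M"
    then have "(\<integral>\<^sup>+x. f x * indicator {w \<in> space M. Z w = x} w \<partial>count_space UNIV) =
        (\<integral>\<^sup>+x. f x * indicator {Z w} x \<partial>count_space UNIV)"
      by (intro nn_integral_cong) (auto simp: indicator_def)
    also have "\<dots> = f (Z w)" by (subst nn_integral_indicator_singleton) auto
    finally show "f (Z w) = (\<integral>\<^sup>+x. f x * indicator {w \<in> space M. Z w = x} w \<partial>count_space UNIV)" ..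
  qed
  also have "\<dots> = (\<integral>\<^sup>+x. \<integral>\<^sup>+w. f x * indicator {w \<in> space M. Z w = x} w \<partial>M \<partial>count_space UNIV)"
    using ev by (intro nn_integral_count_space_nn_integral) auto
  also have "\<dots> = (\<integral>\<^sup>+x. f x * emeasure M {w \<in> space M. Z w = x} \<partial>count_space UNIV)"
    using ev by (intro nn_integral_cong nn_integral_cmult_indicator)
  finally show ?thesis .
qed

section \<open>The mean queue length\<close>

text \<open>The Erlang density of order \<open>a\<close> and rate \<open>w\<close> without its
  factor \<open>w ^ a\<close>, so that the transform is \<open>1 / (\<theta> + w) ^ a\<close>. Rate
  0 stays meaningful and gives the constant 1 for order 1.\<close>

definition erlang_term :: "real \<Rightarrow> nat \<Rightarrow> real \<Rightarrow> real" where
  "erlang_term w a s = exp (- w * s) * (s powr (real a - 1) / Gamma (real a))"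

lemma erlang_term_measurable [measurable]: "erlang_term w a \<in> borel_measurable borel"
  unfolding erlang_term_def by measurable

lemma nn_laplace_erlang_term:
  assumes "a \<ge> 1" "\<theta> + w > 0"
  shows "nn_laplace (\<lambda>s. ennreal (erlang_term w a s)) \<theta> = ennreal (1 / (\<theta> + w) ^ a)"
proof -
  have a: "real a > 0" using assms by simp
  let ?g = "\<lambda>s. s powr (real a - 1) / Gamma (real a)"
  have "exp_bounded (real a) 0 (1 / Gamma (real a)) ?g"
    using Gamma_real_pos[OF a] by (auto simp: exp_bounded_def intro!: continuous_intros)
  then have L: "laplace_integrable ?g (\<theta> + w)" using a assms(2) by (rule exp_bounded_laplace(1))
  have "nn_laplace (\<lambda>s. ennreal (erlang_term w a s)) \<theta> = nn_laplace (\<lambda>s. ennreal (?g s)) (\<theta> + w)"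
    unfolding nn_laplace_def
  proof (rule nn_integral_cong)
    fix s :: real
    have "ennreal (exp (- \<theta> * s)) * ennreal (erlang_term w a s) = ennreal (exp (- \<theta> * s) * erlang_term w a s)"
      by (simp add: ennreal_mult')
    also have "exp (- \<theta> * s) * erlang_term w a s = exp (- (\<theta> + w) * s) * ?g s"
    proof -
      have "exp (- (\<theta> + w) * s) = exp (- \<theta> * s) * exp (- w * s)" by (simp add: exp_add[symmetric] algebra_simps)
      then show ?thesis by (simp add: erlang_term_def)
    qed
    also have "ennreal (exp (- (\<theta> + w) * s) * ?g s) = ennreal (exp (- (\<theta> + w) * s)) * ennreal (?g s)"
      by (rule ennreal_mult') simp
    finally show "ennreal (exp (- \<theta> * s)) * ennreal (erlang_term w a s) * indicator {0<..} s =
        ennreal (exp (- (\<theta> + w) * s)) * ennreal (?g s) * indicator {0<..} s" by (simp only:)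
  qed
  also have "\<dots> = ennreal (laplace ?g (\<theta> + w))"
    using L Gamma_real_pos[OF a] by (intro nn_laplace_eq_laplace) auto
  also have "laplace ?g (\<theta> + w) = 1 / (\<theta> + w) ^ a"
    using laplace_monomial[OF a assms(2)] assms by (simp add: powr_minus powr_realpow divide_inverse)
  finally show ?thesis .
qed

lemma A0_nonneg: "0 < lam \<Longrightarrow> 0 < mu \<Longrightarrow> 0 \<le> A0 lam mu k m r"
  by (simp add: A0_def)

text \<open>The \<open>r\<close> steps up and \<open>Suc m + r * k\<close> steps down total
  \<open>a0 k (Suc m) r\<close>, the power of \<open>\<sigma>\<close>. One factor
  \<open>k * mu\<close> is split off because \<open>A0\<close> carries one power less.\<close>

lemma ballot_weight_eq_A0:
  assumes "\<sigma> > 0" "lam > 0" "mu > 0"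
  shows "ballot_weight k (lam / \<sigma>) (real k * mu / \<sigma>) (Suc m) r =
    real k * mu * (A0 lam mu k (Suc m) r / \<sigma> ^ a0 k (Suc m) r)"
proof -
  have p: "(real k * mu) ^ (Suc m + r * k) = real k * mu * (real k * mu) ^ (Suc m + r * k - 1)" by simp
  have e: "\<sigma> ^ r * \<sigma> ^ (Suc m + r * k) = \<sigma> ^ a0 k (Suc m) r"
    unfolding power_add[symmetric] by (simp add: a0_def algebra_simps)
  have "(lam / \<sigma>) ^ r * (real k * mu / \<sigma>) ^ (Suc m + r * k) = lam ^ r * (real k * mu) ^ (Suc m + r * k) / \<sigma> ^ a0 k (Suc m) r"
    unfolding power_divide e[symmetric] by simp
  then have "ballot_weight k (lam / \<sigma>) (real k * mu / \<sigma>) (Suc m) r =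
     real (Suc m) * fact (Suc m + r * (k + 1) - 1) / (fact r * fact (Suc m + r * k)) *
       (lam ^ r * (real k * mu) ^ (Suc m + r * k) / \<sigma> ^ a0 k (Suc m) r)"
    unfolding ballot_weight_def by (simp only: mult.assoc nat.distinct if_False)
  then show ?thesis unfolding A0_def p
    by (simp only: times_divide_eq_left times_divide_eq_right mult_ac divide_divide_eq_left)
qed

section \<open>Series for the probability of being empty\<close>

context erlang_chain
begin

abbreviation coef :: "nat \<Rightarrow> nat \<Rightarrow> ennreal" where
  "coef m r \<equiv> ennreal (A0 lam mu k (Suc m) r)"

abbreviation erl :: "nat \<Rightarrow> nat \<Rightarrow> real \<Rightarrow> ennreal" where
  "erl m r s \<equiv> ennreal (erlang_term (lam + real k * mu) (a0 k (Suc m) r) s)"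

text \<open>Since \<open>1 / (1 / u - 1) = u / (1 - u)\<close>, the value \<open>1 / sink u\<close>
  is the sum of \<open>u ^ Suc m / (k * mu)\<close> over \<open>m\<close>; each power then opens
  into its ballot series in \<open>r\<close>.\<close>

lemma nn_laplace_empty_prob_series:
  assumes \<theta>: "\<theta> > 0"
  shows "nn_laplace (\<lambda>t. ennreal (empty_prob t)) \<theta> =
    (\<Sum>m. \<Sum>r. coef m r * ennreal (1 / (\<theta> + (lam + real k * mu)) ^ a0 k (Suc m) r))"
    and "nn_laplace (\<lambda>t. ennreal (empty_prob t)) \<theta> < \<infinity>"
proof -
  \<comment> \<open>Jump rate of a nonempty queue plus killing at rate \<open>\<theta>\<close>: with
    \<open>x\<close> and \<open>y\<close> the chances of the next step,
    \<open>x + y = 1 - \<theta> / \<sigma> < 1\<close>.\<close>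
  define \<sigma> where "\<sigma> = \<theta> + (lam + real k * mu)"
  define x where "x = lam / \<sigma>"
  define y where "y = real k * mu / \<sigma>"
  have km: "real k * mu > 0" using k mu by simp
  have \<sigma>: "\<sigma> > 0" using \<theta> lam km by (simp add: \<sigma>_def)
  have xy: "0 < x" "0 < y" "x + y < 1"
    using \<sigma> lam km \<theta> by (auto simp: x_def y_def add_divide_distrib[symmetric] \<sigma>_def)
  obtain u where u: "0 < u" "u < 1" "u = y + x * u ^ Suc k" using ballot_root[OF xy] by blast
  have "\<sigma> * u = \<sigma> * (y + x * u ^ Suc k)" using u(3) by simp
  also have "\<dots> = real k * mu + lam * u ^ Suc k" using \<sigma> by (simp add: x_def y_def field_simps)
  finally have "symbol u = \<theta>"
    using u(1) by (simp add: symbol_def \<sigma>_def field_simps)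
  then have L: "nn_laplace (\<lambda>t. ennreal (empty_prob t)) \<theta> = ennreal (1 / sink u)"
    using nn_laplace_empty_prob[OF u(1,2)] \<theta> by simp
  have "(\<lambda>m. u ^ Suc m / (real k * mu)) sums (1 / sink u)"
  proof -
    have "(\<lambda>m. u / (real k * mu) * u ^ m) sums (u / (real k * mu) * (1 / (1 - u)))"
      using u by (intro sums_mult geometric_sums) simp
    moreover have "u / (real k * mu) * (1 / (1 - u)) = 1 / (sink u)"
      using u km by (simp add: field_simps)
    ultimately show ?thesis by simp
  qed
  then have "ennreal (1 / sink u) = (\<Sum>m. ennreal (u ^ Suc m / (real k * mu)))"
    using u km by (intro suminf_ennreal_eq[symmetric]) auto
  also have "\<dots> = (\<Sum>m. \<Sum>r. coef m r * ennreal (1 / \<sigma> ^ a0 k (Suc m) r))"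
  proof (rule suminf_cong)
    fix m
    have "(\<lambda>r. ballot_weight k x y (Suc m) r / (real k * mu)) sums (u ^ Suc m / (real k * mu))"
      by (intro sums_divide ballot_weight_sums[OF xy u])
    moreover have "ballot_weight k x y (Suc m) r / (real k * mu) = A0 lam mu k (Suc m) r * (1 / \<sigma> ^ a0 k (Suc m) r)" for r
      unfolding x_def y_def ballot_weight_eq_A0[OF \<sigma> lam mu]
        nonzero_mult_div_cancel_left[OF less_imp_neq[OF km, symmetric]] by simp
    ultimately have "(\<lambda>r. A0 lam mu k (Suc m) r * (1 / \<sigma> ^ a0 k (Suc m) r)) sums (u ^ Suc m / (real k * mu))" by simp
    then have "(\<Sum>r. ennreal (A0 lam mu k (Suc m) r * (1 / \<sigma> ^ a0 k (Suc m) r))) = ennreal (u ^ Suc m / (real k * mu))"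
      using A0_nonneg[OF lam mu] \<sigma> by (intro suminf_ennreal_eq) auto
    moreover have "ennreal (A0 lam mu k (Suc m) r * (1 / \<sigma> ^ a0 k (Suc m) r)) =
        coef m r * ennreal (1 / \<sigma> ^ a0 k (Suc m) r)" for r
      using \<sigma> A0_nonneg[OF lam mu] by (intro ennreal_mult) auto
    ultimately show "ennreal (u ^ Suc m / (real k * mu)) = (\<Sum>r. coef m r * ennreal (1 / \<sigma> ^ a0 k (Suc m) r))"
      by (simp only:)
  qed
  finally show "nn_laplace (\<lambda>t. ennreal (empty_prob t)) \<theta> =
    (\<Sum>m. \<Sum>r. coef m r * ennreal (1 / (\<theta> + (lam + real k * mu)) ^ a0 k (Suc m) r))"
    unfolding L \<sigma>_def .
  show "nn_laplace (\<lambda>t. ennreal (empty_prob t)) \<theta> < \<infinity>" unfolding L by simp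
qed

text \<open>Equality for almost every time suffices, because the series is only used inside
  \<open>occupation\<close>, an integral over time.\<close>

lemma empty_prob_series:
  "AE s in lborel. s > 0 \<longrightarrow> ennreal (empty_prob s) =
    (\<Sum>m. \<Sum>r. coef m r * erl m r s)"
proof (rule nn_laplace_unique[where z = 0])
  let ?f = "\<lambda>m r s. coef m r * erl m r s"
  have [measurable]: "empty_prob \<in> borel_measurable borel"
    by (rule borel_measurable_continuous_onI[OF continuous_empty_prob])
  show "(\<lambda>s. ennreal (empty_prob s)) \<in> borel_measurable borel" by measurable
  show "(\<lambda>s. \<Sum>m. \<Sum>r. ?f m r s) \<in> borel_measurable borel" by measurable
  fix \<theta> :: real assume \<theta>: "0 < \<theta>"
  show "nn_laplace (\<lambda>s. ennreal (empty_prob s)) \<theta> < \<infinity>" by (rule nn_laplace_empty_prob_series(2)[OF \<theta>])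
  have pos: "\<theta> + (lam + real k * mu) > 0" using \<theta> lam mu by (simp add: add_pos_nonneg)
  have "nn_laplace (\<lambda>s. \<Sum>m. \<Sum>r. ?f m r s) \<theta> =
      (\<integral>\<^sup>+s. (\<Sum>m. \<Sum>r. coef m r *
        (ennreal (exp (- \<theta> * s)) * erl m r s * indicator {0<..} s)) \<partial>lborel)"
    unfolding nn_laplace_def
  proof (rule nn_integral_cong)
    fix s :: real
    have "ennreal (exp (- \<theta> * s)) * (\<Sum>m. \<Sum>r. ?f m r s) * indicator {0<..} s =
        (ennreal (exp (- \<theta> * s)) * indicator {0<..} s) * (\<Sum>m. \<Sum>r. ?f m r s)" by (simp only: mult_ac)
    also have "\<dots> = (\<Sum>m. \<Sum>r. (ennreal (exp (- \<theta> * s)) * indicator {0<..} s) * ?f m r s)"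
      by (simp only: ennreal_suminf_cmult)
    finally show "ennreal (exp (- \<theta> * s)) * (\<Sum>m. \<Sum>r. ?f m r s) * indicator {0<..} s =
        (\<Sum>m. \<Sum>r. coef m r *
        (ennreal (exp (- \<theta> * s)) * erl m r s * indicator {0<..} s))"
      by (simp only: mult_ac)
  qed
  also have "\<dots> = (\<Sum>m. \<Sum>r. coef m r *
      nn_laplace (\<lambda>s. erl m r s) \<theta>)"
    unfolding nn_laplace_def
    by (subst nn_integral_suminf, measurable, subst nn_integral_suminf, measurable, subst nn_integral_cmult, measurable)
  also have "\<dots> = nn_laplace (\<lambda>s. ennreal (empty_prob s)) \<theta>"
    unfolding nn_laplace_empty_prob_series(1)[OF \<theta>]
    by (subst nn_laplace_erlang_term[OF _ pos]) (simp_all add: a0_def)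
  finally show "nn_laplace (\<lambda>s. ennreal (empty_prob s)) \<theta> = nn_laplace (\<lambda>s. \<Sum>m. \<Sum>r. ?f m r s) \<theta>" ..
qed

end

context subordinator
begin

lemma occupation_integrand_measurable [measurable]:
  "passage t \<in> borel_measurable borel"
proof -
  have "(\<lambda>s. \<integral>\<^sup>+w. (if D (max 0 s) w \<le> t then 1 else 0) \<partial>M) \<in> borel_measurable borel" by measurable
  then show ?thesis by (simp add: indicator_def of_bool_def)
qed

lemma occupation_cmult:
  assumes [measurable]: "f \<in> borel_measurable borel"
  shows "occupation (\<lambda>s. c * f s) t = c * occupation f t"
  unfolding occupation_def by (subst nn_integral_cmult[symmetric]) (simp_all add: mult.assoc)

lemma occupation_suminf:
  assumes [measurable]: "\<And>i. f i \<in> borel_measurable borel"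
  shows "occupation (\<lambda>s. \<Sum>i. f i s) t = (\<Sum>i. occupation (f i) t)"
  unfolding occupation_def by (subst nn_integral_suminf[symmetric]) (simp_all add: mult.commute mult.left_commute)

end

text \<open>Returns from \<open>ennreal\<close> to real series: for nonnegative terms a finite total
  forces each row, and then the row sums, to be summable.\<close>

lemma double_suminf_ennreal:
  fixes x :: "nat \<Rightarrow> nat \<Rightarrow> real"
  assumes nn: "\<And>m r. 0 \<le> x m r" and eq: "(\<Sum>m. \<Sum>r. ennreal (x m r)) = ennreal V" and V: "0 \<le> V"
  shows "summable (x m)" "summable (\<lambda>m. \<Sum>r. x m r)" "(\<Sum>m. \<Sum>r. x m r) = V"
proof -
  have "(\<Sum>r. ennreal (x m r)) < top" for m
    by (rule ennreal_suminf_lessD[where f = "\<lambda>m. \<Sum>r. ennreal (x m r)"]) (simp add: eq)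
  then show s: "summable (x m)" for m
    using nn by (intro summable_suminf_not_top) (auto simp: less_top)
  have n2: "0 \<le> (\<Sum>r. x m r)" for m using nn s by (intro suminf_nonneg)
  have eq2: "(\<Sum>m. ennreal (\<Sum>r. x m r)) = ennreal V"
    unfolding eq[symmetric] using nn s by (intro suminf_cong) (simp add: suminf_ennreal2)
  then show s2: "summable (\<lambda>m. \<Sum>r. x m r)"
    using n2 by (intro summable_suminf_not_top) auto
  have "ennreal (\<Sum>m. \<Sum>r. x m r) = ennreal V"
    using suminf_ennreal2[OF n2 s2] eq2 by simp
  then show "(\<Sum>m. \<Sum>r. x m r) = V"
    using V n2 s2 by (simp add: suminf_nonneg)
qed

text \<open>Integrability and summability belong to the conclusion because \<open>LINT\<close> and
  \<open>suminf\<close> also have values without them; the equation alone would not show that both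
  sides are genuine.\<close>

theorem theorem3p5:
  fixes M :: "'a measure"
    and Q :: "real \<Rightarrow> 'a \<Rightarrow> nat \<times> nat"
    and D :: "real \<Rightarrow> 'a \<Rightarrow> real"
    and lam mu \<alpha>\<^sub>1 \<alpha>\<^sub>2 c\<^sub>1 c\<^sub>2 t :: real
    and k :: nat
  defines "Y \<equiv> inverse_subordinator D"
  defines "L \<equiv> queue_length k (time_change Q Y)"
  defines "summand \<equiv> (\<lambda>m r. A0 lam mu k m r / c\<^sub>1 ^ a0 k m r *
             conv_power (h_fun lam mu k \<alpha>\<^sub>1 \<alpha>\<^sub>2 c\<^sub>1 c\<^sub>2 (a0 k m r)) (a0 k m r) t)"
  assumes "prob_space M"
    and "lam > 0" and "mu > 0" and "k \<ge> 1"
    and "0 < \<alpha>\<^sub>2" and "\<alpha>\<^sub>2 < \<alpha>\<^sub>1" and "\<alpha>\<^sub>1 < 1"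
    and "c\<^sub>1 > 0" and "c\<^sub>2 \<ge> 0" and "c\<^sub>1 + c\<^sub>2 = 1"
    and "erlang_queue M lam mu k Q"
    and "mixed_stable_subordinator M \<alpha>\<^sub>1 \<alpha>\<^sub>2 c\<^sub>1 c\<^sub>2 D"
    and "indep_processes M Q Y"
    and "t > 0"
  shows "integrable (given_empty M L) (\<lambda>\<omega>. real (L t \<omega>)) \<and>
    (\<forall>m\<ge>1. summable (summand m)) \<and>
    summable (\<lambda>m. \<Sum>r. summand (Suc m) r) \<and>
    mean_queue_length M L t =
      real k * (lam - mu) / c\<^sub>1 * t powr \<alpha>\<^sub>1 *
        mittag_leffler3 1 (\<alpha>\<^sub>1 - \<alpha>\<^sub>2) (\<alpha>\<^sub>1 + 1) (- (c\<^sub>2 / c\<^sub>1) * t powr (\<alpha>\<^sub>1 - \<alpha>\<^sub>2)) +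
      real k * mu * (\<Sum>m. \<Sum>r. summand (Suc m) r)"
proof -
  interpret prob_space M by fact
  define \<phi> where "\<phi> z = c\<^sub>1 * z powr \<alpha>\<^sub>1 + c\<^sub>2 * z powr \<alpha>\<^sub>2" for z
  have \<phi>_pos: "0 < \<phi> z" if "0 < z" for z
    using that \<open>c\<^sub>1 > 0\<close> \<open>c\<^sub>2 \<ge> 0\<close> by (simp add: \<phi>_def add_pos_nonneg)
  interpret subordinator M D \<phi>
    using \<open>mixed_stable_subordinator M \<alpha>\<^sub>1 \<alpha>\<^sub>2 c\<^sub>1 c\<^sub>2 D\<close>
    by unfold_locales (auto simp: mixed_stable_subordinator_def levy_process_def \<phi>_def[symmetric] \<phi>_pos mono_on_def)
  have Q_ctmc: "ctmc M (erlang_states k) (erlang_rate lam mu k) (0, 0) Q"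
    using \<open>erlang_queue M lam mu k Q\<close> by (simp add: erlang_queue_def)
  obtain P where P: "transition_function_with_rates (erlang_states k) (erlang_rate lam mu k) P"
    and Q_P: "\<And>s x. 0 \<le> s \<Longrightarrow> x \<in> erlang_states k \<Longrightarrow> prob {w \<in> space M. Q s w = x} = P s (0, 0) x"
    using ctmc_marginal[OF Q_ctmc] by (auto simp: erlang_states_def)
  interpret erlang_chain lam mu k P
    by unfold_locales fact+
  let ?w = "lam + real k * mu"
  have Y_nonneg: "0 \<le> Y s w" for s w unfolding Y_def by (rule inverse_nonneg)

  \<comment> \<open>This will be the mean of the inverse subordinator, with transform
    \<open>1 / (s * \<phi> s)\<close>. It is written to match \<open>mittag_leffler3_laplace\<close>
    at \<open>j = 0\<close>.\<close>
  define R where "R s = 1 / c\<^sub>1 * (s powr ((\<alpha>\<^sub>1 + 1) - 1) *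
      mittag_leffler3 (real 0 + 1) (\<alpha>\<^sub>1 - \<alpha>\<^sub>2) (\<alpha>\<^sub>1 + 1) (- (c\<^sub>2 / c\<^sub>1) * s powr (\<alpha>\<^sub>1 - \<alpha>\<^sub>2)))" for s
  have occ_1: "occupation (\<lambda>_. 1) t = ennreal (R t) \<and> 0 \<le> R t"
  proof -
    have "((\<lambda>w. \<bar>c\<^sub>2 / c\<^sub>1\<bar> * w powr (- (\<alpha>\<^sub>1 - \<alpha>\<^sub>2))) \<longlongrightarrow> 0) at_top"
      using \<open>\<alpha>\<^sub>2 < \<alpha>\<^sub>1\<close> by real_asymp
    then have "\<forall>\<^sub>F w in at_top. \<bar>c\<^sub>2 / c\<^sub>1\<bar> * w powr (- (\<alpha>\<^sub>1 - \<alpha>\<^sub>2)) < 1"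
      by (rule order_tendstoD) simp
    then have "\<forall>\<^sub>F w in at_top. w > 0 \<and> \<bar>c\<^sub>2 / c\<^sub>1\<bar> * w powr (- (\<alpha>\<^sub>1 - \<alpha>\<^sub>2)) < 1"
      using eventually_gt_at_top[of 0] by eventually_elim auto
    then obtain w where w: "w > 0" "\<bar>c\<^sub>2 / c\<^sub>1\<bar> * w powr (- (\<alpha>\<^sub>1 - \<alpha>\<^sub>2)) < 1"
      using eventually_happens[of _ "at_top :: real filter"] by (auto simp: trivial_limit_at_top_linorder)
    have "\<alpha>\<^sub>1 - \<alpha>\<^sub>2 > 0" "\<alpha>\<^sub>1 + 1 > 0" using \<open>0 < \<alpha>\<^sub>2\<close> \<open>\<alpha>\<^sub>2 < \<alpha>\<^sub>1\<close> by auto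
    note lap = mittag_leffler3_laplace[OF this(1,2) order_refl w, where j = 0]
    have z: "exp 1 * w > 0" using w by simp
    have RL: "laplace R s = 1 / (s * \<phi> s)" if "s > exp 1 * w" for s
    proof -
      have s: "s > 0" using that z by linarith
      have "s powr (- (\<alpha>\<^sub>1 + 1)) = 1 / (s * s powr \<alpha>\<^sub>1)"
        using s by (subst powr_minus_divide) (simp add: powr_add)
      moreover have "s powr \<alpha>\<^sub>1 * s powr (- (\<alpha>\<^sub>1 - \<alpha>\<^sub>2)) = s powr \<alpha>\<^sub>2" by (simp flip: powr_add)
      then have "c\<^sub>1 * s powr \<alpha>\<^sub>1 * (1 + c\<^sub>2 / c\<^sub>1 * s powr (- (\<alpha>\<^sub>1 - \<alpha>\<^sub>2))) = \<phi> s"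
        using \<open>c\<^sub>1 > 0\<close> by (simp add: \<phi>_def ring_distribs)
      ultimately show ?thesis
        unfolding R_def laplace_cmult lap(2)[OF that] by (simp add: mult_ac)
    qed
    have bd: "exp_bounded (\<alpha>\<^sub>1 + 1) (exp 1 * w) (\<bar>1 / c\<^sub>1\<bar> *
        (exp (exp 1 * w) * w powr (- (\<alpha>\<^sub>1 + 1)) * (1 / (1 - \<bar>c\<^sub>2 / c\<^sub>1\<bar> * w powr (- (\<alpha>\<^sub>1 - \<alpha>\<^sub>2))) ^ Suc 0))) R"
      unfolding R_def by (rule exp_bounded_cmult[OF lap(1)])
    have eq: "ennreal (1 / s) * nn_laplace (\<lambda>_. 1) (\<phi> s) = ennreal (laplace R s)"
      and nn: "0 \<le> laplace R s" if s: "s > exp 1 * w" for s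
    proof -
      have s0: "s > 0" using s z by linarith
      have "nn_laplace (\<lambda>_. 1) (\<phi> s) = nn_laplace (\<lambda>s. ennreal (erlang_term 0 1 s)) (\<phi> s)"
        unfolding nn_laplace_def by (intro nn_integral_cong) (auto simp: indicator_def erlang_term_def)
      also have "\<dots> = ennreal (1 / \<phi> s)" using nn_laplace_erlang_term[of 1 "\<phi> s" 0] \<phi>_pos[OF s0] by simp
      finally show "ennreal (1 / s) * nn_laplace (\<lambda>_. 1) (\<phi> s) = ennreal (laplace R s)"
        using s0 \<phi>_pos[OF s0] by (simp add: RL[OF s] flip: ennreal_mult)
      show "0 \<le> laplace R s" using s0 \<phi>_pos[OF s0] by (simp add: RL[OF s])
    qed
    show ?thesis
      using occupation_inversion[OF _ _ bd \<open>\<alpha>\<^sub>1 + 1 > 0\<close> z eq nn \<open>t > 0\<close>] by simp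
  qed
  let ?H = "\<lambda>N t. conv_power (h_fun lam mu k \<alpha>\<^sub>1 \<alpha>\<^sub>2 c\<^sub>1 c\<^sub>2 N) N t / c\<^sub>1 ^ N"
  \<comment> \<open>With \<open>N\<close> fixed, both sides have transform
    \<open>1 / (s * (\<phi> s + lam + k * mu) ^ N)\<close>: one through
    \<open>nn_laplace_erlang_term\<close>, the other through the convolution power.\<close>
  have occ_term: "occupation (\<lambda>s. ennreal (erlang_term ?w N s)) t =
      ennreal (?H N t) \<and>
      0 \<le> ?H N t" if N: "N \<ge> 1" for N
  proof -
    let ?R = "?H N"
    obtain z C where z: "z > 0" and bd: "exp_bounded 1 z C ?R"
      and RL: "\<And>s. s > z \<Longrightarrow> laplace ?R s = 1 / (s * (c\<^sub>1 * s powr \<alpha>\<^sub>1 + c\<^sub>2 * s powr \<alpha>\<^sub>2 + ?w) ^ N)"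
      using conv_power_h_fun_laplace[OF \<open>lam > 0\<close> \<open>mu > 0\<close> \<open>0 < \<alpha>\<^sub>2\<close> \<open>\<alpha>\<^sub>2 < \<alpha>\<^sub>1\<close> \<open>c\<^sub>1 > 0\<close> \<open>c\<^sub>2 \<ge> 0\<close> N] by metis
    have pos: "\<phi> s + ?w > 0" if "s > 0" for s
      using \<phi>_pos[OF that] \<open>lam > 0\<close> \<open>mu > 0\<close> by (simp add: add_pos_nonneg)
    have eq: "ennreal (1 / s) * nn_laplace (\<lambda>s. ennreal (erlang_term ?w N s)) (\<phi> s) = ennreal (laplace ?R s)"
      and nn: "0 \<le> laplace ?R s" if s: "s > z" for s
    proof -
      have s0: "s > 0" using s z by simp
      show "0 \<le> laplace ?R s" unfolding RL[OF s] using s0 pos[OF s0] by (simp add: \<phi>_def)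
      show "ennreal (1 / s) * nn_laplace (\<lambda>s. ennreal (erlang_term ?w N s)) (\<phi> s) = ennreal (laplace ?R s)"
        unfolding RL[OF s] nn_laplace_erlang_term[OF N pos[OF s0]] using s0 pos[OF s0]
        by (simp add: \<phi>_def flip: ennreal_mult)
    qed
    show ?thesis
      using occupation_inversion[OF _ _ bd zero_less_one z eq nn \<open>t > 0\<close>] by simp
  qed

  define Z where "Z w = Q (Y t w) w" for w
  have Q_meas: "Q s \<in> M \<rightarrow>\<^sub>M count_space UNIV" if "0 \<le> s" for s
    using Q_ctmc that by (simp add: ctmc_def)
  have Q_right: "\<forall>\<^sub>F r in at_right s. Q r w = Q s w" if "0 \<le> s" "w \<in> space M" for s w
    using Q_ctmc that by (simp add: ctmc_def)
  have Q_states: "Q s w \<in> erlang_states k" if "0 \<le> s" "w \<in> space M" for s w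
    using Q_ctmc that by (simp add: ctmc_def)
  \<comment> \<open>Outside the state space both sides are 0; stating the law for all pairs lets the
    later sums run over the whole type.\<close>
  have Q_law: "prob {w \<in> space M. Q s w = x} = pmf (kernel s (0, 0)) x" if s: "0 \<le> s" for s x
  proof (cases "x \<in> erlang_states k")
    case False
    then have empty: "{w \<in> space M. Q s w = x} = {}" using Q_states[OF s] by auto
    show ?thesis unfolding empty using False s by (simp add: pmf_kernel zero_state)
  qed (use s Q_P in \<open>simp add: pmf_kernel zero_state\<close>)
  have pmf_cont: "continuous_on {0..} (\<lambda>s. pmf (kernel s (0, 0)) x)" for x
  proof (cases "x \<in> erlang_states k")
    case True
    show ?thesis
      by (rule continuous_on_cong[THEN iffD1, OF refl _ continuous_P[OF zero_state True]])
        (simp add: pmf_kernel zero_state True)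
  next
    case False
    show ?thesis
      by (rule continuous_on_cong[THEN iffD1, OF refl _ continuous_on_const[of _ 0]])
        (simp add: pmf_kernel zero_state False)
  qed
  have [measurable]: "Y t \<in> borel_measurable M"
    using indep_processes_measurable[OF \<open>indep_processes M Q Y\<close>] \<open>t > 0\<close> by simp
  have pmf_Y [measurable]: "(\<lambda>w. pmf (kernel (Y t w) (0, 0)) x) \<in> borel_measurable M" for x
  proof -
    have "continuous_on UNIV (\<lambda>s. pmf (kernel (max 0 s) (0, 0)) x)"
      by (rule continuous_on_compose2[OF pmf_cont]) (auto intro!: continuous_intros)
    then have "(\<lambda>s. pmf (kernel (max 0 s) (0, 0)) x) \<in> borel_measurable borel"
      by (rule borel_measurable_continuous_onI)
    from measurable_compose[OF \<open>Y t \<in> borel_measurable M\<close> this] show ?thesis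
      using Y_nonneg by (simp add: max_def)
  qed
  note tc = independent_time_change[OF Q_meas Q_right \<open>indep_processes M Q Y\<close> less_imp_le[OF \<open>t > 0\<close>] Y_nonneg Q_law pmf_cont]
  have Z_ev: "{w \<in> space M. Z w = x} \<in> events" for x using tc(1) by (simp add: Z_def)
  have Z_law: "emeasure M {w \<in> space M. Z w = x} = (\<integral>\<^sup>+w. ennreal (pmf (kernel (Y t w) (0, 0)) x) \<partial>M)" for x
    using tc(2) by (simp add: Z_def)
  have Z_meas: "Z \<in> M \<rightarrow>\<^sub>M count_space UNIV"
    using Z_ev by (subst measurable_count_space_eq2_countable) (auto simp: vimage_def Int_def conj_commute)

  define I where "I s = integral {0..s} empty_prob" for s
  have "(\<integral>\<^sup>+w. ennreal (real (phase_count k (Z w))) \<partial>M) =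
      (\<integral>\<^sup>+x. ennreal (real (phase_count k x)) * (\<integral>\<^sup>+w. ennreal (pmf (kernel (Y t w) (0, 0)) x) \<partial>M) \<partial>count_space UNIV)"
    unfolding Z_law[symmetric] by (rule nn_integral_countable_partition[OF Z_ev])
  also have "\<dots> = (\<integral>\<^sup>+x. \<integral>\<^sup>+w. ennreal (pmf (kernel (Y t w) (0, 0)) x) * ennreal (real (phase_count k x)) \<partial>M \<partial>count_space UNIV)"
    by (intro nn_integral_cong, subst mult.commute, rule nn_integral_multc[symmetric]) measurable
  also have "\<dots> = (\<integral>\<^sup>+w. \<integral>\<^sup>+x. ennreal (pmf (kernel (Y t w) (0, 0)) x) * ennreal (real (phase_count k x)) \<partial>count_space UNIV \<partial>M)"
    by (rule nn_integral_count_space_nn_integral[symmetric]) auto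
  also have "\<dots> = (\<integral>\<^sup>+w. ennreal (real k * (lam - mu) * Y t w + real k * mu * I (Y t w)) \<partial>M)"
    unfolding nn_integral_measure_pmf[symmetric] mean_phase_count(1)[OF Y_nonneg] I_def ..
  finally have Z_mean: "(\<integral>\<^sup>+w. ennreal (real (phase_count k (Z w))) \<partial>M) =
      (\<integral>\<^sup>+w. ennreal (real k * (lam - mu) * Y t w + real k * mu * I (Y t w)) \<partial>M)" .

  have "(\<integral>\<^sup>+w. ennreal (Y t w) \<partial>M) = occupation (\<lambda>_. 1) t"
    using \<open>t > 0\<close> Y_nonneg[unfolded Y_def] by (simp add: occupation_eq Y_def)
  \<comment> \<open>For \<open>f = 1\<close> the inner integral in \<open>occupation_eq\<close> is
    the length of \<open>{0<..<Y t w}\<close>, so the occupation is the mean of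
    \<open>Y t\<close>.\<close>
  then have Y_int: "integrable M (Y t)" "(LINT w|M. Y t w) = R t"
    using occ_1 Y_nonneg by (simp_all add: nn_integral_eq_integrable)

  have p0_meas [measurable]: "empty_prob \<in> borel_measurable borel"
    by (rule borel_measurable_continuous_onI[OF continuous_empty_prob])
  have I_nn: "(\<integral>\<^sup>+s\<in>{0<..<y}. ennreal (empty_prob s) \<partial>lborel) = ennreal (I y)" "0 \<le> I y" for y
  proof -
    have "(empty_prob has_integral I y) {0..y}" unfolding I_def
      by (intro integrable_integral integrable_continuous_real continuous_empty_prob)
    then have "(\<integral>\<^sup>+s. ennreal (empty_prob s) * indicator {0..y} s \<partial>lborel) = ennreal (I y)"
      by (intro nn_integral_has_integral_lebesgue' empty_prob_bounds)
    moreover have "(\<integral>\<^sup>+s\<in>{0<..<y}. ennreal (empty_prob s) \<partial>lborel) =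
        (\<integral>\<^sup>+s. ennreal (empty_prob s) * indicator {0..y} s \<partial>lborel)"
    proof (rule nn_integral_cong_AE)
      show "AE s in lborel. ennreal (empty_prob s) * indicator {0<..<y} s = ennreal (empty_prob s) * indicator {0..y} s"
        using AE_lborel_singleton[of 0] AE_lborel_singleton[of y]
        by eventually_elim (auto simp: indicator_def)
    qed
    ultimately show "(\<integral>\<^sup>+s\<in>{0<..<y}. ennreal (empty_prob s) \<partial>lborel) = ennreal (I y)" by simp
    show "0 \<le> I y" unfolding I_def
      by (intro Henstock_Kurzweil_Integration.integral_nonneg integrable_continuous_real continuous_empty_prob)
        (rule empty_prob_bounds)
  qed
  have occ_p0: "occupation (\<lambda>s. ennreal (empty_prob s)) t = (\<integral>\<^sup>+w. ennreal (I (Y t w)) \<partial>M)"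
    using \<open>t > 0\<close> by (simp add: occupation_eq I_nn flip: Y_def)
  have I_meas: "(\<lambda>w. I (Y t w)) \<in> borel_measurable M"
  proof -
    have "(\<lambda>w. \<integral>\<^sup>+s. ennreal (empty_prob s) * (if 0 < s \<and> s < Y t w then 1 else 0) \<partial>lborel) \<in> borel_measurable M"
      by measurable
    also have "(\<lambda>w. \<integral>\<^sup>+s. ennreal (empty_prob s) * (if 0 < s \<and> s < Y t w then 1 else 0) \<partial>lborel) = (\<lambda>w. ennreal (I (Y t w)))"
      unfolding I_nn(1)[symmetric] by (intro ext nn_integral_cong) (auto simp: indicator_def)
    finally have "(\<lambda>w. enn2real (ennreal (I (Y t w)))) \<in> borel_measurable M" by measurable
    then show ?thesis using I_nn(2) by simp
  qed
  have I_le: "I y \<le> y" if "0 \<le> y" for y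
  proof -
    have "I y \<le> integral {0..y} (\<lambda>_. 1)" unfolding I_def
      by (intro integral_le integrable_continuous_real continuous_empty_prob continuous_on_const empty_prob_bounds)
    then show ?thesis using that by simp
  qed
  \<comment> \<open>Separate integrability of \<open>Y t\<close> and \<open>I (Y t)\<close> matters:
    \<open>lam - mu\<close> may be negative, so the mean has to be split in the reals and not in
    \<open>ennreal\<close>.\<close>
  have I_int: "integrable M (\<lambda>w. I (Y t w))"
    by (rule Bochner_Integration.integrable_bound[OF Y_int(1) I_meas])
      (use I_nn(2) I_le Y_nonneg in \<open>auto intro!: AE_I2\<close>)
  define V where "V = (LINT w|M. I (Y t w))"
  have V: "occupation (\<lambda>s. ennreal (empty_prob s)) t = ennreal V" "0 \<le> V"
    unfolding occ_p0 V_def using I_nn(2)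
    by (auto intro!: nn_integral_eq_integral I_int Bochner_Integration.integral_nonneg)

  have summand_eq: "summand (Suc m) r = A0 lam mu k (Suc m) r *
      (?H (a0 k (Suc m) r) t)" for m r
    by (simp add: summand_def)
  have occ_a0: "occupation (erl m r) t =
      ennreal (?H (a0 k (Suc m) r) t)"
    "0 \<le> ?H (a0 k (Suc m) r) t" for m r
    using occ_term[of "a0 k (Suc m) r"] by (simp_all add: a0_def)
  have summand_nonneg: "0 \<le> summand (Suc m) r" for m r
    unfolding summand_eq using occ_a0(2) A0_nonneg[OF \<open>lam > 0\<close> \<open>mu > 0\<close>] by (rule mult_nonneg_nonneg[rotated])
  \<comment> \<open>The exceptional times of the series form a null set and disappear under the
    integral.\<close>
  have "occupation (\<lambda>s. ennreal (empty_prob s)) t =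
      occupation (\<lambda>s. \<Sum>m. \<Sum>r. coef m r * erl m r s) t"
    unfolding occupation_def
    by (intro nn_integral_cong_AE eventually_mono[OF empty_prob_series]) (auto simp: indicator_def)
  also have "\<dots> = (\<Sum>m. \<Sum>r. coef m r * occupation (erl m r) t)"
    using occupation_suminf[of "\<lambda>m s. \<Sum>r. coef m r * erl m r s" t]
    by (simp add: occupation_suminf occupation_cmult)
  also have "\<dots> = (\<Sum>m. \<Sum>r. ennreal (summand (Suc m) r))"
    unfolding summand_eq occ_a0(1) using occ_a0(2) A0_nonneg[OF \<open>lam > 0\<close> \<open>mu > 0\<close>]
    by (simp only: ennreal_mult)
  finally have "(\<Sum>m. \<Sum>r. ennreal (summand (Suc m) r)) = ennreal V" using V(1) by simp
  note sums = double_suminf_ennreal[of "\<lambda>m. summand (Suc m)", OF summand_nonneg this V(2)]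

  have L_Z: "L t w = phase_count k (Z w)" for w
    by (simp add: L_def queue_length_def time_change_def Z_def)
  \<comment> \<open>The conditioning event has probability 1: the inverse is set to 0 at time 0, and
    the queue starts empty almost surely. Conditioning thus leaves the mean unchanged.\<close>
  define S where "S = {w \<in> space M. L 0 w = 0}"
  have L0: "L 0 w = phase_count k (Q 0 w)" for w
    by (simp add: L_def queue_length_def time_change_def Y_def inverse_subordinator_def)
  have S_ev [measurable]: "S \<in> events"
  proof -
    have "(\<lambda>w. phase_count k (Q 0 w)) \<in> M \<rightarrow>\<^sub>M count_space UNIV"
      by (rule measurable_compose[OF Q_meas]) simp_all
    from measurable_sets[OF this, of "{0}"] show ?thesis
      by (simp add: S_def L0 vimage_def Int_def conj_commute)
  qed
  have S_AE: "AE w in M. w \<in> S"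
  proof -
    have "AE w in M. Q 0 w = (0, 0)" using Q_ctmc by (simp add: ctmc_def)
    then show ?thesis using AE_space by eventually_elim (simp add: S_def L0 phase_count_def)
  qed
  then have S_1: "emeasure M S = 1" using S_ev emeasure_eq_1_AE by blast
  have L_meas [measurable]: "(\<lambda>w. real (L t w)) \<in> borel_measurable M"
    unfolding L_Z by (rule measurable_compose[OF Z_meas]) simp
  have m_int: "integrable M (\<lambda>w. real k * (lam - mu) * Y t w + real k * mu * I (Y t w))"
    by (intro Bochner_Integration.integrable_add integrable_mult_right Y_int I_int)
  define E where "E = real k * (lam - mu) * R t + real k * mu * V"
  have m_val: "(LINT w|M. real k * (lam - mu) * Y t w + real k * mu * I (Y t w)) = E"
    using Y_int I_int by (simp add: E_def V_def)
  have m_nonneg: "0 \<le> real k * (lam - mu) * Y t w + real k * mu * I (Y t w)" for w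
    unfolding I_def by (rule mean_phase_count(2)[OF Y_nonneg])
  have "0 \<le> E" unfolding m_val[symmetric] using m_nonneg by (intro Bochner_Integration.integral_nonneg)
  have "(\<integral>\<^sup>+w. ennreal (real (L t w)) \<partial>given_empty M L) = (\<integral>\<^sup>+w. ennreal (real (L t w)) * indicator S w \<partial>M) / 1"
    unfolding given_empty_def S_def[symmetric] using S_1 by (subst nn_integral_uniform_measure) simp_all
  also have "(\<integral>\<^sup>+w. ennreal (real (L t w)) * indicator S w \<partial>M) = (\<integral>\<^sup>+w. ennreal (real (L t w)) \<partial>M)"
    by (intro nn_integral_cong_AE eventually_mono[OF S_AE]) simp
  also have "\<dots> = ennreal E"
    unfolding L_Z Z_mean m_val[symmetric] using m_nonneg by (intro nn_integral_eq_integral m_int) simp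
  finally have "(\<integral>\<^sup>+w. ennreal (real (L t w)) \<partial>given_empty M L) = ennreal E"
    by (simp add: divide_ennreal_def)
  moreover have "(\<lambda>w. real (L t w)) \<in> borel_measurable (given_empty M L)"
    unfolding given_empty_def by simp
  ultimately have LE: "integrable (given_empty M L) (\<lambda>w. real (L t w)) \<and> (LINT w|given_empty M L. real (L t w)) = E"
    using \<open>0 \<le> E\<close> by (subst nn_integral_eq_integrable[symmetric]) auto
  have E_eq: "E = real k * (lam - mu) / c\<^sub>1 * t powr \<alpha>\<^sub>1 *
        mittag_leffler3 1 (\<alpha>\<^sub>1 - \<alpha>\<^sub>2) (\<alpha>\<^sub>1 + 1) (- (c\<^sub>2 / c\<^sub>1) * t powr (\<alpha>\<^sub>1 - \<alpha>\<^sub>2)) +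
      real k * mu * (\<Sum>m. \<Sum>r. summand (Suc m) r)"
    unfolding E_def R_def sums(3) by simp
  show ?thesis
  proof (intro conjI allI impI)
    show "summable (summand m)" if "1 \<le> m" for m using sums(1)[of "m - 1"] that by simp
  qed (use LE sums(2) E_eq in \<open>simp_all add: mean_queue_length_def\<close>)
qed

end
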